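(* Let $d\ge1$ and let $\mathbf{r}=(r_1,\ldots,r_d)\colon\mathbb{N}\to(0,\frac12)^d$ with $|\mathbf{r}(n)|_\infty\to0$ as $n\to\infty$. Let $\mathcal{A}=(A_n)_{n\in\mathbb{N}}$ be a sequence of integral $d\times d$ matrices. Assume that $\det(A_m-A_n)\ne0$ for all $m,n\in\mathbb{N}$ with $m\ne n$. Let $f$ be a dimension function such that $s\preceq f\preceq s+1$ for some integer $s\in[0,d-1]$. Then, for $\mathcal{L}^d$-almost all $\boldsymbol\alpha\in[0,1)^d$, we have $$\mathcal{H}^f\big(\mathcal{T}_{\boldsymbol\alpha}(\mathcal{A},\mathbf{r})\big)=\begin{cases}0,&\text{if }\sum_{n=1}^\infty s_n(\mathbf{r},f)<\infty,\\ \mathcal{H}^f([0,1)^d),&\text{if }\sum_{n=1}^\infty s_n(\mathbf{r},f)=\infty,\end{cases}$$ where $$s_n(\mathbf{r},f)=\min_{1\le i\le d}\left\{f(r_i(n))\prod_{j\colon r_j(n)\ge r_i(n)}\frac{r_j(n)}{r_i(n)}\right\}.$$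
   Context: $\mathbb{N}=\{1,2,\ldots\}$. $\mathcal{L}^d$ is $d$-dimensional Lebesgue measure. $\|x\|$ denotes the distance from a real number $x$ to the nearest integer, and $|\mathbf{x}|_\infty=\max_i|x_i|$. A dimension function is a continuous, non-decreasing function $f\colon(0,\infty)\to(0,\infty)$ such that $f(\rho)\to0$ as $\rho\to0^+$. For $t\ge0$, $f\preceq t$ means that $\frac{f(y)}{y^t}\le\frac{f(x)}{x^t}$ for all $0<x<y$; and $t\preceq f$ means that $\frac{f(x)}{x^t}\le\frac{f(y)}{y^t}$ for all $0<x<y$. For $E\subset\mathbb{R}^d$ and $\eta>0$, $\mathcal{H}^f_\eta(E)=\inf\{\sum_i f(|B_i|):E\subset\bigcup_{i\ge1}B_i,\ |B_i|\le\eta\}$, where the $B_i$ are balls and $|B|$ is the diameter of a ball $B$. The Hausdorff $f$-measure of $E$ is $\mathcal{H}^f(E)=\lim_{\eta\to0^+}\mathcal{H}^f_\eta(E)$. $\mathcal{R}_n(\mathbf{r})=\{\mathbf{x}\in[0,1)^d:\|x_i\|\le r_i(n),\ 1\le i\le d\}$, and $$\mathcal{T}_{\boldsymbol\alpha}(\mathcal{A},\mathbf{r})=\{\boldsymbol\beta\in[0,1)^d: A_n\boldsymbol\alpha\in\boldsymbol\beta+\mathcal{R}_n(\mathbf{r})\ (\mathrm{mod}\ 1)\text{ for infinitely many } n\in\mathbb{N}\},$$ i.e. $\boldsymbol\beta$ belongs to this set iff for infinitely many $n$ one has $\|(A_n\boldsymbol\alpha)_i-\beta_i\|\le r_i(n)$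 for all $1\le i\le d$. *)

theory Defs
  imports "HOL-Analysis.Analysis"
begin

text \<open>Gauge functions live on the open half-line; a function \<^typ>\<open>real \<Rightarrow> real\<close> is only
  ever constrained and evaluated at positive arguments.\<close>

definition dimension_function :: "(real \<Rightarrow> real) \<Rightarrow> bool" where
  "dimension_function f \<longleftrightarrow>
     continuous_on {0<..} f \<and> mono_on {0<..} f \<and> (\<forall>x>0. f x > 0) \<and> (f \<longlongrightarrow> 0) (at_right 0)"

definition fun_preceq :: "(real \<Rightarrow> real) \<Rightarrow> real \<Rightarrow> bool" where
  "fun_preceq f t \<longleftrightarrow> (\<forall>x y. 0 < x \<longrightarrow> x < y \<longrightarrow> f y / y powr t \<le> f x / x powr t)"

definition preceq_fun :: "real \<Rightarrow> (real \<Rightarrow> real) \<Rightarrow> bool" where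
  "preceq_fun t f \<longleftrightarrow> (\<forall>x y. 0 < x \<longrightarrow> x < y \<longrightarrow> f x / x powr t \<le> f y / y powr t)"

text \<open>Covers use (open or closed) balls of positive radius, so that \<^term>\<open>f (diameter B)\<close> is
  always meaningful. Covers by infinite sequences suffice: since gauge functions vanish at
  \<^term>\<open>0::real\<close>, a finite cover can be padded with balls of arbitrarily small total cost.\<close>

definition is_ball :: "'a::metric_space set \<Rightarrow> bool" where
  "is_ball B \<longleftrightarrow> (\<exists>c r. r > 0 \<and> (B = ball c r \<or> B = cball c r))"

definition hausdorff_premeasure ::
    "(real \<Rightarrow> real) \<Rightarrow> real \<Rightarrow> 'a::metric_space set \<Rightarrow> ennreal" where
  "hausdorff_premeasure f \<eta> E =
     Inf {(\<Sum>i. ennreal (f (diameter (B i)))) | B :: nat \<Rightarrow> 'a set.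
            (\<forall>i. is_ball (B i) \<and> diameter (B i) \<le> \<eta>) \<and> E \<subseteq> (\<Union>i. B i)}"

definition hausdorff_measure :: "(real \<Rightarrow> real) \<Rightarrow> 'a::metric_space set \<Rightarrow> ennreal" where
  "hausdorff_measure f E = Lim (at_right 0) (\<lambda>\<eta>. hausdorff_premeasure f \<eta> E)"

lemma hausdorff_premeasure_antimono:
  assumes "\<eta> \<le> \<eta>'"
  shows "hausdorff_premeasure f \<eta>' E \<le> hausdorff_premeasure f \<eta> E"
  unfolding hausdorff_premeasure_def
proof (rule Inf_superset_mono, rule Collect_mono, rule impI)
  fix x assume "\<exists>B. x = (\<Sum>i. ennreal (f (diameter (B i)))) \<and>
    (\<forall>i. is_ball (B i) \<and> diameter (B i) \<le> \<eta>) \<and> E \<subseteq> (\<Union>i. B i)"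
  then obtain B where B: "x = (\<Sum>i. ennreal (f (diameter (B i))))"
    "\<And>i. is_ball (B i) \<and> diameter (B i) \<le> \<eta>" "E \<subseteq> (\<Union>i. B i)"
    by (elim exE conjE) (rule that, simp_all)
  have "is_ball (B i) \<and> diameter (B i) \<le> \<eta>'" for i
    using B(2)[of i] assms by simp
  with B(1,3) show "\<exists>B. x = (\<Sum>i. ennreal (f (diameter (B i)))) \<and>
    (\<forall>i. is_ball (B i) \<and> diameter (B i) \<le> \<eta>') \<and> E \<subseteq> (\<Union>i. B i)"
    by (intro exI[of _ B] conjI allI) simp_all
qed

lemma tendsto_hausdorff_premeasure:
  "((\<lambda>\<eta>. hausdorff_premeasure f \<eta> E) \<longlongrightarrow> (SUP \<eta>\<in>{0<..}. hausdorff_premeasure f \<eta> E)) (at_right 0)"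
proof (rule order_tendstoI)
  fix a assume "a < (SUP \<eta>\<in>{0<..}. hausdorff_premeasure f \<eta> E)"
  then obtain \<eta> where \<eta>: "\<eta> > 0" "a < hausdorff_premeasure f \<eta> E"
    by (auto simp: less_SUP_iff)
  show "\<forall>\<^sub>F x in at_right 0. a < hausdorff_premeasure f x E"
    using eventually_at_right_real[OF \<eta>(1)]
  proof eventually_elim
    case (elim x)
    then show ?case
      using \<eta>(2) hausdorff_premeasure_antimono[of x \<eta> f E] by auto
  qed
next
  fix a assume a: "(SUP \<eta>\<in>{0<..}. hausdorff_premeasure f \<eta> E) < a"
  show "\<forall>\<^sub>F x in at_right 0. hausdorff_premeasure f x E < a"
    using eventually_at_right_less[of "0::real"]
  proof eventually_elim
    case (elim x)
    then have "hausdorff_premeasure f x E \<le> (SUP \<eta>\<in>{0<..}. hausdorff_premeasure f \<eta> E)"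
      by (intro SUP_upper) auto
    with a show ?case by simp
  qed
qed

lemma hausdorff_measure_eq_SUP:
  "hausdorff_measure f E = (SUP \<eta>\<in>{0<..}. hausdorff_premeasure f \<eta> E)"
  unfolding hausdorff_measure_def
  by (rule tendsto_Lim[OF _ tendsto_hausdorff_premeasure]) simp

definition dist_to_int :: "real \<Rightarrow> real" where
  "dist_to_int x = \<bar>x - of_int (round x)\<bar>"

definition unit_cube :: "(real ^ 'n) set" where
  "unit_cube = {x. \<forall>i. 0 \<le> x $ i \<and> x $ i < 1}"

definition target_rectangle :: "(nat \<Rightarrow> real ^ 'n) \<Rightarrow> nat \<Rightarrow> (real ^ 'n) set" where
  "target_rectangle r n = {x \<in> unit_cube. \<forall>i. dist_to_int (x $ i) \<le> r n $ i}"

definition cong_mod_1 :: "real ^ 'n \<Rightarrow> real ^ 'n \<Rightarrow> bool" where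
  "cong_mod_1 x y \<longleftrightarrow> (\<forall>i. x $ i - y $ i \<in> \<int>)"

text \<open>Sequences are indexed by the positive integers; their values at \<^term>\<open>0::nat\<close> are
  ignored.\<close>

definition twisted_set ::
    "real ^ 'n \<Rightarrow> (nat \<Rightarrow> int ^ 'n ^ 'n) \<Rightarrow> (nat \<Rightarrow> real ^ 'n) \<Rightarrow> (real ^ 'n) set" where
  "twisted_set \<alpha> A r =
     {\<beta> \<in> unit_cube. infinite {n. n \<ge> 1 \<and>
        (\<exists>\<rho> \<in> target_rectangle r n. cong_mod_1 (map_matrix real_of_int (A n) *v \<alpha>) (\<beta> + \<rho>))}}"

lemma dist_to_int_diff_Ints:
  assumes "x - y \<in> \<int>"
  shows "dist_to_int x = dist_to_int y"
proof -
  obtain k where k: "x = y + of_int k"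
    using assms by (metis Ints_cases add.commute diff_add_cancel)
  have "round x = round y + k"
    unfolding k round_def by (metis add.commute add.left_commute floor_add_int)
  then show ?thesis
    by (simp add: dist_to_int_def k)
qed

lemma twisted_set_eq:
  "twisted_set \<alpha> A r =
     {\<beta> \<in> unit_cube. infinite {n. n \<ge> 1 \<and>
        (\<forall>i. dist_to_int ((map_matrix real_of_int (A n) *v \<alpha>) $ i - \<beta> $ i) \<le> r n $ i)}}"
proof -
  have "(\<exists>\<rho> \<in> target_rectangle r n. cong_mod_1 x (\<beta> + \<rho>)) \<longleftrightarrow>
        (\<forall>i. dist_to_int (x $ i - \<beta> $ i) \<le> r n $ i)" (is "?L \<longleftrightarrow> ?R") for x \<beta> n
  proof
    assume ?L
    then obtain \<rho> where \<rho>: "\<And>i. dist_to_int (\<rho> $ i) \<le> r n $ i" "\<And>i. x $ i - (\<beta> $ i + \<rho> $ i) \<in> \<int>"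
      by (auto simp: target_rectangle_def cong_mod_1_def)
    have "dist_to_int (x $ i - \<beta> $ i) = dist_to_int (\<rho> $ i)" for i
      by (rule dist_to_int_diff_Ints) (use \<rho>(2)[of i] in \<open>simp add: algebra_simps\<close>)
    with \<rho>(1) show ?R by simp
  next
    assume R: ?R
    define \<rho> :: "real ^ 'a" where "\<rho> = (\<chi> i. frac (x $ i - \<beta> $ i))"
    have "dist_to_int (\<rho> $ i) = dist_to_int (x $ i - \<beta> $ i)" for i
      by (rule dist_to_int_diff_Ints) (simp add: \<rho>_def frac_def)
    then have "\<rho> \<in> target_rectangle r n"
      using R by (simp add: target_rectangle_def unit_cube_def \<rho>_def frac_lt_1)
    moreover have "cong_mod_1 x (\<beta> + \<rho>)"
      by (simp add: cong_mod_1_def \<rho>_def frac_def)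
    ultimately show ?L by blast
  qed
  then show ?thesis by (simp add: twisted_set_def)
qed

definition s_coeff :: "(nat \<Rightarrow> real ^ 'n) \<Rightarrow> (real \<Rightarrow> real) \<Rightarrow> nat \<Rightarrow> real" where
  "s_coeff r f n =
     (MIN i. f (r n $ i) * (\<Prod>j | r n $ j \<ge> r n $ i. r n $ j / r n $ i))"

end

theory Submission
  imports Defs "HOL-Probability.Probability_Measure"
begin

text \<open>Write \<open>T\<close> for the twisted set of \<open>\<alpha>\<close>: it is the limsup of boxes of half-sides \<open>r n $ i\<close> around
  the points \<open>A n *v \<alpha>\<close> of the torus. The number \<open>s_coeff r f n\<close> is, up to constants, the least cost
  of covering the \<open>n\<close>-th box by balls of equal size. If these costs are summable, then the boxes of
  large index are economical covers of \<open>T\<close>, and the Hausdorff measure vanishes for every \<open>\<alpha>\<close>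
  (\<open>hausdorff_measure_limsup_rectangles_eq_0\<close>).

  In the divergence case randomness enters in only one place. For \<open>(\<alpha>, \<beta>)\<close> uniform in two copies of the
  cube and \<open>m \<noteq> n\<close>, the differences \<open>A m *v \<alpha> - \<beta>\<close> and \<open>A n *v \<alpha> - \<beta>\<close> are independent and uniform
  modulo 1: their difference is the image of \<open>\<alpha>\<close> under a surjective endomorphism of the torus, and
  \<open>\<beta>\<close> contributes an independent translation. Chebyshev's inequality and Fubini's theorem then show
  that, for almost every \<open>\<alpha>\<close>, boxes around the points \<open>A n *v \<alpha>\<close> with divergent sum of volumes
  cover almost every \<open>\<beta>\<close> infinitely often (\<open>AE_infinitely_often_near_mod_1\<close>).

  If \<open>f x \<le> C * x ^ d\<close>, where \<open>d\<close> is the dimension, divergence of the costs forces divergence of the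
  volumes, so \<open>T\<close> has full Lebesgue measure, and Lebesgue null sets are \<open>f\<close>-null.
  Otherwise \<open>f x / x ^ d\<close> tends to infinity at 0, and a mass transference argument shows that the
  measure of \<open>T\<close> is infinite. Given \<open>c > 0\<close>, enlarge the \<open>n\<close>-th box to half-sides \<open>max (r n $ i) l\<close>, where
  \<open>l\<close> is chosen such that the part of the original box in a cube of size \<open>l\<close> has cost \<open>c * l ^ d\<close>
  (\<open>critical_scale\<close>). The enlarged boxes have volumes with divergent sum, hence cover almost everything.
  Each is covered by balls of radius comparable to \<open>l\<close>, and each of these balls contains a piece \<open>E\<close>
  of the original box such that the uniform distribution on \<open>E\<close> with total mass the volume of the ball
  gives mass at most \<open>f \<rho> / c\<close> to every ball of radius \<open>\<rho>\<close> (\<open>gauge_piece_of_enlarged_rectangle\<close>).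

  Now start with Lebesgue measure on the open cube and repeat: if the current measure has density
  at most \<open>c\<close>, take finitely many disjoint balls from the Vitali covering theorem that carry enough of its
  mass, and move the mass of each ball to the piece inside it (\<open>spread_measure_refine\<close>). Mass moves
  only within tiny balls, so large balls keep almost the same mass; a small ball which meets a single
  piece has mass at most \<open>c * (f \<rho> / c)\<close>; a small ball which meets several pieces is not much smaller than
  the balls around them, so it has mass of order \<open>c * \<rho> ^ d\<close>, which is below \<open>f \<rho>\<close>. Taking pieces for the
  constant \<open>c\<close>, which depends on the stage, is what keeps the bounds uniform along the construction.
  The supports shrink to a compact subset of \<open>T\<close>; a cover of this set by balls also covers some
  stage, where it must pay for a fixed mass (\<open>hausdorff_premeasure_limsup_lower_bound\<close>). The same
  applies to \<open>f / M\<close> for every \<open>M\<close>, so the Hausdorff measure exceeds every bound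
  (\<open>mass_transference_gauge_pieces\<close>).\<close>

section \<open>The covering cost of a box\<close>

text \<open>Up to a constant factor, a box with half-sides \<open>v $ j\<close> is covered by as many balls of radius \<open>\<rho>\<close> as
  the product says. Factors clipped at 1 make the expression continuous in \<open>v\<close> and \<open>\<rho>\<close>.\<close>
definition box_cost :: "(real \<Rightarrow> real) \<Rightarrow> real ^ 'n \<Rightarrow> real \<Rightarrow> real" where
  "box_cost f v \<rho> = f \<rho> * (\<Prod>j\<in>UNIV. max 1 (v $ j / \<rho>))"

definition box_content :: "(real \<Rightarrow> real) \<Rightarrow> real ^ 'n \<Rightarrow> real" where
  "box_content f v = (MIN i. box_cost f v (v $ i))"

lemma s_coeff_eq_box_content:
  fixes r :: "nat \<Rightarrow> real ^ 'n"
  assumes "\<And>i. 0 < r n $ i"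
  shows "s_coeff r f n = box_content f (r n)"
proof -
  have "(\<Prod>j | r n $ j \<ge> r n $ i. r n $ j / r n $ i) = (\<Prod>j\<in>UNIV. max 1 (r n $ j / r n $ i))" for i
    using assms[of i] by (intro prod.mono_neutral_cong_left) (auto simp: max_def field_simps)
  then show ?thesis
    by (simp add: s_coeff_def box_content_def box_cost_def)
qed

lemma box_content_attained:
  obtains i where "box_content f v = box_cost f v (v $ i)"
proof -
  have "box_content f v \<in> range (\<lambda>i. box_cost f v (v $ i))"
    unfolding box_content_def by (intro Min_in) auto
  then show ?thesis using that by auto
qed

lemma box_content_le: "box_content f v \<le> box_cost f v (v $ i)"
  unfolding box_content_def by (intro Min_le) auto

locale gauge_between_powers =
  fixes f :: "real \<Rightarrow> real" and s :: nat
  assumes dim_fun: "dimension_function f"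
    and above: "preceq_fun (real s) f"
    and below: "fun_preceq f (real (s + 1))"
begin

lemma f_pos: "0 < x \<Longrightarrow> 0 < f x"
  using dim_fun by (auto simp: dimension_function_def)

lemma f_mono: "0 < x \<Longrightarrow> x \<le> y \<Longrightarrow> f x \<le> f y"
  using dim_fun by (auto simp: dimension_function_def mono_on_def)

lemma f_tendsto_0: "(f \<longlongrightarrow> 0) (at_right 0)"
  using dim_fun by (auto simp: dimension_function_def)

lemma f_cont: "continuous_on {0<..} f"
  using dim_fun by (auto simp: dimension_function_def)

lemma quotient_mono:
  assumes "k \<le> s" "0 < x" "x \<le> y"
  shows "f x / x ^ k \<le> f y / y ^ k"
proof -
  have xy: "f x / x ^ s \<le> f y / y ^ s"
    using above assms by (cases "x = y") (auto simp: preceq_fun_def powr_realpow)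
  have "f x / x ^ k = f x / x ^ s * x ^ (s - k)"
    using assms by (simp add: power_diff)
  also have "\<dots> \<le> f y / y ^ s * y ^ (s - k)"
    using assms f_pos[of y] xy by (intro mult_mono power_mono) auto
  also have "\<dots> = f y / y ^ k"
    using assms by (simp add: power_diff)
  finally show ?thesis .
qed

lemma quotient_antimono:
  assumes "k > s" "0 < x" "x \<le> y"
  shows "f y / y ^ k \<le> f x / x ^ k"
proof -
  have xy: "f y / y ^ (s + 1) \<le> f x / x ^ (s + 1)"
  proof (cases "x = y")
    case False
    then have "f y / y powr (real (s + 1)) \<le> f x / x powr (real (s + 1))"
      using below assms by (auto simp: fun_preceq_def)
    then show ?thesis
      using assms by (simp only: powr_realpow)
  qed auto
  have "f y / y ^ k = f y / y ^ (s+1) * (1 / y) ^ (k - (s+1))"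
    using assms by (simp add: power_diff power_one_over)
  also have "\<dots> \<le> f x / x ^ (s+1) * (1 / x) ^ (k - (s+1))"
    using assms f_pos[of x] xy by (intro mult_mono power_mono) (auto simp: frac_le)
  also have "\<dots> = f x / x ^ k"
    using assms by (simp add: power_diff power_one_over)
  finally show ?thesis .
qed

lemma f_scale: 
  assumes "1 \<le> K" "0 < x"
  shows "f (K * x) \<le> K ^ (s + 1) * f x"
proof -
  have "x \<le> K * x" using assms by simp
  then have "f (K * x) / (K * x) ^ (s+1) \<le> f x / x ^ (s+1)"
    using assms by (intro quotient_antimono) auto
  then have "f (K * x) \<le> f x / x ^ (s+1) * (K * x) ^ (s+1)"
    using assms by (subst (asm) pos_divide_le_eq) auto
  also have "\<dots> = K ^ (s+1) * f x"
    using assms by (simp add: field_simps)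
  finally show ?thesis .
qed

text \<open>Among all radii, the half-sides of the box are the ones at which covering is cheapest. Between two
  consecutive half-sides the cost is a constant times \<open>f \<rho> / \<rho> ^ k\<close>, where \<open>k\<close> counts the half-sides
  above \<open>\<rho>\<close>; this is nondecreasing if \<open>k \<le> s\<close> and nonincreasing if \<open>k > s\<close>. So moving \<open>\<rho>\<close> down to
  the next half-side in the first case, and up in the second, does not raise the cost.

  The bound is used both ways: the content is at most the cost at \<open>\<rho>\<close>, and, equivalently, the uniform
  distribution on the box with mass \<open>box_content f v\<close> gives mass at most \<open>f \<rho>\<close> to a ball of radius \<open>\<rho>\<close>.\<close>
lemma box_content_le_box_cost:
  fixes v :: "real ^ 'n"
  assumes s_less: "s < CARD('n)" and v: "\<And>i. 0 < v $ i" and \<rho>: "0 < \<rho>"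
  shows "box_content f v \<le> box_cost f v \<rho>"
proof -
  define J where "J = {j. v $ j > \<rho>}"
  have cost: "box_cost f v t = (\<Prod>j\<in>J. v $ j) * (f t / t ^ card J)"
    if "0 < t" "\<And>j. j \<in> J \<Longrightarrow> t \<le> v $ j" "\<And>j. j \<notin> J \<Longrightarrow> v $ j \<le> t" for t
  proof -
    have "(\<Prod>j\<in>UNIV. max 1 (v $ j / t)) = (\<Prod>j\<in>J. v $ j / t)"
      using that by (intro prod.mono_neutral_cong_right) (auto simp: max_def field_simps intro: antisym)
    then show ?thesis
      by (simp add: box_cost_def prod_dividef)
  qed
  have prod_pos: "0 \<le> (\<Prod>j\<in>J. v $ j)"
    using v by (intro prod_nonneg) (auto simp: less_imp_le)
  show ?thesis
  proof (cases "card J \<le> s")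
    case True
    with s_less have "J \<noteq> UNIV" by auto
    then have ne: "- J \<noteq> {}" by auto
    have "Max ((\<lambda>j. v $ j) ` (- J)) \<in> (\<lambda>j. v $ j) ` (- J)"
      using ne by (intro Max_in) auto
    then obtain i where i: "i \<notin> J" "v $ i = Max ((\<lambda>j. v $ j) ` (- J))"
      by auto
    then have max: "v $ j \<le> v $ i" if "j \<notin> J" for j
      using that by (metis Compl_iff Max_ge finite_code finite_imageI image_eqI)
    have *: "v $ i \<le> \<rho>" using i by (auto simp: J_def)
    have "box_content f v \<le> box_cost f v (v $ i)" by (rule box_content_le)
    also have "\<dots> = (\<Prod>j\<in>J. v $ j) * (f (v $ i) / (v $ i) ^ card J)"
      using i(1) max * v by (intro cost) (auto simp: J_def)
    also have "\<dots> \<le> (\<Prod>j\<in>J. v $ j) * (f \<rho> / \<rho> ^ card J)"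
      using * v True prod_pos by (intro mult_left_mono quotient_mono) auto
    also have "\<dots> = box_cost f v \<rho>"
      using \<rho> by (intro cost[symmetric]) (auto simp: J_def)
    finally show ?thesis .
  next
    case False
    then have ne: "J \<noteq> {}" by auto
    have "Min ((\<lambda>j. v $ j) ` J) \<in> (\<lambda>j. v $ j) ` J"
      using ne by (intro Min_in) auto
    then obtain i where i: "i \<in> J" "v $ i = Min ((\<lambda>j. v $ j) ` J)"
      by auto
    then have min: "v $ i \<le> v $ j" if "j \<in> J" for j
      using that by (metis Min_le finite_code finite_imageI image_eqI)
    have *: "\<rho> < v $ i" using i by (auto simp: J_def)
    have "box_content f v \<le> box_cost f v (v $ i)" by (rule box_content_le)
    also have "\<dots> = (\<Prod>j\<in>J. v $ j) * (f (v $ i) / (v $ i) ^ card J)"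
      using i(1) min * v by (intro cost) (auto simp: J_def)
    also have "\<dots> \<le> (\<Prod>j\<in>J. v $ j) * (f \<rho> / \<rho> ^ card J)"
      using * v \<rho> False prod_pos by (intro mult_left_mono quotient_antimono) auto
    also have "\<dots> = box_cost f v \<rho>"
      using \<rho> by (intro cost[symmetric]) (auto simp: J_def)
    finally show ?thesis .
  qed
qed

lemma box_content_pos:
  fixes v :: "real ^ 'n"
  assumes "\<And>i. 0 < v $ i"
  shows "0 < box_content f v"
proof -
  obtain i where "box_content f v = box_cost f v (v $ i)" by (rule box_content_attained)
  then show ?thesis
    using f_pos assms by (auto simp: box_cost_def intro!: mult_pos_pos prod_pos)
qed

text \<open>Subadditivity of the content: cutting a box into cells of size \<open>l\<close> produces the number of cells given
  by the product, each a box with half-sides \<open>min (v $ i) l\<close>.\<close>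
lemma box_content_truncate:
  fixes v :: "real ^ 'n"
  assumes s_less: "s < CARD('n)" and v: "\<And>i. 0 < v $ i" and l: "0 < l"
  shows "box_content f v \<le> box_content f (\<chi> i. min (v $ i) l) * (\<Prod>j\<in>UNIV. max 1 (v $ j / l))"
proof -
  define m where "m = (\<chi> i. min (v $ i) l)"
  have m: "m $ i = min (v $ i) l" for i by (simp add: m_def)
  obtain i where i: "box_content f m = box_cost f m (m $ i)" by (rule box_content_attained)
  have mi: "0 < m $ i" "m $ i \<le> l" using v l by (auto simp: m)
  have *: "max 1 (m $ j / m $ i) * max 1 (v $ j / l) = max 1 (v $ j / m $ i)" for j
  proof (cases "v $ j \<le> l")
    case True
    then show ?thesis using l by (simp add: m[of j])
  next
    case False
    then have "1 \<le> l / m $ i" "1 \<le> v $ j / l" "1 \<le> v $ j / m $ i"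
      using mi l by (auto simp: divide_simps)
    then show ?thesis
      using False l mi by (simp add: m[of j] max_def)
  qed
  have "box_content f v \<le> box_cost f v (m $ i)"
    using s_less v mi by (intro box_content_le_box_cost) auto
  also have "\<dots> = box_content f m * (\<Prod>j\<in>UNIV. max 1 (v $ j / l))"
    unfolding i box_cost_def by (simp add: prod.distrib[symmetric] * mult.assoc)
  finally show ?thesis by (simp add: m_def)
qed

end

section \<open>Hausdorff measures\<close>

lemma is_ball_cball: "0 < r \<Longrightarrow> is_ball (cball c r)"
  by (auto simp: is_ball_def)

lemma hausdorff_premeasure_le_cover:
  assumes "\<And>i. is_ball (B i)" "\<And>i. diameter (B i) \<le> \<eta>" "E \<subseteq> (\<Union>i. B i)"
  shows "hausdorff_premeasure f \<eta> E \<le> (\<Sum>i. ennreal (f (diameter (B i))))"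
  unfolding hausdorff_premeasure_def using assms by (intro Inf_lower) blast

lemma hausdorff_premeasure_mono:
  assumes "E \<subseteq> F"
  shows "hausdorff_premeasure f \<eta> E \<le> hausdorff_premeasure f \<eta> F"
  unfolding hausdorff_premeasure_def
  by (rule Inf_superset_mono) (use assms in blast)

lemma hausdorff_measure_mono:
  assumes "E \<subseteq> F"
  shows "hausdorff_measure f E \<le> hausdorff_measure f F"
  unfolding hausdorff_measure_eq_SUP
  by (intro SUP_mono) (use hausdorff_premeasure_mono[OF assms] in blast)

lemma hausdorff_premeasure_le_measure:
  "0 < \<eta> \<Longrightarrow> hausdorff_premeasure f \<eta> E \<le> hausdorff_measure f E"
  unfolding hausdorff_measure_eq_SUP by (intro SUP_upper) auto

lemma suminf_ennreal_geometric_half: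
  assumes "0 \<le> e"
  shows "(\<Sum>i. ennreal (e * (1/2) ^ Suc i)) = ennreal e"
proof -
  have "(\<lambda>i. e * (1/2) ^ Suc i) sums (e * 1)"
    by (intro sums_mult power_half_series)
  then show ?thesis
    using assms by (intro suminf_ennreal_eq) auto
qed

text \<open>Covers are infinite sequences of nondegenerate balls, so a finite or empty cover has to be padded.
  The gauge vanishes at 0, so padding costs arbitrarily little.\<close>
lemma cheap_balls:
  assumes f: "dimension_function f" and "0 < \<eta>" "0 < e"
  obtains B :: "nat \<Rightarrow> 'a::euclidean_space set"
  where "\<And>i. is_ball (B i)" "\<And>i. diameter (B i) \<le> \<eta>"
    "(\<Sum>i. ennreal (f (diameter (B i)))) \<le> ennreal e"
proof -
  have "\<exists>r>0. 2 * r \<le> \<eta> \<and> f (2 * r) \<le> e * (1/2) ^ Suc i" for i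
  proof -
    have "eventually (\<lambda>x. f x < e * (1/2) ^ Suc i) (at_right 0)"
      using f \<open>0 < e\<close> unfolding dimension_function_def by (intro order_tendstoD(2)) auto
    moreover have "eventually (\<lambda>x::real. x \<in> {0<..<\<eta>}) (at_right 0)"
      using \<open>0 < \<eta>\<close> by (rule eventually_at_right_real)
    ultimately have "eventually (\<lambda>x. x \<in> {0<..<\<eta>} \<and> f x < e * (1/2) ^ Suc i) (at_right 0)"
      by eventually_elim auto
    then obtain x where "x \<in> {0<..<\<eta>}" "f x < e * (1/2) ^ Suc i"
      using eventually_happens[of _ "at_right (0::real)"] trivial_limit_at_right_real by blast
    then show ?thesis by (intro exI[of _ "x/2"]) auto
  qed
  then obtain r where r: "\<And>i. 0 < r i" "\<And>i. 2 * r i \<le> \<eta>"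
      "\<And>i. f (2 * r i) \<le> e * (1/2) ^ Suc i"
    by metis
  show ?thesis
  proof (rule that[of "\<lambda>i. ball 0 (r i)"])
    have nonneg: "\<not> r i < 0" for i using r(1)[of i] by simp
    show "is_ball (ball (0::'a) (r i))" for i using r by (auto simp: is_ball_def)
    show "diameter (ball (0::'a) (r i)) \<le> \<eta>" for i using r(1)[of i] r(2)[of i] by simp
    have "(\<Sum>i. ennreal (f (diameter (ball (0::'a) (r i))))) \<le> (\<Sum>i. ennreal (e * (1/2) ^ Suc i))"
      using r(3) by (intro suminf_le ennreal_leI) (simp_all add: nonneg)
    also have "\<dots> = ennreal e"
      using \<open>0 < e\<close> by (intro suminf_ennreal_geometric_half) auto
    finally show "(\<Sum>i. ennreal (f (diameter (ball (0::'a) (r i))))) \<le> ennreal e" .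
  qed
qed

lemma hausdorff_premeasure_empty:
  assumes "dimension_function f" "0 < \<eta>"
  shows "hausdorff_premeasure f \<eta> ({} :: 'a::euclidean_space set) = 0"
proof -
  have "hausdorff_premeasure f \<eta> ({} :: 'a set) \<le> 0"
  proof (rule ennreal_le_epsilon)
    fix e :: real assume "0 < e"
    obtain B :: "nat \<Rightarrow> 'a set" where B: "\<And>i. is_ball (B i)" "\<And>i. diameter (B i) \<le> \<eta>"
      "(\<Sum>i. ennreal (f (diameter (B i)))) \<le> ennreal e"
      using cheap_balls[OF assms \<open>0 < e\<close>] by blast
    show "hausdorff_premeasure f \<eta> ({} :: 'a set) \<le> 0 + ennreal e"
      using hausdorff_premeasure_le_cover[where B = B and \<eta> = \<eta> and E = "{}" and f = f] B by auto
  qed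
  then show ?thesis by simp
qed

lemma hausdorff_premeasure_ball:
  fixes b :: "'a::euclidean_space set"
  assumes f: "dimension_function f" and \<eta>: "0 < \<eta>" and b: "is_ball b" "diameter b \<le> \<eta>"
  shows "hausdorff_premeasure f \<eta> b \<le> ennreal (f (diameter b))"
proof (rule ennreal_le_epsilon)
  fix e :: real assume "0 < e"
  obtain B :: "nat \<Rightarrow> 'a set" where B: "\<And>i. is_ball (B i)" "\<And>i. diameter (B i) \<le> \<eta>"
      "(\<Sum>i. ennreal (f (diameter (B i)))) \<le> ennreal e"
    using cheap_balls[OF f \<eta> \<open>0 < e\<close>] by blast
  define B' where "B' = (\<lambda>i::nat. if i = 0 then b else B i)"
  have "hausdorff_premeasure f \<eta> b \<le> (\<Sum>i. ennreal (f (diameter (B' i))))"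
    using b B by (intro hausdorff_premeasure_le_cover) (auto simp: B'_def)
  also have "\<dots> \<le> (\<Sum>i. (if i = 0 then ennreal (f (diameter b)) else 0) + ennreal (f (diameter (B i))))"
    by (intro suminf_le) (auto simp: B'_def)
  also have "\<dots> = (\<Sum>i. (if i = (0::nat) then ennreal (f (diameter b)) else 0)) + (\<Sum>i. ennreal (f (diameter (B i))))"
    by (rule suminf_add[symmetric]) auto
  also have "(\<Sum>i. (if i = (0::nat) then ennreal (f (diameter b)) else 0)) = ennreal (f (diameter b))"
    by (subst suminf_finite[of "{0}"]) auto
  finally show "hausdorff_premeasure f \<eta> b \<le> ennreal (f (diameter b)) + ennreal e"
    using B(3) by (meson add_left_mono order_trans)
qed

lemma hausdorff_premeasure_countable_subadditive:
  fixes E :: "nat \<Rightarrow> 'a::metric_space set"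
  shows "hausdorff_premeasure f \<eta> (\<Union>k. E k) \<le> (\<Sum>k. hausdorff_premeasure f \<eta> (E k))"
proof (cases "\<forall>k. hausdorff_premeasure f \<eta> (E k) < \<infinity>")
  case False
  then obtain k where "hausdorff_premeasure f \<eta> (E k) = \<infinity>"
    using infinity_ennreal_def top.not_eq_extremum by metis
  moreover have "hausdorff_premeasure f \<eta> (E k) \<le> (\<Sum>k. hausdorff_premeasure f \<eta> (E k))"
    using sum_le_suminf[of "\<lambda>k. hausdorff_premeasure f \<eta> (E k)" "{k}"] by auto
  ultimately show ?thesis by (simp add: top_unique)
next
  case fin: True
  show ?thesis
  proof (rule ennreal_le_epsilon)
    fix e :: real assume "0 < e"
    have "\<exists>B. (\<forall>i. is_ball (B i) \<and> diameter (B i) \<le> \<eta>) \<and> E k \<subseteq> (\<Union>i. B i) \<and>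
      (\<Sum>i. ennreal (f (diameter (B i)))) \<le> hausdorff_premeasure f \<eta> (E k) + ennreal (e * (1/2) ^ Suc k)"
      (is "\<exists>B. ?P B \<and> ?Q B \<and> ?R B") for k
    proof -
      have "hausdorff_premeasure f \<eta> (E k) < hausdorff_premeasure f \<eta> (E k) + ennreal (e * (1/2) ^ Suc k)"
        using fin[rule_format, of k] \<open>0 < e\<close>
        by (cases "hausdorff_premeasure f \<eta> (E k)")
          (auto simp: ennreal_plus[symmetric] ennreal_less_iff simp del: ennreal_plus)
      from this[unfolded hausdorff_premeasure_def[of f \<eta> "E k"]] obtain x B
        where "x < Inf {\<Sum>i. ennreal (f (diameter (B i))) |B. (\<forall>i. is_ball (B i) \<and> diameter (B i) \<le> \<eta>) \<and> E k \<subseteq> \<Union> (range B)} +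
         ennreal (e * (1 / 2) ^ Suc k)" "x = (\<Sum>i. ennreal (f (diameter (B i))))" "?P B" "?Q B"
        unfolding Inf_less_iff by auto
      then show ?thesis
        unfolding hausdorff_premeasure_def[of f \<eta> "E k"]
        by (intro exI[of _ B]) (auto intro: less_imp_le)
    qed
    then obtain B where B: "\<And>k i. is_ball (B k i)" "\<And>k i. diameter (B k i) \<le> \<eta>"
      "\<And>k. E k \<subseteq> (\<Union>i. B k i)" "\<And>k. (\<Sum>i. ennreal (f (diameter (B k i)))) \<le> hausdorff_premeasure f \<eta> (E k) + ennreal (e * (1/2) ^ Suc k)"
      by metis
    define B' where "B' = (\<lambda>m. case prod_decode m of (k, i) \<Rightarrow> B k i)"
    have cov: "(\<Union>k. E k) \<subseteq> (\<Union>m. B' m)"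
    proof
      fix x assume "x \<in> (\<Union>k. E k)"
      then obtain k i where "x \<in> B k i" using B(3) by blast
      then have "x \<in> B' (prod_encode (k, i))" by (simp add: B'_def)
      then show "x \<in> (\<Union>m. B' m)" by blast
    qed
    have "hausdorff_premeasure f \<eta> (\<Union>k. E k) \<le> (\<Sum>m. ennreal (f (diameter (B' m))))"
      using cov B(1,2) by (intro hausdorff_premeasure_le_cover) (auto simp: B'_def split: prod.split)
    also have "\<dots> = (\<Sum>m. (\<lambda>(k,i). ennreal (f (diameter (B k i)))) (prod_decode m))"
      by (intro suminf_cong) (auto simp: B'_def split: prod.split)
    also have "\<dots> = (\<Sum>k. (\<Sum>i. ennreal (f (diameter (B k i)))))"
      by (rule suminf_ennreal_2dimen) auto
    also have "\<dots> \<le> (\<Sum>k. hausdorff_premeasure f \<eta> (E k) + ennreal (e * (1/2) ^ Suc k))"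
      by (intro suminf_le B) auto
    also have "\<dots> = (\<Sum>k. hausdorff_premeasure f \<eta> (E k)) + (\<Sum>k. ennreal (e * (1/2) ^ Suc k))"
      by (rule suminf_add[symmetric]) auto
    also have "(\<Sum>k. ennreal (e * (1/2) ^ Suc k)) = ennreal e"
      using \<open>0 < e\<close> by (intro suminf_ennreal_geometric_half) auto
    finally show "hausdorff_premeasure f \<eta> (\<Union>k. E k) \<le> (\<Sum>k. hausdorff_premeasure f \<eta> (E k)) + ennreal e" .
  qed
qed

lemma hausdorff_premeasure_UN_countable:
  fixes E :: "'i \<Rightarrow> 'a::euclidean_space set"
  assumes f: "dimension_function f" "0 < \<eta>" and C: "countable C"
  shows "hausdorff_premeasure f \<eta> (\<Union>i\<in>C. E i) \<le> (\<integral>\<^sup>+i. hausdorff_premeasure f \<eta> (E i) \<partial>count_space C)"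
proof -
  define K where "K = to_nat_on C ` C"
  define F where "F = (\<lambda>k. if k \<in> K then E (from_nat_into C k) else {})"
  have "(\<Union>i\<in>C. E i) \<subseteq> (\<Union>k. F k)"
    using C by (force simp: F_def K_def)
  then have "hausdorff_premeasure f \<eta> (\<Union>i\<in>C. E i) \<le> hausdorff_premeasure f \<eta> (\<Union>k. F k)"
    by (rule hausdorff_premeasure_mono)
  also have "\<dots> \<le> (\<Sum>k. hausdorff_premeasure f \<eta> (F k))"
    by (rule hausdorff_premeasure_countable_subadditive)
  also have "\<dots> = (\<integral>\<^sup>+k. hausdorff_premeasure f \<eta> (F k) \<partial>count_space UNIV)"
    by (rule nn_integral_count_space_nat[symmetric])
  also have "\<dots> = (\<integral>\<^sup>+k. hausdorff_premeasure f \<eta> (E (from_nat_into C k)) \<partial>count_space K)"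
    by (subst nn_integral_count_space_indicator)
      (auto intro!: nn_integral_cong simp: F_def hausdorff_premeasure_empty[OF f] split: split_indicator)
  also have "\<dots> = (\<integral>\<^sup>+i. hausdorff_premeasure f \<eta> (E (from_nat_into C (to_nat_on C i))) \<partial>count_space C)"
    unfolding K_def
    by (rule nn_integral_bij_count_space[symmetric])
      (auto simp: bij_betw_def inj_on_to_nat_on C)
  also have "\<dots> = (\<integral>\<^sup>+i. hausdorff_premeasure f \<eta> (E i) \<partial>count_space C)"
    using C by (intro nn_integral_cong) auto
  finally show ?thesis .
qed

lemma hausdorff_measure_Un:
  fixes E F :: "'a::euclidean_space set"
  assumes f: "dimension_function f"
  shows "hausdorff_measure f (E \<union> F) \<le> hausdorff_measure f E + hausdorff_measure f F"
  unfolding hausdorff_measure_eq_SUP[of f "E \<union> F"]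
proof (rule SUP_least)
  fix \<eta> :: real assume "\<eta> \<in> {0<..}"
  then have \<eta>: "0 < \<eta>" by simp
  have "E \<union> F = (\<Union>b\<in>UNIV. if b then E else F)"
    by (auto split: if_splits)
  then have "hausdorff_premeasure f \<eta> (E \<union> F) \<le> (\<integral>\<^sup>+b. hausdorff_premeasure f \<eta> (if b then E else F) \<partial>count_space UNIV)"
    using hausdorff_premeasure_UN_countable[OF f \<eta>, of UNIV "\<lambda>b. if b then E else F"] by simp
  also have "\<dots> = hausdorff_premeasure f \<eta> E + hausdorff_premeasure f \<eta> F"
    by (simp add: nn_integral_count_space_finite UNIV_bool add.commute)
  also have "\<dots> \<le> hausdorff_measure f E + hausdorff_measure f F"
    using \<eta> by (intro add_mono hausdorff_premeasure_le_measure)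
  finally show "hausdorff_premeasure f \<eta> (E \<union> F) \<le> hausdorff_measure f E + hausdorff_measure f F" .
qed

lemma hausdorff_measure_eq_0I:
  assumes "\<And>\<eta> e. 0 < \<eta> \<Longrightarrow> 0 < e \<Longrightarrow> hausdorff_premeasure f \<eta> E \<le> ennreal e"
  shows "hausdorff_measure f E = 0"
proof -
  have "hausdorff_premeasure f \<eta> E \<le> 0" if "0 < \<eta>" for \<eta>
    by (rule ennreal_le_epsilon) (use assms[OF that] in simp)
  then have "hausdorff_measure f E \<le> 0"
    unfolding hausdorff_measure_eq_SUP by (intro SUP_least) auto
  then show ?thesis by simp
qed

text \<open>A null set has open neighbourhoods of small volume. In such a neighbourhood, choose disjoint small
  balls whose fivefold enlargements still cover the set; their cost is bounded by their total volume.\<close>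
lemma hausdorff_measure_null_set:
  fixes N :: "'a::euclidean_space set"
  assumes f: "dimension_function f" and bd: "\<And>x. 0 < x \<Longrightarrow> f x \<le> C * x ^ DIM('a)"
    and N: "N \<in> null_sets lebesgue"
  shows "hausdorff_measure f N = 0"
proof (rule hausdorff_measure_eq_0I)
  fix \<eta> e :: real assume \<eta>: "0 < \<eta>" and e: "0 < e"
  let ?d = "DIM('a)"
  \<comment> \<open>\<open>K\<close> times the volume of a ball bounds the cost of its fivefold enlargement.\<close>
  define K where "K = C * 10 ^ ?d / unit_ball_vol (real ?d)"
  have f_pos: "0 < x \<Longrightarrow> 0 < f x" for x using f by (auto simp: dimension_function_def)
  have V: "unit_ball_vol (real ?d) \<noteq> 0"
    by (metis less_irrefl of_nat_0_le_iff unit_ball_vol_pos)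
  have "0 < C" using f_pos[of 1] bd[of 1] by simp
  then have K: "0 < K" by (simp add: K_def)
  obtain T where T: "open T" "N \<subseteq> T" "emeasure lebesgue (T - N) < ennreal (e / K)"
  proof (rule sets_lebesgue_outer_open)
    show "N \<in> sets lebesgue" using N by auto
    show "0 < e / K" using e K by simp
  qed
  have "emeasure lebesgue T \<le> emeasure lebesgue ((T - N) \<union> N)"
    using T(1) null_setsD2[OF N] by (intro emeasure_mono sets.Un sets.Diff) (auto intro: borel_open)
  also have "\<dots> \<le> emeasure lebesgue (T - N) + emeasure lebesgue N"
    using T(1) null_setsD2[OF N] by (intro emeasure_subadditive sets.Diff) (auto intro: borel_open)
  finally have T_small: "emeasure lborel T \<le> ennreal (e / K)"
    using T null_setsD1[OF N] by simp
  have "\<exists>\<rho>>0. \<rho> \<le> \<eta> / 10 \<and> cball x \<rho> \<subseteq> T" if x: "x \<in> N" for x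
  proof -
    obtain \<rho> where "\<rho> > 0" "cball x \<rho> \<subseteq> T"
      using T x open_contains_cball by blast
    then show ?thesis
      using \<eta> by (intro exI[of _ "min \<rho> (\<eta> / 10)"]) (auto intro: subset_trans[OF subset_cball])
  qed
  then obtain \<rho> where \<rho>: "\<And>x. x \<in> N \<Longrightarrow> 0 < \<rho> x" "\<And>x. x \<in> N \<Longrightarrow> \<rho> x \<le> \<eta> / 10"
      "\<And>x. x \<in> N \<Longrightarrow> cball x (\<rho> x) \<subseteq> T" by metis
  have "N \<subseteq> (\<Union>x\<in>N. cball x (\<rho> x))" using \<rho>(1) by fastforce
  then obtain D where D: "countable D" "D \<subseteq> N"
      "pairwise (\<lambda>i j. disjnt (cball i (\<rho> i)) (cball j (\<rho> j))) D"
      "N \<subseteq> (\<Union>i\<in>D. cball i (5 * \<rho> i))"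
  proof (rule Vitali_covering_lemma_cballs)
    show "0 < \<rho> x \<and> \<rho> x \<le> \<eta> / 10" if "x \<in> N" for x using \<rho>(1,2) that by blast
  qed
  have "hausdorff_premeasure f \<eta> N \<le> hausdorff_premeasure f \<eta> (\<Union>i\<in>D. cball i (5 * \<rho> i))"
    by (rule hausdorff_premeasure_mono) (rule D)
  also have "\<dots> \<le> (\<integral>\<^sup>+i. hausdorff_premeasure f \<eta> (cball i (5 * \<rho> i)) \<partial>count_space D)"
    by (rule hausdorff_premeasure_UN_countable[OF f \<eta> D(1)])
  also have "\<dots> \<le> (\<integral>\<^sup>+i. ennreal K * emeasure lborel (cball i (\<rho> i)) \<partial>count_space D)"
  proof (rule nn_integral_mono)
    fix i assume "i \<in> space (count_space D)"
    then have i: "i \<in> N" using D by auto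
    have "hausdorff_premeasure f \<eta> (cball i (5 * \<rho> i)) \<le> ennreal (f (diameter (cball i (5 * \<rho> i))))"
      using \<rho>(1,2)[OF i] \<eta> by (intro hausdorff_premeasure_ball[OF f \<eta>] is_ball_cball) auto
    also have "\<dots> \<le> ennreal (C * (10 * \<rho> i) ^ ?d)"
      using \<rho>(1)[OF i] bd[of "10 * \<rho> i"] by (intro ennreal_leI) auto
    also have "C * (10 * \<rho> i) ^ ?d = K * (unit_ball_vol (real ?d) * \<rho> i ^ ?d)"
      using V by (simp add: K_def power_mult_distrib)
    also have "ennreal \<dots> = ennreal K * emeasure lborel (cball i (\<rho> i))"
      using \<rho>(1)[OF i] K by (simp add: emeasure_cball ennreal_mult)
    finally show "hausdorff_premeasure f \<eta> (cball i (5 * \<rho> i)) \<le> ennreal K * emeasure lborel (cball i (\<rho> i))" .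
  qed
  also have "\<dots> = ennreal K * (\<integral>\<^sup>+i. emeasure lborel (cball i (\<rho> i)) \<partial>count_space D)"
    by (rule nn_integral_cmult) auto
  also have "(\<integral>\<^sup>+i. emeasure lborel (cball i (\<rho> i)) \<partial>count_space D) = emeasure lborel (\<Union>i\<in>D. cball i (\<rho> i))"
    using D(1,3) by (intro emeasure_UN_countable[symmetric])
      (auto simp: disjoint_family_on_def pairwise_def disjnt_def)
  also have "\<dots> \<le> emeasure lborel T"
    using D \<rho>(3) T(1) by (intro emeasure_mono) auto
  also note T_small
  also have "ennreal K * ennreal (e / K) = ennreal e"
    using K e by (simp add: ennreal_mult[symmetric])
  finally show "hausdorff_premeasure f \<eta> N \<le> ennreal e" by (simp add: mult_left_mono)
qed

section \<open>Periodic functions and toral endomorphisms\<close>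

definition lattice_point :: "int ^ 'n \<Rightarrow> real ^ 'n" where
  "lattice_point z = (\<chi> i. of_int (z $ i))"

definition periodic :: "(real ^ 'n \<Rightarrow> 'b) \<Rightarrow> bool" where
  "periodic \<phi> \<longleftrightarrow> (\<forall>x z. \<phi> (x + lattice_point z) = \<phi> x)"

lemma lattice_point_nth [simp]: "lattice_point z $ i = of_int (z $ i)"
  by (simp add: lattice_point_def)

lemma lattice_point_uminus: "lattice_point (- z) = - lattice_point z"
  by (simp add: vec_eq_iff)

lemma unit_cube_borel [measurable]: "(unit_cube :: (real ^ 'n) set) \<in> sets borel"
proof -
  have "{x \<in> space borel. \<forall>i. 0 \<le> x $ i \<and> x $ i < (1::real)} \<in> sets (borel :: (real ^ 'n) measure)"
    by measurable
  then show ?thesis by (simp add: unit_cube_def)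
qed

lemma emeasure_lborel_cbox_cart:
  fixes a b :: "real ^ 'n"
  assumes "\<And>i. a $ i \<le> b $ i"
  shows "emeasure lborel (cbox a b) = ennreal (\<Prod>i\<in>UNIV. b $ i - a $ i)"
proof -
  have ne: "cbox a b \<noteq> {}"
    using assms by (auto simp: interval_ne_empty_cart)
  have "emeasure lborel (cbox a b) = ennreal (measure lborel (cbox a b))"
    by (intro emeasure_eq_ennreal_measure) (simp add: emeasure_lborel_cbox_eq)
  then show ?thesis
    using content_cbox_cart[OF ne] by simp
qed

lemma emeasure_unit_cube [simp]: "emeasure lborel (unit_cube :: (real ^ 'n) set) = 1"
proof (rule antisym)
  have cbox: "emeasure lborel (cbox 0 (1 :: real ^ 'n)) = 1"
    by (subst emeasure_lborel_cbox_cart) auto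
  have "emeasure lborel (unit_cube :: (real ^ 'n) set) \<le> emeasure lborel (cbox 0 (1 :: real ^ 'n))"
    by (intro emeasure_mono) (auto simp: unit_cube_def mem_box_cart less_imp_le)
  then show "emeasure lborel (unit_cube :: (real ^ 'n) set) \<le> 1"
    by (simp add: cbox)
  have "emeasure lborel (box 0 (1 :: real ^ 'n)) \<le> emeasure lborel (unit_cube :: (real ^ 'n) set)"
    by (intro emeasure_mono) (auto simp: unit_cube_def mem_box_cart less_imp_le)
  moreover have "emeasure lborel (box 0 (1 :: real ^ 'n)) = emeasure lborel (cbox 0 (1 :: real ^ 'n))"
    by (simp add: emeasure_lborel_box_eq emeasure_lborel_cbox_eq)
  ultimately show "1 \<le> emeasure lborel (unit_cube :: (real ^ 'n) set)"
    by (simp add: cbox)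
qed

text \<open>The half-open unit cube is a fundamental domain of the integer lattice.\<close>
lemma count_lattice_translates:
  fixes w :: "real ^ 'n"
  shows "(\<integral>\<^sup>+z. indicator unit_cube (w + lattice_point z) \<partial>count_space UNIV) = (1 :: ennreal)"
    and "(\<integral>\<^sup>+z. indicator unit_cube (w - lattice_point z) \<partial>count_space UNIV) = (1 :: ennreal)"
proof -
  have 1: "w + lattice_point z \<in> unit_cube \<longleftrightarrow> z = (\<chi> i. - \<lfloor>w $ i\<rfloor>)" for z
  proof -
    have "0 \<le> w $ i + of_int (z $ i) \<and> w $ i + of_int (z $ i) < 1 \<longleftrightarrow> z $ i = - \<lfloor>w $ i\<rfloor>" for i
      using floor_eq_iff[of "w $ i" "- z $ i"] by auto
    then show ?thesis by (simp add: unit_cube_def vec_eq_iff)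
  qed
  have 2: "w - lattice_point z \<in> unit_cube \<longleftrightarrow> z = (\<chi> i. \<lfloor>w $ i\<rfloor>)" for z
    using 1[of "- z"] by (auto simp: lattice_point_uminus vec_eq_iff)
  have "(\<lambda>z. indicator unit_cube (w + lattice_point z)) = (indicator {\<chi> i. - \<lfloor>w $ i\<rfloor>} :: _ \<Rightarrow> ennreal)"
    by (auto simp: fun_eq_iff indicator_def 1)
  then show "(\<integral>\<^sup>+z. indicator unit_cube (w + lattice_point z) \<partial>count_space UNIV) = (1 :: ennreal)"
    by simp
  have "(\<lambda>z. indicator unit_cube (w - lattice_point z)) = (indicator {\<chi> i. \<lfloor>w $ i\<rfloor>} :: _ \<Rightarrow> ennreal)"
    by (auto simp: fun_eq_iff indicator_def 2)
  then show "(\<integral>\<^sup>+z. indicator unit_cube (w - lattice_point z) \<partial>count_space UNIV) = (1 :: ennreal)"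
    by simp
qed

lemma nn_integral_lborel_shift:
  fixes g :: "'a::euclidean_space \<Rightarrow> ennreal"
  assumes [measurable]: "g \<in> borel_measurable borel"
  shows "(\<integral>\<^sup>+x. g (x + y) \<partial>lborel) = (\<integral>\<^sup>+x. g x \<partial>lborel)"
proof -
  have "(\<integral>\<^sup>+x. g x \<partial>lborel) = (\<integral>\<^sup>+x. g x \<partial>distr lborel borel ((+) y))"
    by (simp add: lborel_distr_plus)
  also have "\<dots> = (\<integral>\<^sup>+x. g (y + x) \<partial>lborel)"
    by (rule nn_integral_distr) auto
  finally show ?thesis by (simp add: add.commute)
qed

text \<open>Translation invariance of Haar measure on the torus: both the cube and its translate are
  fundamental domains, and cutting the translate along the lattice translates of the cube rearranges
  it into the cube itself.\<close>
lemma nn_integral_unit_cube_translate: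
  fixes \<phi> :: "real ^ 'n \<Rightarrow> ennreal"
  assumes [measurable]: "\<phi> \<in> borel_measurable borel" and per: "periodic \<phi>"
  shows "(\<integral>\<^sup>+x. \<phi> (x + y) * indicator unit_cube x \<partial>lborel) = (\<integral>\<^sup>+x. \<phi> x * indicator unit_cube x \<partial>lborel)"
proof -
  let ?C = "unit_cube :: (real ^ 'n) set"
  have per': "\<phi> (x - lattice_point z) = \<phi> x" for x z
    using per[unfolded periodic_def, rule_format, of x "- z"] by (simp add: lattice_point_uminus)
  have "(\<integral>\<^sup>+x. \<phi> (x + y) * indicator ?C x \<partial>lborel) = (\<integral>\<^sup>+x. \<phi> x * indicator ?C (x - y) \<partial>lborel)"
    using nn_integral_lborel_shift[of "\<lambda>x. \<phi> x * indicator ?C (x - y)" y] by simp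
  also have "\<dots> = (\<integral>\<^sup>+x. \<integral>\<^sup>+z. \<phi> x * indicator ?C (x - y) * indicator ?C (x + lattice_point z) \<partial>count_space UNIV \<partial>lborel)"
    by (simp add: nn_integral_cmult count_lattice_translates)
  also have "\<dots> = (\<integral>\<^sup>+z. \<integral>\<^sup>+x. \<phi> x * indicator ?C (x - y) * indicator ?C (x + lattice_point z) \<partial>lborel \<partial>count_space UNIV)"
    by (rule nn_integral_count_space_nn_integral) auto
  also have "\<dots> = (\<integral>\<^sup>+z. \<integral>\<^sup>+x. \<phi> x * indicator ?C x * indicator ?C (x - y - lattice_point z) \<partial>lborel \<partial>count_space UNIV)"
  proof (rule nn_integral_cong)
    fix z
    have "(\<integral>\<^sup>+x. \<phi> x * indicator ?C (x - y) * indicator ?C (x + lattice_point z) \<partial>lborel) =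
        (\<integral>\<^sup>+x. (\<lambda>x. \<phi> x * indicator ?C x * indicator ?C (x - y - lattice_point z)) (x + lattice_point z) \<partial>lborel)"
      using per by (intro nn_integral_cong) (simp add: periodic_def algebra_simps)
    also have "\<dots> = (\<integral>\<^sup>+x. \<phi> x * indicator ?C x * indicator ?C (x - y - lattice_point z) \<partial>lborel)"
      by (rule nn_integral_lborel_shift) measurable
    finally show "(\<integral>\<^sup>+x. \<phi> x * indicator ?C (x - y) * indicator ?C (x + lattice_point z) \<partial>lborel) = \<dots>" .
  qed
  also have "\<dots> = (\<integral>\<^sup>+x. \<integral>\<^sup>+z. \<phi> x * indicator ?C x * indicator ?C (x - y - lattice_point z) \<partial>count_space UNIV \<partial>lborel)"
    by (rule nn_integral_count_space_nn_integral[symmetric]) auto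
  also have "\<dots> = (\<integral>\<^sup>+x. \<phi> x * indicator ?C x \<partial>lborel)"
    by (simp add: nn_integral_cmult count_lattice_translates)
  finally show ?thesis .
qed

lemma matrix_vector_mult_lattice_point:
  "map_matrix real_of_int D *v lattice_point z = lattice_point (D *v z)"
  by (simp add: vec_eq_iff matrix_vector_mult_def)

lemma det_map_matrix_of_int:
  "det (map_matrix real_of_int D) = real_of_int (det D)"
  by (simp add: det_def)

lemma borel_measurable_matrix_vector_mult [measurable]:
  "(\<lambda>x. (M :: real ^ 'n ^ 'n) *v x) \<in> borel_measurable borel"
  by (intro borel_measurable_continuous_onI linear_continuous_on)
    (simp add: linear_conv_bounded_linear[symmetric])

text \<open>A surjective endomorphism preserves Haar measure. As in the proof of uniqueness of Haar measure,
  the integral over the image does not change if the image is translated by \<open>y\<close>, because \<open>y\<close> can be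
  absorbed into the argument by surjectivity; averaging over \<open>y\<close> in the cube removes the endomorphism.\<close>
lemma nn_integral_unit_cube_toral_endomorphism:
  fixes H :: "real ^ 'n \<Rightarrow> ennreal" and D :: "int ^ 'n ^ 'n"
  assumes [measurable]: "H \<in> borel_measurable borel" and per: "periodic H" and D: "det D \<noteq> 0"
  shows "(\<integral>\<^sup>+x. H (map_matrix real_of_int D *v x - b) * indicator unit_cube x \<partial>lborel) =
    (\<integral>\<^sup>+x. H x * indicator unit_cube x \<partial>lborel)"
proof -
  let ?C = "unit_cube :: (real ^ 'n) set"
  let ?M = "map_matrix real_of_int D"
  define I where "I = (\<lambda>y. \<integral>\<^sup>+x. H (?M *v x + y - b) * indicator ?C x \<partial>lborel)"
  have I_const: "I y = I 0" for y
  proof -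
    have "invertible ?M"
      using D by (simp add: invertible_det_nz det_map_matrix_of_int)
    then obtain w where w: "?M *v w = y"
      by (metis invertible_def matrix_vector_mul_assoc matrix_vector_mul_lid)
    have "H (?M *v (x + lattice_point z) - b) = H (?M *v x - b)" for x z
      using per[unfolded periodic_def, rule_format, of "?M *v x - b" "D *v z"]
      by (simp add: matrix_vector_right_distrib matrix_vector_mult_lattice_point algebra_simps)
    then have "periodic (\<lambda>x. H (?M *v x - b))"
      by (simp add: periodic_def)
    then have "(\<integral>\<^sup>+x. (\<lambda>x. H (?M *v x - b)) (x + w) * indicator ?C x \<partial>lborel) =
      (\<integral>\<^sup>+x. H (?M *v x - b) * indicator ?C x \<partial>lborel)"
      by (intro nn_integral_unit_cube_translate) measurable
    then show ?thesis
      by (simp add: I_def matrix_vector_right_distrib w)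
  qed
  have "I 0 = (\<integral>\<^sup>+y. I 0 * indicator ?C y \<partial>lborel)"
    by (simp add: nn_integral_cmult)
  also have "\<dots> = (\<integral>\<^sup>+y. I y * indicator ?C y \<partial>lborel)"
    by (intro nn_integral_cong) (subst I_const, rule refl)
  also have "\<dots> = (\<integral>\<^sup>+y. \<integral>\<^sup>+x. H (?M *v x + y - b) * indicator ?C x * indicator ?C y \<partial>lborel \<partial>lborel)"
    unfolding I_def by (intro nn_integral_cong nn_integral_multc[symmetric]) measurable
  also have "\<dots> = (\<integral>\<^sup>+x. \<integral>\<^sup>+y. H (?M *v x + y - b) * indicator ?C x * indicator ?C y \<partial>lborel \<partial>lborel)"
    by (rule lborel_pair.Fubini') measurable
  also have "\<dots> = (\<integral>\<^sup>+x. (\<integral>\<^sup>+y. H y * indicator ?C y \<partial>lborel) * indicator ?C x \<partial>lborel)"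
  proof (rule nn_integral_cong)
    fix x :: "real ^ 'n"
    have "(\<integral>\<^sup>+y. H (?M *v x + y - b) * indicator ?C x * indicator ?C y \<partial>lborel) =
      (\<integral>\<^sup>+y. H (y + (?M *v x - b)) * indicator ?C y * indicator ?C x \<partial>lborel)"
      by (intro nn_integral_cong) (simp add: algebra_simps)
    also have "\<dots> = (\<integral>\<^sup>+y. H (y + (?M *v x - b)) * indicator ?C y \<partial>lborel) * indicator ?C x"
      by (rule nn_integral_multc) measurable
    also have "\<dots> = (\<integral>\<^sup>+y. H y * indicator ?C y \<partial>lborel) * indicator ?C x"
      using per by (simp add: nn_integral_unit_cube_translate)
    finally show "(\<integral>\<^sup>+y. H (?M *v x + y - b) * indicator ?C x * indicator ?C y \<partial>lborel) = \<dots>" .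
  qed
  also have "\<dots> = (\<integral>\<^sup>+y. H y * indicator ?C y \<partial>lborel)"
    by (simp add: nn_integral_cmult)
  finally show ?thesis by (simp add: I_def)
qed

definition near_mod_1 :: "real ^ 'n \<Rightarrow> (real ^ 'n) set" where
  "near_mod_1 v = {x. \<forall>i. dist_to_int (x $ i) \<le> v $ i}"

lemma dist_to_int_borel [measurable]: "dist_to_int \<in> borel_measurable borel"
  unfolding dist_to_int_def[abs_def] round_def by measurable

lemma near_mod_1_borel [measurable]: "near_mod_1 v \<in> sets borel"
proof -
  have "{x \<in> space borel. \<forall>i. dist_to_int (x $ i) \<le> v $ i} \<in> sets borel"
    by measurable
  then show ?thesis by (simp add: near_mod_1_def)
qed

lemma near_mod_1_add_lattice_point [simp]: "x + lattice_point z \<in> near_mod_1 v \<longleftrightarrow> x \<in> near_mod_1 v"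
  and near_mod_1_diff_lattice_point [simp]: "x - lattice_point z \<in> near_mod_1 v \<longleftrightarrow> x \<in> near_mod_1 v"
proof -
  have "dist_to_int (x $ i + of_int k) = dist_to_int (x $ i)" 
    "dist_to_int (x $ i - of_int k) = dist_to_int (x $ i)" for i k
    by (auto intro!: dist_to_int_diff_Ints)
  then show "x + lattice_point z \<in> near_mod_1 v \<longleftrightarrow> x \<in> near_mod_1 v"
    "x - lattice_point z \<in> near_mod_1 v \<longleftrightarrow> x \<in> near_mod_1 v"
    by (simp_all add: near_mod_1_def)
qed

text \<open>Translating the target to the centre of the cube avoids the boundary: there, for half-sides below
  \<open>1 / 2\<close>, the condition modulo 1 describes a single closed box.\<close>
lemma nn_integral_near_mod_1:
  fixes v :: "real ^ 'n"
  assumes v: "\<And>i. 0 < v $ i \<and> v $ i < 1 / 2"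
  shows "(\<integral>\<^sup>+x. indicator (near_mod_1 v) (y - x) * indicator unit_cube x \<partial>lborel) = ennreal (\<Prod>i\<in>UNIV. 2 * v $ i)"
proof -
  let ?C = "unit_cube :: (real ^ 'n) set"
  define h :: "real ^ 'n" where "h = (\<chi> i. 1 / 2)"
  define g :: "real ^ 'n \<Rightarrow> ennreal" where "g = (\<lambda>x. indicator (near_mod_1 v) (y - x))"
  have [measurable]: "g \<in> borel_measurable borel" unfolding g_def by measurable
  have "periodic g"
    by (auto simp: periodic_def g_def indicator_def diff_diff_eq[symmetric])
  then have "(\<integral>\<^sup>+x. g x * indicator ?C x \<partial>lborel) = (\<integral>\<^sup>+x. g (x + (y - h)) * indicator ?C x \<partial>lborel)"
    by (intro nn_integral_unit_cube_translate[symmetric]) measurable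
  also have "\<dots> = (\<integral>\<^sup>+x. indicator (cbox (h - v) (h + v)) x \<partial>lborel)"
  proof (rule nn_integral_cong)
    fix x :: "real ^ 'n"
    have eq: "dist_to_int (1 / 2 - x $ i) = \<bar>1 / 2 - x $ i\<bar>" if "0 < x $ i" "x $ i < 1" for i
    proof -
      have "round (1 / 2 - x $ i) = 0"
        using that by (simp add: round_def floor_eq_iff)
      then show ?thesis by (simp add: dist_to_int_def)
    qed
    have half: "dist_to_int (1 / 2) = 1 / 2"
    proof -
      have "round (1 / 2 :: real) = 1" by (simp add: round_def)
      then show ?thesis by (simp add: dist_to_int_def)
    qed
    have "y - (x + (y - h)) \<in> near_mod_1 v \<and> x \<in> ?C \<longleftrightarrow> x \<in> cbox (h - v) (h + v)"
    proof
      assume *: "y - (x + (y - h)) \<in> near_mod_1 v \<and> x \<in> ?C"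
      have "\<bar>1 / 2 - x $ i\<bar> \<le> v $ i" for i
      proof -
        have i: "dist_to_int (1 / 2 - x $ i) \<le> v $ i" "0 \<le> x $ i" "x $ i < 1"
          using * by (auto simp: near_mod_1_def h_def unit_cube_def)
        then have "x $ i \<noteq> 0" using half v[of i] by auto
        then show ?thesis using i eq[of i] by auto
      qed
      then show "x \<in> cbox (h - v) (h + v)"
        by (auto simp: mem_box_cart h_def abs_le_iff algebra_simps)
    next
      assume "x \<in> cbox (h - v) (h + v)"
      then have *: "1 / 2 - v $ i \<le> x $ i" "x $ i \<le> 1 / 2 + v $ i" for i
        by (auto simp: mem_box_cart h_def)
      have pos: "0 < x $ i" "x $ i < 1" for i using *[of i] v[of i] by linarith+
      have "dist_to_int (1 / 2 - x $ i) \<le> v $ i" for i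
        using eq[OF pos] *[of i] by (auto simp: abs_le_iff)
      then show "y - (x + (y - h)) \<in> near_mod_1 v \<and> x \<in> ?C"
        using pos by (auto simp: near_mod_1_def h_def unit_cube_def less_imp_le)
    qed
    then show "g (x + (y - h)) * indicator ?C x = indicator (cbox (h - v) (h + v)) x"
      by (auto simp: g_def indicator_def)
  qed
  also have "\<dots> = emeasure lborel (cbox (h - v) (h + v))" by simp
  also have "\<dots> = ennreal (\<Prod>i\<in>UNIV. 2 * v $ i)"
  proof (subst emeasure_lborel_cbox_cart)
    show "(h - v) $ i \<le> (h + v) $ i" for i using v[of i] by simp
  qed simp
  finally show ?thesis by (simp add: g_def)
qed

section \<open>Covering almost every point infinitely often\<close>

text \<open>By pairwise independence, the number of events among \<open>N, \<dots>, K - 1\<close> that occur has variance at most its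
  mean \<open>S K\<close>. By Chebyshev's inequality none of them occurs with probability at most \<open>1 / S K\<close>, which
  tends to 0.\<close>
lemma (in prob_space) borel_cantelli_pairwise:
  assumes G [measurable]: "\<And>n. G n \<in> events"
    and indep: "\<And>m n. m \<noteq> n \<Longrightarrow> prob (G m \<inter> G n) = prob (G m) * prob (G n)"
    and div: "\<not> summable (\<lambda>n. prob (G n))"
  shows "AE x in M. infinite {n. x \<in> G n}"
proof -
  have "AE x in M. \<exists>n\<ge>N. x \<in> G n" for N
  proof -
    define H where "H = {x \<in> space M. \<forall>n\<ge>N. x \<notin> G n}"
    have H [measurable]: "H \<in> events" unfolding H_def by measurable
    define S where "S K = (\<Sum>n\<in>{N..<K}. prob (G n))" for K
    have bound: "(S K)\<^sup>2 * prob H \<le> S K" for K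
    proof -
      define Z where "Z = (\<lambda>x. \<Sum>n\<in>{N..<K}. indicator (G n) x :: real)"
      have sq: "(Z x - S K)\<^sup>2 = (\<Sum>m\<in>{N..<K}. \<Sum>n\<in>{N..<K}. indicator (G m \<inter> G n) x) - 2 * S K * Z x + (S K)\<^sup>2" for x
      proof -
        have "(\<Sum>m\<in>{N..<K}. \<Sum>n\<in>{N..<K}. indicator (G m \<inter> G n) x) = Z x * Z x"
          unfolding Z_def sum_product by (intro sum.cong refl) (auto simp: indicator_def)
        then show ?thesis by (simp add: power2_eq_square algebra_simps)
      qed
      have int_ind: "integrable M (\<lambda>x. indicator (G m \<inter> G n) x :: real)" for m n
        by (intro integrable_real_indicator) (auto simp: emeasure_eq_measure)
      have int_ind1: "integrable M (\<lambda>x. indicator (G n) x :: real)" for n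
        by (intro integrable_real_indicator) (auto simp: emeasure_eq_measure)
      have int_Z: "integrable M Z"
        unfolding Z_def using int_ind1 by (intro Bochner_Integration.integrable_sum)
      have int_sq: "integrable M (\<lambda>x. (Z x - S K)\<^sup>2)"
        unfolding sq using int_Z int_ind
        by (intro Bochner_Integration.integrable_add Bochner_Integration.integrable_diff
            Bochner_Integration.integrable_sum integrable_mult_right) auto
      have int_W: "integrable M (\<lambda>x. \<Sum>m\<in>{N..<K}. \<Sum>n\<in>{N..<K}. indicator (G m \<inter> G n) x :: real)"
        by (intro Bochner_Integration.integrable_sum int_ind)
      have EZ: "expectation Z = S K"
        unfolding Z_def S_def by (subst Bochner_Integration.integral_sum) (use int_ind1 in auto)
      have "(S K)\<^sup>2 * prob H = expectation (\<lambda>x. (S K)\<^sup>2 * indicator H x)"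
        by simp
      also have "\<dots> \<le> expectation (\<lambda>x. (Z x - S K)\<^sup>2)"
      proof (intro integral_mono int_sq)
        show "integrable M (\<lambda>x. (S K)\<^sup>2 * indicator H x)"
          by (intro integrable_mult_right integrable_real_indicator) (auto simp: emeasure_eq_measure)
        fix x assume "x \<in> space M"
        show "(S K)\<^sup>2 * indicator H x \<le> (Z x - S K)\<^sup>2"
        proof (cases "x \<in> H")
          case True
          then have "Z x = 0" by (auto simp: Z_def H_def)
          then show ?thesis using True by simp
        qed simp
      qed
      also have "\<dots> = expectation (\<lambda>x. \<Sum>m\<in>{N..<K}. \<Sum>n\<in>{N..<K}. indicator (G m \<inter> G n) x) - 2 * S K * expectation Z + (S K)\<^sup>2"
        unfolding sq using int_W int_Z by (simp add: prob_space)
      also have "expectation (\<lambda>x. \<Sum>m\<in>{N..<K}. \<Sum>n\<in>{N..<K}. indicator (G m \<inter> G n) x) =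
          (\<Sum>m\<in>{N..<K}. \<Sum>n\<in>{N..<K}. prob (G m \<inter> G n))"
        using int_ind by (simp add: Bochner_Integration.integral_sum)
      also have "\<dots> \<le> (\<Sum>m\<in>{N..<K}. \<Sum>n\<in>{N..<K}. prob (G m) * prob (G n) + (if m = n then prob (G n) else 0))"
        using indep by (intro sum_mono) auto
      also have "\<dots> = (S K)\<^sup>2 + S K"
        by (simp add: sum.distrib S_def power2_eq_square sum_product)
      finally show ?thesis by (simp add: EZ power2_eq_square)
    qed
    have "prob H = 0"
    proof (rule ccontr)
      assume "prob H \<noteq> 0"
      then have pos: "0 < prob H" by (simp add: less_le)
      have "S K \<le> 1 / prob H" for K
      proof (cases "S K = 0")
        case False
        then have "0 < S K" by (simp add: S_def sum_nonneg less_le)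
        then show ?thesis
          using bound[of K] pos by (simp add: field_simps power2_eq_square)
      qed (use pos in simp)
      then have "(\<Sum>n<K. prob (G (n + N))) \<le> 1 / prob H" for K
      proof -
        have "(\<Sum>n<K. prob (G (n + N))) = S (K + N)"
          unfolding S_def using sum.shift_bounds_nat_ivl[of "\<lambda>n. prob (G n)" 0 N K]
          by (simp add: atLeast0LessThan)
        then show ?thesis using \<open>S (K + N) \<le> 1 / prob H\<close> by simp
      qed
      then have "summable (\<lambda>n. prob (G (n + N)))"
        by (intro summableI_nonneg_bounded[of _ "1 / prob H"]) auto
      then show False using div summable_iff_shift by blast
    qed
    then have "AE x in M. x \<notin> H"
      by (intro AE_not_in) (auto simp: null_sets_def emeasure_eq_measure)
    then show ?thesis
      using AE_space by eventually_elim (auto simp: H_def)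
  qed
  then have "AE x in M. \<forall>N. \<exists>n\<ge>N. x \<in> G n"
    by (simp add: AE_all_countable)
  then show ?thesis
    by eventually_elim (auto simp: infinite_nat_iff_unbounded_le)
qed

text \<open>The matrices may be singular, so for fixed \<open>\<beta>\<close> the points \<open>A n *v \<alpha>\<close> need not be equidistributed.
  Randomising \<open>\<beta>\<close> as well makes the events pairwise independent under the hypothesis on the differences
  \<open>A m - A n\<close> alone, and Fubini's theorem returns to almost every \<open>\<alpha>\<close>.\<close>
lemma AE_infinitely_often_near_mod_1:
  fixes A :: "nat \<Rightarrow> int ^ 'n ^ 'n" and v :: "nat \<Rightarrow> real ^ 'n"
  assumes det: "\<And>m n. m \<noteq> n \<Longrightarrow> det (A m - A n) \<noteq> 0"
    and v: "\<And>n i. 0 < v n $ i \<and> v n $ i < 1 / 2"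
    and div: "\<not> summable (\<lambda>n. \<Prod>i\<in>UNIV. v n $ i)"
  shows "AE \<alpha> in lborel. \<alpha> \<in> unit_cube \<longrightarrow> (AE \<beta> in lborel. \<beta> \<in> unit_cube \<longrightarrow>
    infinite {n. map_matrix real_of_int (A n) *v \<alpha> - \<beta> \<in> near_mod_1 (v n)})"
proof -
  let ?C = "unit_cube :: (real ^ 'n) set"
  define Q :: "(real ^ 'n) measure" where "Q = density lborel (indicator ?C)"
  define M where "M n = map_matrix real_of_int (A n)" for n
  have [simp]: "sets Q = sets borel" "space Q = UNIV" by (simp_all add: Q_def)
  have [measurable_cong]: "sets Q = sets borel" by simp
  interpret Q: prob_space Q
    by standard (simp add: Q_def emeasure_density)
  interpret P: pair_prob_space Q Q ..
  have int_Q: "(\<integral>\<^sup>+x. g x \<partial>Q) = (\<integral>\<^sup>+x. g x * indicator ?C x \<partial>lborel)"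
    if "g \<in> borel_measurable borel" for g
    using that by (simp add: Q_def nn_integral_density mult.commute)
  define p where "p n = (\<Prod>i\<in>UNIV. 2 * v n $ i)" for n
  have p0: "0 \<le> p n" for n unfolding p_def using v by (intro prod_nonneg) (auto simp: less_imp_le)
  define G where "G n = {(x, y). M n *v x - y \<in> near_mod_1 (v n)}" for n
  have G_borel: "{z \<in> space (borel \<Otimes>\<^sub>M borel). M n *v fst z - snd z \<in> near_mod_1 (v n)} \<in> sets (borel \<Otimes>\<^sub>M borel)" for n
    by measurable
  then have [measurable]: "G n \<in> sets (borel \<Otimes>\<^sub>M borel)" for n
    by (simp add: G_def space_pair_measure split_beta')
  have sets_QQ: "sets (Q \<Otimes>\<^sub>M Q) = sets (borel \<Otimes>\<^sub>M borel)"
    by (rule sets_pair_measure_cong) auto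
  have em: "emeasure (Q \<Otimes>\<^sub>M Q) X = (\<integral>\<^sup>+x. (\<integral>\<^sup>+y. indicator X (x, y) * indicator ?C y \<partial>lborel) * indicator ?C x \<partial>lborel)"
    if [measurable]: "X \<in> sets (borel \<Otimes>\<^sub>M borel)" for X
  proof -
    have "emeasure (Q \<Otimes>\<^sub>M Q) X = (\<integral>\<^sup>+x. \<integral>\<^sup>+y. indicator X (x, y) \<partial>Q \<partial>Q)"
      by (rule Q.emeasure_pair_measure) (use that in \<open>simp add: sets_QQ\<close>)
    also have "\<dots> = (\<integral>\<^sup>+x. (\<integral>\<^sup>+y. indicator X (x, y) * indicator ?C y \<partial>lborel) \<partial>Q)"
      by (intro nn_integral_cong int_Q) measurable
    also have "\<dots> = (\<integral>\<^sup>+x. (\<integral>\<^sup>+y. indicator X (x, y) * indicator ?C y \<partial>lborel) * indicator ?C x \<partial>lborel)"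
      by (intro int_Q) measurable
    finally show ?thesis .
  qed
  have ind_G: "indicator (G n) (x, y) = (indicator (near_mod_1 (v n)) (M n *v x - y) :: ennreal)" for n x y
    by (simp add: G_def indicator_def)
  have em_G: "emeasure (Q \<Otimes>\<^sub>M Q) (G n) = ennreal (p n)" for n
    by (simp add: em ind_G nn_integral_near_mod_1[OF v] p_def nn_integral_cmult)
  have em_GG: "emeasure (Q \<Otimes>\<^sub>M Q) (G m \<inter> G n) = ennreal (p m) * ennreal (p n)" if "m \<noteq> n" for m n
  proof -
    let ?N = "\<lambda>k x. indicator (near_mod_1 (v k)) x :: ennreal"
    have diff: "M m *v x - M n *v x = map_matrix real_of_int (A m - A n) *v x" for x
      by (simp add: M_def matrix_vector_mult_def vec_eq_iff sum_subtractf[symmetric] left_diff_distrib)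
    \<comment> \<open>Translating \<open>y\<close> by \<open>M m *v x\<close> leaves the first factor independent of \<open>x\<close>, and the second is a function
      of the endomorphism \<open>A m - A n\<close> applied to \<open>x\<close>.\<close>
    have inner: "(\<integral>\<^sup>+y. indicator (G m \<inter> G n) (x, y) * indicator ?C y \<partial>lborel) =
      (\<integral>\<^sup>+y. ?N m (0 - y) * ?N n (0 - (map_matrix real_of_int (A m - A n) *v x - (- y))) * indicator ?C y \<partial>lborel)" for x
    proof -
      define \<phi> where "\<phi> = (\<lambda>y. ?N m (M m *v x - y) * ?N n (M n *v x - y))"
      have [measurable]: "\<phi> \<in> borel_measurable borel" unfolding \<phi>_def by measurable
      have "periodic \<phi>"
        by (simp add: periodic_def \<phi>_def indicator_def diff_diff_eq[symmetric])
      then have "(\<integral>\<^sup>+y. \<phi> y * indicator ?C y \<partial>lborel) = (\<integral>\<^sup>+y. \<phi> (y + M m *v x) * indicator ?C y \<partial>lborel)"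
        by (intro nn_integral_unit_cube_translate[symmetric]) measurable
      also have "\<dots> = (\<integral>\<^sup>+y. ?N m (0 - y) * ?N n (0 - (map_matrix real_of_int (A m - A n) *v x - (- y))) * indicator ?C y \<partial>lborel)"
        by (intro nn_integral_cong) (simp add: \<phi>_def diff[symmetric] algebra_simps)
      also have "(\<integral>\<^sup>+y. \<phi> y * indicator ?C y \<partial>lborel) = (\<integral>\<^sup>+y. indicator (G m \<inter> G n) (x, y) * indicator ?C y \<partial>lborel)"
        by (intro nn_integral_cong) (simp add: \<phi>_def indicator_inter_arith ind_G)
      finally show ?thesis .
    qed
    define H where "H = (\<lambda>x. ?N n (0 - x))"
    have [measurable]: "H \<in> borel_measurable borel" unfolding H_def by measurable
    have per: "periodic H"
      by (simp add: periodic_def H_def indicator_def diff_diff_eq[symmetric])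
    have H_int: "(\<integral>\<^sup>+x. H (map_matrix real_of_int (A m - A n) *v x - b) * indicator ?C x \<partial>lborel) = ennreal (p n)" for b
    proof -
      have "(\<integral>\<^sup>+x. H (map_matrix real_of_int (A m - A n) *v x - b) * indicator ?C x \<partial>lborel) = (\<integral>\<^sup>+x. H x * indicator ?C x \<partial>lborel)"
        by (rule nn_integral_unit_cube_toral_endomorphism) (use per det[OF that] in auto)
      then show ?thesis unfolding H_def by (simp only: nn_integral_near_mod_1[OF v] p_def)
    qed
    have "emeasure (Q \<Otimes>\<^sub>M Q) (G m \<inter> G n) =
      (\<integral>\<^sup>+x. (\<integral>\<^sup>+y. ?N m (0 - y) * H (map_matrix real_of_int (A m - A n) *v x - (- y)) * indicator ?C y \<partial>lborel) * indicator ?C x \<partial>lborel)"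
      by (subst em) (auto simp: inner H_def)
    also have "\<dots> = (\<integral>\<^sup>+x. \<integral>\<^sup>+y. ?N m (0 - y) * H (map_matrix real_of_int (A m - A n) *v x - (- y)) * indicator ?C y * indicator ?C x \<partial>lborel \<partial>lborel)"
      by (intro nn_integral_cong nn_integral_multc[symmetric]) measurable
    also have "\<dots> = (\<integral>\<^sup>+y. \<integral>\<^sup>+x. ?N m (0 - y) * H (map_matrix real_of_int (A m - A n) *v x - (- y)) * indicator ?C y * indicator ?C x \<partial>lborel \<partial>lborel)"
      by (rule lborel_pair.Fubini') measurable
    also have "\<dots> = (\<integral>\<^sup>+y. \<integral>\<^sup>+x. (?N m (0 - y) * indicator ?C y) * (H (map_matrix real_of_int (A m - A n) *v x - (- y)) * indicator ?C x) \<partial>lborel \<partial>lborel)"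
      by (intro nn_integral_cong) (simp add: mult_ac)
    also have "\<dots> = (\<integral>\<^sup>+y. (?N m (0 - y) * indicator ?C y) * ennreal (p n) \<partial>lborel)"
      by (intro nn_integral_cong) (subst nn_integral_cmult, measurable, simp only: H_int)
    also have "\<dots> = (\<integral>\<^sup>+y. ?N m (0 - y) * indicator ?C y \<partial>lborel) * ennreal (p n)"
      by (rule nn_integral_multc) measurable
    also have "(\<integral>\<^sup>+y. ?N m (0 - y) * indicator ?C y \<partial>lborel) = ennreal (p m)"
      by (simp only: nn_integral_near_mod_1[OF v] p_def)
    finally show ?thesis .
  qed
  have prob_G: "measure (Q \<Otimes>\<^sub>M Q) (G n) = p n" for n
    using em_G p0 by (simp add: measure_def)
  have "AE z in Q \<Otimes>\<^sub>M Q. infinite {n. z \<in> G n}"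
  proof (rule P.borel_cantelli_pairwise)
    show "G n \<in> sets (Q \<Otimes>\<^sub>M Q)" for n by (simp add: sets_QQ)
    show "measure (Q \<Otimes>\<^sub>M Q) (G m \<inter> G n) = measure (Q \<Otimes>\<^sub>M Q) (G m) * measure (Q \<Otimes>\<^sub>M Q) (G n)" if "m \<noteq> n" for m n
      using em_GG[OF that] p0 by (simp add: prob_G) (simp add: measure_def ennreal_mult[symmetric])
    have "p n = 2 ^ CARD('n) * (\<Prod>i\<in>UNIV. v n $ i)" for n
      by (simp add: p_def prod.distrib)
    then show "\<not> summable (\<lambda>n. measure (Q \<Otimes>\<^sub>M Q) (G n))"
      using div by (simp add: prob_G)
  qed
  then have "AE x in Q. AE y in Q. infinite {n. (x, y) \<in> G n}"
    by (rule P.AE_pair)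
  moreover have "(AE x in Q. R x) \<longleftrightarrow> (AE x in lborel. x \<in> ?C \<longrightarrow> R x)" for R
    unfolding Q_def by (subst AE_density) (auto simp: indicator_def)
  ultimately show ?thesis
    by (simp add: G_def M_def)
qed

section \<open>Mass transference\<close>

text \<open>The displayed inequality says that the uniform distribution on \<open>E\<close> with total mass the volume of
  \<open>cball y t\<close> gives mass at most \<open>f \<rho> / c\<close> to balls of radius \<open>\<rho>\<close>. That \<open>E\<close> lies in the ball of half the
  radius keeps pieces in disjoint balls apart from each other at the scale of the balls.\<close>
definition gauge_piece :: "(real \<Rightarrow> real) \<Rightarrow> real \<Rightarrow> 'a::euclidean_space set \<Rightarrow> 'a \<Rightarrow> real \<Rightarrow> bool" where
  "gauge_piece f c E y t \<longleftrightarrow> open E \<and> E \<noteq> {} \<and> 0 < t \<and> E \<subseteq> cball y (t / 2) \<and>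
    (\<forall>z \<rho>. 0 < \<rho> \<longrightarrow>
      c * measure lborel (cball y t) * measure lborel (E \<inter> cball z \<rho>) \<le> f \<rho> * measure lborel E)"

text \<open>The stages of the construction. The density bound \<open>c\<close> tells the next step which pieces to use; it
  grows without control. The Frostman condition, with constant \<open>\<kappa>\<close> at scales up to \<open>\<eta>\<close>, is what persists.\<close>
definition spread_measure ::
    "(real \<Rightarrow> real) \<Rightarrow> real \<Rightarrow> ennreal \<Rightarrow> real \<Rightarrow> 'a::euclidean_space set \<times> 'a measure \<times> real \<Rightarrow> bool" where
  "spread_measure f \<eta> a \<kappa> = (\<lambda>(U, \<mu>, c). open U \<and> bounded U \<and> 0 < c \<and> sets \<mu> = sets borel \<and>
    (\<forall>A\<in>sets borel. emeasure \<mu> A \<le> ennreal c * emeasure lborel (A \<inter> U)) \<and>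
    a < emeasure \<mu> UNIV \<and>
    (\<forall>z \<rho>. 0 < \<rho> \<longrightarrow> \<rho> \<le> \<eta> \<longrightarrow> emeasure \<mu> (cball z \<rho>) \<le> ennreal (\<kappa> * f \<rho>)))"

lemma measure_lborel_cball:
  fixes y :: "'a::euclidean_space"
  assumes "0 \<le> t"
  shows "measure lborel (cball y t) = unit_ball_vol (real DIM('a)) * t ^ DIM('a)"
  using assms by (simp add: content_cball)

lemma open_measure_pos:
  fixes E :: "'a::euclidean_space set"
  assumes "open E" "E \<noteq> {}" "bounded E"
  shows "0 < measure lborel E"
proof -
  obtain x e where e: "e > 0" "ball x e \<subseteq> E"
    using assms open_contains_ball by (metis ex_in_conv)
  have "0 < measure lborel (ball x e)"
    using e by (simp add: content_ball)
  also have "\<dots> \<le> measure lborel E"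
    using e assms emeasure_bounded_finite[of E]
    by (intro measure_mono_fmeasurable) (auto simp: fmeasurable_def)
  finally show ?thesis .
qed

text \<open>The Vitali covering theorem exhausts \<open>U\<close> up to a Lebesgue null set by countably many disjoint
  balls. The measure is absolutely continuous, so finitely many of them already carry more than \<open>a\<close>.\<close>
lemma finite_Vitali_subfamily:
  fixes \<K> :: "('a::euclidean_space set \<times> 'a \<times> real) set" and \<mu> :: "'a measure"
  assumes U: "open U" and sets_\<mu>: "sets \<mu> = sets borel"
    and ac: "\<And>A. A \<in> sets borel \<Longrightarrow> emeasure \<mu> A \<le> ennreal c * emeasure lborel (A \<inter> U)"
    and a: "a < emeasure \<mu> UNIV"
    and pos: "\<And>E y t. (E, y, t) \<in> \<K> \<Longrightarrow> 0 < t"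
    and cover: "AE x in lborel. x \<in> U \<longrightarrow> (\<forall>\<delta>>0. \<exists>(E, y, t)\<in>\<K>. x \<in> cball y t \<and> t < \<delta>)"
    and \<delta>: "0 < \<delta>"
  obtains F where "finite F" "F \<subseteq> \<K>"
    "\<And>E y t. (E, y, t) \<in> F \<Longrightarrow> t < \<delta> \<and> cball y t \<subseteq> U"
    "pairwise (\<lambda>i j. disjnt (cball (fst (snd i)) (snd (snd i))) (cball (fst (snd j)) (snd (snd j)))) F"
    "a < (\<Sum>(E, y, t)\<in>F. emeasure \<mu> (cball y t))"
proof -
  define b where "b = (\<lambda>i::'a set \<times> 'a \<times> real. cball (fst (snd i)) (snd (snd i)))"
  define S where "S = {x\<in>U. \<forall>\<delta>>0. \<exists>(E, y, t)\<in>\<K>. x \<in> cball y t \<and> t < \<delta>}"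
  define K where "K = {(E, y, t). (E, y, t) \<in> \<K> \<and> t < \<delta> \<and> cball y t \<subseteq> U}"
  have fine: "\<exists>i. i \<in> K \<and> x \<in> cball (fst (snd i)) (snd (snd i)) \<and> snd (snd i) < e"
    if x: "x \<in> S" and e: "0 < e" for x e
  proof -
    obtain e' where e': "0 < e'" "cball x e' \<subseteq> U"
      using x U by (auto simp: S_def open_contains_cball)
    have "0 < min \<delta> (min e (e' / 2))" using e e' \<delta> by simp
    then obtain E y t where k: "(E, y, t) \<in> \<K>" "x \<in> cball y t" "t < min \<delta> (min e (e' / 2))"
      using x unfolding S_def by fast
    have "cball y t \<subseteq> cball x e'"
    proof
      fix w assume "w \<in> cball y t"
      then have "dist x w \<le> 2 * t"
        using k(2) dist_triangle2[of x w y] by (auto simp: dist_commute)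
      then show "w \<in> cball x e'" using k(3) by auto
    qed
    then show ?thesis
      using k e' by (intro exI[of _ "(E, y, t)"]) (auto simp: K_def)
  qed
  obtain C where C: "countable C" "C \<subseteq> K"
      "pairwise (\<lambda>i j. disjnt (cball (fst (snd i)) (snd (snd i))) (cball (fst (snd j)) (snd (snd j)))) C"
      "negligible (S - (\<Union>i\<in>C. cball (fst (snd i)) (snd (snd i))))"
  proof (rule Vitali_covering_theorem_cballs[of K "\<lambda>i. snd (snd i)" S "\<lambda>i. fst (snd i)"])
    show "0 < snd (snd i)" if "i \<in> K" for i
      using that pos by (auto simp: K_def)
  qed (use fine in blast)+
  obtain N where N: "N \<in> null_sets lborel" "U - S \<subseteq> N"
  proof -
    obtain N where N: "N \<in> null_sets lborel"
        "{x \<in> space lborel. \<not> (x \<in> U \<longrightarrow> (\<forall>\<delta>>0. \<exists>(E, y, t)\<in>\<K>. x \<in> cball y t \<and> t < \<delta>))} \<subseteq> N"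
      using cover unfolding eventually_ae_filter by blast
    have "U - S \<subseteq> N"
      using N(2) unfolding S_def by (elim order_trans[rotated]) auto
    with N(1) show ?thesis by (rule that)
  qed
  define V where "V = (\<Union>i\<in>C. b i)"
  have b_borel [measurable]: "b i \<in> sets borel" for i by (simp add: b_def)
  have V_borel: "V \<in> sets borel" unfolding V_def using C(1) by (intro sets.countable_UN') auto
  have K_sub: "cball (fst (snd i)) (snd (snd i)) \<subseteq> U" if "i \<in> K" for i
    using that by (cases i) (auto simp: K_def simp del: mem_cball)
  have V_sub: "V \<subseteq> U" using C(2) K_sub unfolding V_def b_def by blast
  have "negligible N"
    using N(1) by (simp add: negligible_iff_null_sets null_sets_completionI)
  then have "negligible (N \<union> (S - V))"
    using C(4) by (auto simp: V_def b_def)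
  then have "negligible (U - V)"
    using N(2) by (elim negligible_subset) auto
  then have "U - V \<in> null_sets lborel"
    using U V_borel by (simp add: negligible_iff_null_sets null_sets_completion_iff)
  then have "emeasure \<mu> (- V) = 0"
    using ac[of "- V"] V_borel by (auto simp: Int_commute Diff_eq[symmetric])
  then have "emeasure \<mu> UNIV = emeasure \<mu> V"
    using emeasure_Un_null_set[of V \<mu> "- V"] V_borel sets_\<mu> by (auto simp: null_sets_def)
  with a have a_V: "a < emeasure \<mu> V" by simp
  then have "C \<noteq> {}" by (auto simp: V_def)
  define G where "G n = from_nat_into C ` {..<n}" for n
  have "V = (\<Union>n. \<Union>i\<in>G n. b i)"
  proof -
    have "(\<Union>n. G n) = from_nat_into C ` (\<Union>n. {..<n})" by (auto simp: G_def)
    also have "(\<Union>n::nat. {..<n}) = UNIV" by auto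
    also have "from_nat_into C ` UNIV = C" using range_from_nat_into[OF \<open>C \<noteq> {}\<close> C(1)] .
    finally show ?thesis unfolding V_def by blast
  qed
  moreover have "(SUP n. emeasure \<mu> (\<Union>i\<in>G n. b i)) = emeasure \<mu> (\<Union>n. \<Union>i\<in>G n. b i)"
  proof (rule SUP_emeasure_incseq)
    show "range (\<lambda>n. \<Union>i\<in>G n. b i) \<subseteq> sets \<mu>"
    proof -
      have "(\<Union>i\<in>G n. b i) \<in> sets borel" for n
        by (rule sets.finite_UN) (simp_all add: G_def)
      then show ?thesis unfolding sets_\<mu> by blast
    qed
    show "incseq (\<lambda>n. \<Union>i\<in>G n. b i)"
    proof (rule monoI)
      fix n n' :: nat assume "n \<le> n'"
      then have "G n \<subseteq> G n'" unfolding G_def by (intro image_mono) auto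
      then show "(\<Union>i\<in>G n. b i) \<subseteq> (\<Union>i\<in>G n'. b i)" by blast
    qed
  qed
  ultimately have "a < (SUP n. emeasure \<mu> (\<Union>i\<in>G n. b i))" using a_V by simp
  then obtain n where n: "a < emeasure \<mu> (\<Union>i\<in>G n. b i)"
    unfolding less_SUP_iff by blast
  have GC: "G n \<subseteq> C"
    unfolding G_def by (intro image_subsetI from_nat_into \<open>C \<noteq> {}\<close>)
  note pw = pairwise_subset[OF C(3) GC]
  have "emeasure \<mu> (\<Union>i\<in>G n. b i) = (\<Sum>i\<in>G n. emeasure \<mu> (b i))"
    using pw sets_\<mu> by (intro sum_emeasure[symmetric])
      (auto simp: G_def disjoint_family_on_def pairwise_def disjnt_def b_def)
  also have "\<dots> = (\<Sum>(E, y, t)\<in>G n. emeasure \<mu> (cball y t))"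
    by (intro sum.cong) (auto simp: b_def)
  finally have sum: "emeasure \<mu> (\<Union>i\<in>G n. b i) = (\<Sum>(E, y, t)\<in>G n. emeasure \<mu> (cball y t))" .
  show ?thesis
  proof (rule that[of "G n"])
    show "finite (G n)" by (simp add: G_def)
    show "G n \<subseteq> \<K>" using GC C(2) by (auto simp: K_def)
    show "t < \<delta> \<and> cball y t \<subseteq> U" if "(E, y, t) \<in> G n" for E y t
      using that GC C(2) by (auto simp: K_def)
  qed (use pw n sum in auto)
qed

text \<open>One step of the construction: the mass of each of finitely many disjoint balls of radius below \<open>\<delta>\<close> is
  distributed uniformly over the piece inside it. The new density may be much larger than \<open>c\<close>, but the
  Frostman constant increases only from \<open>\<kappa>\<close> to \<open>\<kappa>'\<close>, by as little as desired.\<close>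
lemma spread_measure_refine:
  fixes U :: "'a::euclidean_space set"
  assumes f_pos: "\<And>x. 0 < x \<Longrightarrow> 0 < f x" and f_mono: "\<And>x y. 0 < x \<Longrightarrow> x \<le> y \<Longrightarrow> f x \<le> f y"
    and f_large: "\<And>C. \<exists>\<rho>0>0. \<forall>\<rho>. 0 < \<rho> \<longrightarrow> \<rho> < \<rho>0 \<longrightarrow> C * \<rho> ^ DIM('a) \<le> f \<rho>"
    and \<eta>: "0 < \<eta>" and \<kappa>: "1 \<le> \<kappa>" "\<kappa> < \<kappa>'"
    and spread: "spread_measure f \<eta> a \<kappa> (U, \<mu>, c)"
    and cover: "AE x in lborel. x \<in> U \<longrightarrow> (\<forall>\<delta>>0. \<exists>E y t. gauge_piece f c E y t \<and> E \<subseteq> W \<and> x \<in> cball y t \<and> t < \<delta>)"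
  obtains U' \<mu>' c' where "spread_measure f \<eta> a \<kappa>' (U', \<mu>', c')" "closure U' \<subseteq> U" "U' \<subseteq> W"
proof -
  let ?d = "DIM('a)"
  let ?V = "unit_ball_vol (real ?d)"
  have V: "0 < ?V" by simp
  then have V0: "?V \<noteq> 0" by linarith
  from spread have U: "open U" "bounded U" and c: "0 < c" and sets_\<mu>: "sets \<mu> = sets borel"
    and ac: "\<And>A. A \<in> sets borel \<Longrightarrow> emeasure \<mu> A \<le> ennreal c * emeasure lborel (A \<inter> U)"
    and a: "a < emeasure \<mu> UNIV"
    and balls: "\<And>z \<rho>. 0 < \<rho> \<Longrightarrow> \<rho> \<le> \<eta> \<Longrightarrow> emeasure \<mu> (cball z \<rho>) \<le> ennreal (\<kappa> * f \<rho>)"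
    by (auto simp: spread_measure_def)
  have ac': "emeasure \<mu> A \<le> ennreal c * emeasure lborel A" if "A \<in> sets borel" for A
    using ac[OF that] that U(1) by (elim order_trans) (auto intro!: mult_left_mono emeasure_mono)
  \<comment> \<open>Below \<open>\<rho>0\<close>, Lebesgue measure with density \<open>c\<close> on a ball of nine times the radius is cheaper than
    the gauge. This settles small balls that meet several pieces.\<close>
  obtain \<rho>0 where \<rho>0: "0 < \<rho>0" "\<And>\<rho>. 0 < \<rho> \<Longrightarrow> \<rho> < \<rho>0 \<Longrightarrow> (c * ?V * 9 ^ ?d) * \<rho> ^ ?d \<le> f \<rho>"
    using f_large[of "c * ?V * 9 ^ ?d"] by blast
  \<comment> \<open>For radii between \<open>\<rho>0\<close> and \<open>\<eta>\<close>, a shell of width \<open>2 * \<delta>\<close> has mass at most \<open>(\<kappa>' - \<kappa>) * f \<rho>0\<close>.\<close>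
  define \<epsilon> where "\<epsilon> = (\<kappa>' - \<kappa>) * f \<rho>0 / (c * ?V)"
  have \<epsilon>: "0 < \<epsilon>" using \<kappa> c V f_pos[OF \<rho>0(1)] by (simp add: \<epsilon>_def)
  obtain \<delta>0 where \<delta>0: "0 < \<delta>0"
    "\<And>x x'. x \<in> {0..\<eta> + 1} \<Longrightarrow> x' \<in> {0..\<eta> + 1} \<Longrightarrow> dist x' x < \<delta>0 \<Longrightarrow> dist (x' ^ ?d) (x ^ ?d) < \<epsilon>"
  proof -
    have "uniformly_continuous_on {0..\<eta> + 1} (\<lambda>x::real. x ^ ?d)"
      by (intro compact_uniformly_continuous continuous_intros) auto
    then show ?thesis
      using that \<epsilon> unfolding uniformly_continuous_on_def by metis
  qed
  define \<delta> where "\<delta> = min (1 / 2) (\<delta>0 / 4)"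
  have \<delta>: "0 < \<delta>" using \<delta>0(1) by (simp add: \<delta>_def)
  have thicken: "emeasure \<mu> (cball z (\<rho> + 2 * \<delta>)) \<le> ennreal (\<kappa>' * f \<rho>)"
    if \<rho>: "\<rho>0 \<le> \<rho>" "\<rho> \<le> \<eta>" for z \<rho>
  proof -
    have "0 < \<rho>" using \<rho> \<rho>0 by simp
    have "dist ((\<rho> + 2 * \<delta>) ^ ?d) (\<rho> ^ ?d) < \<epsilon>"
      using \<rho> \<open>0 < \<rho>\<close> \<delta>0(1) by (intro \<delta>0(2)) (auto simp: \<delta>_def dist_real_def)
    then have "(\<rho> + 2 * \<delta>) ^ ?d - \<rho> ^ ?d \<le> \<epsilon>" by (simp add: dist_real_def)
    then have "c * ?V * ((\<rho> + 2 * \<delta>) ^ ?d - \<rho> ^ ?d) \<le> c * ?V * \<epsilon>"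
      using c V by (intro mult_left_mono) auto
    also have "\<dots> = (\<kappa>' - \<kappa>) * f \<rho>0" using c V0 by (simp add: \<epsilon>_def)
    also have "\<dots> \<le> (\<kappa>' - \<kappa>) * f \<rho>" using \<kappa> f_mono[OF \<rho>0(1) \<rho>(1)] by (intro mult_left_mono) auto
    finally have shell: "c * (?V * (\<rho> + 2 * \<delta>) ^ ?d - ?V * \<rho> ^ ?d) \<le> (\<kappa>' - \<kappa>) * f \<rho>"
      by (simp add: algebra_simps)
    have "emeasure \<mu> (cball z (\<rho> + 2 * \<delta>)) = emeasure \<mu> (cball z \<rho> \<union> (cball z (\<rho> + 2 * \<delta>) - cball z \<rho>))"
      using \<delta> by (intro arg_cong[of _ _ "emeasure \<mu>"]) auto
    also have "\<dots> \<le> emeasure \<mu> (cball z \<rho>) + emeasure \<mu> (cball z (\<rho> + 2 * \<delta>) - cball z \<rho>)"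
      using sets_\<mu> by (intro emeasure_subadditive) auto
    also have "\<dots> \<le> ennreal (\<kappa> * f \<rho>) + ennreal c * emeasure lborel (cball z (\<rho> + 2 * \<delta>) - cball z \<rho>)"
      using \<rho> \<open>0 < \<rho>\<close> by (intro add_mono balls ac') auto
    also have "emeasure lborel (cball z (\<rho> + 2 * \<delta>) - cball z \<rho>) = ennreal (?V * (\<rho> + 2 * \<delta>) ^ ?d - ?V * \<rho> ^ ?d)"
      using \<open>0 < \<rho>\<close> \<delta> by (subst emeasure_Diff) (auto simp: emeasure_cball ennreal_minus)
    also have "ennreal c * \<dots> = ennreal (c * (?V * (\<rho> + 2 * \<delta>) ^ ?d - ?V * \<rho> ^ ?d))"
      using c by (simp add: ennreal_mult')
    also have "ennreal (\<kappa> * f \<rho>) + \<dots> \<le> ennreal (\<kappa> * f \<rho>) + ennreal ((\<kappa>' - \<kappa>) * f \<rho>)"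
      using shell by (intro add_left_mono ennreal_leI)
    also have "\<dots> = ennreal (\<kappa>' * f \<rho>)"
      using \<kappa> f_pos[OF \<open>0 < \<rho>\<close>] by (subst ennreal_plus[symmetric]) (auto simp: algebra_simps)
    finally show ?thesis .
  qed
  define \<K> where "\<K> = {(E, y, t). gauge_piece f c E y t \<and> E \<subseteq> W}"
  obtain F where F: "finite F" "F \<subseteq> \<K>"
    and F_ball: "\<And>E y t. (E, y, t) \<in> F \<Longrightarrow> t < \<delta> \<and> cball y t \<subseteq> U"
    and F_disj: "pairwise (\<lambda>i j. disjnt (cball (fst (snd i)) (snd (snd i))) (cball (fst (snd j)) (snd (snd j)))) F"
    and F_mass: "a < (\<Sum>(E, y, t)\<in>F. emeasure \<mu> (cball y t))"
  proof (rule finite_Vitali_subfamily[OF U(1) sets_\<mu> ac a, of \<K> \<delta>])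
    show "0 < t" if "(E, y, t) \<in> \<K>" for E y t using that by (auto simp: \<K>_def gauge_piece_def)
    show "AE x in lborel. x \<in> U \<longrightarrow> (\<forall>\<delta>>0. \<exists>(E, y, t)\<in>\<K>. x \<in> cball y t \<and> t < \<delta>)"
      using cover by eventually_elim (fastforce simp: \<K>_def)
  qed (use \<delta> in auto)
  define E where "E k = fst k" for k :: "'a set \<times> 'a \<times> real"
  define b where "b k = cball (fst (snd k)) (snd (snd k))" for k :: "'a set \<times> 'a \<times> real"
  define t where "t k = snd (snd k)" for k :: "'a set \<times> 'a \<times> real"
  have piece: "gauge_piece f c (E k) (fst (snd k)) (t k)" "E k \<subseteq> W" if "k \<in> F" for k
  proof -
    have "k \<in> \<K>" using F(2) that by blast
    then show "gauge_piece f c (E k) (fst (snd k)) (t k)" "E k \<subseteq> W"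
      by (cases k; simp add: \<K>_def E_def t_def)+
  qed
  have tk: "0 < t k" "t k < \<delta>" "b k \<subseteq> U" if "k \<in> F" for k
    using piece(1)[OF that] F_ball[of "fst k" "fst (snd k)" "t k"] that
    by (auto simp: gauge_piece_def t_def b_def)
  have Ek: "open (E k)" "E k \<noteq> {}" "E k \<subseteq> cball (fst (snd k)) (t k / 2)" "E k \<subseteq> b k" if "k \<in> F" for k
    using piece(1)[OF that] tk[OF that] unfolding gauge_piece_def b_def t_def[symmetric] by auto
  have Ek_bounded: "bounded (E k)" if "k \<in> F" for k
    using Ek(3)[OF that] bounded_cball bounded_subset by blast
  have Ek_pos: "0 < measure lborel (E k)" if "k \<in> F" for k
    using Ek[OF that] Ek_bounded[OF that] by (intro open_measure_pos) auto
  have Ek_em: "emeasure lborel (E k \<inter> A) = ennreal (measure lborel (E k \<inter> A))" if "k \<in> F" for k A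
    using emeasure_bounded_finite[of "E k \<inter> A"] Ek_bounded[OF that]
    by (intro emeasure_eq_ennreal_measure) (auto simp: bounded_Int)
  have b_borel: "b k \<in> sets borel" for k by (simp add: b_def)
  have b_em: "emeasure lborel (b k) = ennreal (measure lborel (b k))" for k
    using emeasure_bounded_finite[of "b k"] by (intro emeasure_eq_ennreal_measure) (auto simp: b_def)
  define m where "m k = measure \<mu> (b k)" for k
  have m_em: "emeasure \<mu> (b k) = ennreal (m k)" and m_le: "m k \<le> c * measure lborel (b k)" for k
  proof -
    have le: "emeasure \<mu> (b k) \<le> ennreal (c * measure lborel (b k))"
      using ac'[OF b_borel[of k]] c by (simp add: b_em ennreal_mult)
    then have "emeasure \<mu> (b k) \<noteq> \<infinity>" by (auto simp: top_unique)
    then show eq: "emeasure \<mu> (b k) = ennreal (m k)"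
      unfolding m_def by (intro emeasure_eq_ennreal_measure) auto
    show "m k \<le> c * measure lborel (b k)"
      using le c unfolding eq by (subst (asm) ennreal_le_iff) auto
  qed
  have m_nonneg: "0 \<le> m k" for k by (simp add: m_def)
  define w where "w k = m k / measure lborel (E k)" for k
  have w_nonneg: "0 \<le> w k" for k by (simp add: w_def m_nonneg)
  define U' where "U' = (\<Union>k\<in>F. E k)"
  define \<mu>' where "\<mu>' = density lborel (\<lambda>x. \<Sum>k\<in>F. ennreal (w k) * indicator (E k) x)"
  \<comment> \<open>The summand 1 keeps the bound positive even if all weights vanish.\<close>
  define c' where "c' = 1 + (\<Sum>k\<in>F. w k)"
  have \<mu>': "emeasure \<mu>' A = (\<Sum>k\<in>F. ennreal (w k * measure lborel (E k \<inter> A)))" if [measurable]: "A \<in> sets borel" for A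
  proof -
    have [measurable]: "E k \<in> sets borel" if "k \<in> F" for k using Ek(1)[OF that] by simp
    have "emeasure \<mu>' A = (\<integral>\<^sup>+x. (\<Sum>k\<in>F. ennreal (w k) * indicator (E k \<inter> A) x) \<partial>lborel)"
      unfolding \<mu>'_def
      by (subst emeasure_density) (auto intro!: nn_integral_cong simp: sum_distrib_right indicator_inter_arith mult.assoc)
    also have "\<dots> = (\<Sum>k\<in>F. \<integral>\<^sup>+x. ennreal (w k) * indicator (E k \<inter> A) x \<partial>lborel)"
      by (rule nn_integral_sum) measurable
    also have "\<dots> = (\<Sum>k\<in>F. ennreal (w k * measure lborel (E k \<inter> A)))"
      by (intro sum.cong refl) (simp add: nn_integral_cmult Ek_em ennreal_mult w_nonneg)
    finally show ?thesis .
  qed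
  have term_le_m: "w k * measure lborel (E k \<inter> A) \<le> m k" if "k \<in> F" "A \<in> sets borel" for k A
  proof -
    have "measure lborel (E k \<inter> A) \<le> measure lborel (E k)"
      using that Ek(1)[OF that(1)] Ek_em[of k UNIV] by (intro measure_mono_fmeasurable) (auto simp: fmeasurable_def)
    then show ?thesis
      using Ek_pos[OF that(1)] m_nonneg[of k] unfolding w_def
      by (simp add: divide_simps mult_left_mono)
  qed
  have \<mu>'_ball: "emeasure \<mu>' (cball z \<rho>) \<le> ennreal (\<kappa>' * f \<rho>)" if \<rho>: "0 < \<rho>" "\<rho> \<le> \<eta>" for z \<rho>
  proof -
    define F' where "F' = {k\<in>F. E k \<inter> cball z \<rho> \<noteq> {}}"
    have F': "F' \<subseteq> F" "finite F'" using F by (auto simp: F'_def)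
    have sum_F': "emeasure \<mu>' (cball z \<rho>) = (\<Sum>k\<in>F'. ennreal (w k * measure lborel (E k \<inter> cball z \<rho>)))"
      using F(1) by (subst \<mu>') (auto simp: F'_def intro!: sum.mono_neutral_cong_right)
    show ?thesis
    proof (cases "\<exists>k. F' \<subseteq> {k}")
      case True
      then consider "F' = {}" | k where "F' = {k}" "k \<in> F" using F'(1) by blast
      then show ?thesis
      proof cases
        case 2
        have "w k * measure lborel (E k \<inter> cball z \<rho>) \<le> c * measure lborel (b k) / measure lborel (E k) * measure lborel (E k \<inter> cball z \<rho>)"
          unfolding w_def using m_le[of k] Ek_pos[OF 2(2)] by (intro mult_right_mono divide_right_mono) auto
        also have "\<dots> \<le> f \<rho>"
          using piece(1)[OF 2(2)] Ek_pos[OF 2(2)] \<rho>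
          by (simp add: gauge_piece_def b_def t_def divide_simps)
        also have "\<dots> \<le> \<kappa>' * f \<rho>" using \<kappa> f_pos[OF \<rho>(1)] by simp
        finally show ?thesis unfolding sum_F' 2 by (simp add: ennreal_leI)
      qed (simp add: sum_F')
    next
      case False
      \<comment> \<open>A point of another piece lies outside \<open>b k\<close>, hence at distance at least \<open>t k / 2\<close> from \<open>E k\<close>.\<close>
      have t_small: "t k \<le> 4 * \<rho>" if k: "k \<in> F'" for k
      proof -
        obtain k' where k': "k' \<in> F'" "k' \<noteq> k" using False k by blast
        obtain p q where p: "p \<in> E k" "p \<in> cball z \<rho>" and q: "q \<in> E k'" "q \<in> cball z \<rho>"
          using k k' by (auto simp: F'_def)
        have "disjnt (b k) (b k')"
          using F_disj k k' F'(1) unfolding pairwise_def b_def by (metis subsetD)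
        moreover have "q \<in> b k'" using Ek(4)[OF subsetD[OF F'(1) k'(1)]] q(1) by blast
        ultimately have "q \<notin> b k" by (auto simp: disjnt_def)
        then have "t k < dist (fst (snd k)) q" by (auto simp: b_def t_def)
        moreover have "dist (fst (snd k)) p \<le> t k / 2"
          using Ek(3)[OF subsetD[OF F'(1) k]] p(1) by auto
        moreover have "dist p q \<le> 2 * \<rho>"
          using p(2) q(2) dist_triangle3[of p q z] by auto
        ultimately show ?thesis
          using dist_triangle[of "fst (snd k)" q p] by linarith
      qed
      have b_sub: "b k \<subseteq> cball z (\<rho> + 2 * t k)" if k: "k \<in> F'" for k
      proof
        fix x assume "x \<in> b k"
        obtain p where p: "p \<in> E k" "p \<in> cball z \<rho>" using k by (auto simp: F'_def)
        have "p \<in> b k" using Ek(4)[OF subsetD[OF F'(1) k]] p(1) by blast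
        then have "dist p x \<le> 2 * t k"
          using \<open>x \<in> b k\<close> dist_triangle3[of p x "fst (snd k)"] by (auto simp: b_def t_def)
        then show "x \<in> cball z (\<rho> + 2 * t k)"
          using p(2) dist_triangle[of z x p] by auto
      qed
      have "emeasure \<mu>' (cball z \<rho>) \<le> (\<Sum>k\<in>F'. emeasure \<mu> (b k))"
        unfolding sum_F' m_em using F'(1) by (intro sum_mono ennreal_leI term_le_m) auto
      also have "\<dots> = emeasure \<mu> (\<Union>k\<in>F'. b k)"
      proof (rule sum_emeasure)
        show "disjoint_family_on b F'"
          using F_disj F'(1) unfolding disjoint_family_on_def pairwise_def disjnt_def b_def
          by (metis subsetD)
      qed (use F'(2) b_borel in \<open>auto simp: sets_\<mu>\<close>)
      finally have le: "emeasure \<mu>' (cball z \<rho>) \<le> emeasure \<mu> (\<Union>k\<in>F'. b k)" .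
      show ?thesis
      proof (cases "\<rho> < \<rho>0")
        case True
        have "(\<Union>k\<in>F'. b k) \<subseteq> cball z (9 * \<rho>)"
        proof (rule UN_least)
          fix k assume "k \<in> F'"
          then show "b k \<subseteq> cball z (9 * \<rho>)"
            using b_sub[of k] t_small[of k] subset_cball[of "\<rho> + 2 * t k" "9 * \<rho>" z] by auto
        qed
        then have "emeasure \<mu> (\<Union>k\<in>F'. b k) \<le> emeasure \<mu> (cball z (9 * \<rho>))"
          using sets_\<mu> by (intro emeasure_mono) auto
        also have "\<dots> \<le> ennreal c * emeasure lborel (cball z (9 * \<rho>))"
          by (intro ac') auto
        also have "\<dots> = ennreal (c * ?V * 9 ^ ?d * \<rho> ^ ?d)"
          using \<rho> c V by (simp add: emeasure_cball ennreal_mult[symmetric] power_mult_distrib mult_ac)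
        also have "\<dots> \<le> ennreal (\<kappa>' * f \<rho>)"
        proof (rule ennreal_leI)
          have "f \<rho> \<le> \<kappa>' * f \<rho>" using \<kappa> f_pos[OF \<rho>(1)] by simp
          then show "c * ?V * 9 ^ ?d * \<rho> ^ ?d \<le> \<kappa>' * f \<rho>"
            using \<rho>0(2)[OF \<rho>(1) True] by simp
        qed
        finally show ?thesis using le by simp
      next
        case big: False
        have "(\<Union>k\<in>F'. b k) \<subseteq> cball z (\<rho> + 2 * \<delta>)"
        proof (rule UN_least)
          fix k assume k: "k \<in> F'"
          have "\<rho> + 2 * t k \<le> \<rho> + 2 * \<delta>" using tk(2)[OF subsetD[OF F'(1) k]] by simp
          then show "b k \<subseteq> cball z (\<rho> + 2 * \<delta>)"
            using b_sub[OF k] subset_cball[of "\<rho> + 2 * t k" "\<rho> + 2 * \<delta>" z] by (meson order_trans)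
        qed
        then have "emeasure \<mu> (\<Union>k\<in>F'. b k) \<le> emeasure \<mu> (cball z (\<rho> + 2 * \<delta>))"
          using sets_\<mu> by (intro emeasure_mono) auto
        also have "\<dots> \<le> ennreal (\<kappa>' * f \<rho>)"
          using big \<rho> by (intro thicken) auto
        finally show ?thesis using le by simp
      qed
    qed
  qed
  have "spread_measure f \<eta> a \<kappa>' (U', \<mu>', c')"
    unfolding spread_measure_def prod.case
  proof (intro conjI ballI allI impI)
    show "open U'" using Ek(1) by (auto simp: U'_def)
    show "bounded U'" using Ek_bounded F(1) by (auto simp: U'_def)
    show "0 < c'" using sum_nonneg[of F w] w_nonneg by (simp add: c'_def add_pos_nonneg)
    show "sets \<mu>' = sets borel" by (simp add: \<mu>'_def)
    show "emeasure \<mu>' A \<le> ennreal c' * emeasure lborel (A \<inter> U')" if A: "A \<in> sets borel" for A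
    proof -
      have "emeasure \<mu>' A \<le> (\<Sum>k\<in>F. ennreal (w k) * emeasure lborel (A \<inter> U'))"
        unfolding \<mu>'[OF A]
      proof (rule sum_mono)
        fix k assume k: "k \<in> F"
        have "ennreal (w k * measure lborel (E k \<inter> A)) = ennreal (w k) * emeasure lborel (E k \<inter> A)"
          by (simp add: Ek_em[OF k] ennreal_mult w_nonneg)
        also have "\<dots> \<le> ennreal (w k) * emeasure lborel (A \<inter> U')"
          using A k \<open>open U'\<close> by (intro mult_left_mono emeasure_mono) (auto simp: U'_def)
        finally show "ennreal (w k * measure lborel (E k \<inter> A)) \<le> ennreal (w k) * emeasure lborel (A \<inter> U')" .
      qed
      also have "\<dots> = ennreal (\<Sum>k\<in>F. w k) * emeasure lborel (A \<inter> U')"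
        by (simp add: sum_distrib_right[symmetric] w_nonneg)
      also have "\<dots> \<le> ennreal c' * emeasure lborel (A \<inter> U')"
        by (intro mult_right_mono ennreal_leI) (auto simp: c'_def)
      finally show ?thesis .
    qed
    have "emeasure \<mu>' UNIV = (\<Sum>k\<in>F. ennreal (m k))"
      using less_imp_neq[OF Ek_pos] by (subst \<mu>') (auto simp: w_def intro!: sum.cong)
    also have "\<dots> = (\<Sum>(E, y, t)\<in>F. emeasure \<mu> (cball y t))"
      by (intro sum.cong refl) (auto simp: m_em[symmetric] b_def)
    finally show "a < emeasure \<mu>' UNIV" using F_mass by simp
  qed (rule \<mu>'_ball)
  moreover have "closure U' \<subseteq> U"
  proof -
    have "closure U' \<subseteq> (\<Union>k\<in>F. b k)"
      using F(1) Ek(4) unfolding U'_def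
      by (intro closure_minimal UN_mono closed_UN) (auto simp: b_def)
    then show ?thesis using tk(3) by blast
  qed
  moreover have "U' \<subseteq> W" using piece(2) by (auto simp: U'_def)
  ultimately show ?thesis by (rule that)
qed

text \<open>The Frostman constants increase from 1 but stay below 2, so they do not deteriorate in the limit.\<close>
lemma nested_spread_measures:
  fixes U0 :: "'a::euclidean_space set" and W :: "nat \<Rightarrow> 'a set"
  assumes f_pos: "\<And>x. 0 < x \<Longrightarrow> 0 < f x" and f_mono: "\<And>x y. 0 < x \<Longrightarrow> x \<le> y \<Longrightarrow> f x \<le> f y"
    and f_large: "\<And>C. \<exists>\<rho>0>0. \<forall>\<rho>. 0 < \<rho> \<longrightarrow> \<rho> < \<rho>0 \<longrightarrow> C * \<rho> ^ DIM('a) \<le> f \<rho>"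
    and \<eta>: "0 < \<eta>" and spread: "spread_measure f \<eta> a 1 (U0, \<mu>0, c0)"
    and cover: "\<And>c N. 0 < c \<Longrightarrow> AE x in lborel. x \<in> U0 \<longrightarrow>
      (\<forall>\<delta>>0. \<exists>E y t. gauge_piece f c E y t \<and> (\<exists>n\<ge>N. E \<subseteq> W n) \<and> x \<in> cball y t \<and> t < \<delta>)"
  obtains U :: "nat \<Rightarrow> 'a set" and \<mu> c where
    "\<And>n. spread_measure f \<eta> a 2 (U n, \<mu> n, c n)" "U 0 = U0"
    "\<And>n. closure (U (Suc n)) \<subseteq> U n" "\<And>n. U (Suc n) \<subseteq> (\<Union>m\<in>{n..}. W m)"
proof -
  define \<kappa> :: "nat \<Rightarrow> real" where "\<kappa> n = 2 - (1 / 2) ^ n" for n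
  have \<kappa>: "1 \<le> \<kappa> n" "\<kappa> n < \<kappa> (Suc n)" "\<kappa> n \<le> 2" for n
    by (auto simp: \<kappa>_def power_le_one)
  define P where "P n X \<longleftrightarrow> spread_measure f \<eta> a (\<kappa> n) X \<and> fst X \<subseteq> U0 \<and> (n = 0 \<longrightarrow> fst X = U0)"
    for n and X :: "'a set \<times> 'a measure \<times> real"
  define R where "R n X Y \<longleftrightarrow> closure (fst Y) \<subseteq> fst X \<and> fst Y \<subseteq> (\<Union>m\<in>{n..}. W m)"
    for n and X Y :: "'a set \<times> 'a measure \<times> real"
  have "\<exists>g. \<forall>n. P n (g n) \<and> R n (g n) (g (Suc n))"
  proof (rule dependent_nat_choice)
    show "\<exists>X. P 0 X"
      using spread by (intro exI[of _ "(U0, \<mu>0, c0)"]) (simp add: P_def \<kappa>_def)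
    fix X n assume X: "P n X"
    obtain V \<mu> c where X_eq: "X = (V, \<mu>, c)" by (cases X) auto
    have c: "0 < c" and V: "V \<subseteq> U0" using X by (auto simp: X_eq P_def spread_measure_def)
    have cover_V: "AE x in lborel. x \<in> V \<longrightarrow>
      (\<forall>\<delta>>0. \<exists>E y t. gauge_piece f c E y t \<and> E \<subseteq> (\<Union>m\<in>{n..}. W m) \<and> x \<in> cball y t \<and> t < \<delta>)"
      using cover[OF c, of n]
    proof eventually_elim
      case (elim x)
      show ?case
      proof (intro impI allI)
        fix \<delta> :: real assume "x \<in> V" "0 < \<delta>"
        then have "x \<in> U0" using V by blast
        then obtain E y t m where "gauge_piece f c E y t" "m \<ge> n" "E \<subseteq> W m" "x \<in> cball y t" "t < \<delta>"
          using elim[rule_format, OF _ \<open>0 < \<delta>\<close>] by blast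
        then show "\<exists>E y t. gauge_piece f c E y t \<and> E \<subseteq> (\<Union>m\<in>{n..}. W m) \<and> x \<in> cball y t \<and> t < \<delta>"
          by (intro exI[of _ E] exI[of _ y] exI[of _ t]) auto
      qed
    qed
    have spread_X: "spread_measure f \<eta> a (\<kappa> n) (V, \<mu>, c)" using X by (simp add: P_def X_eq)
    obtain V' \<mu>' c' where "spread_measure f \<eta> a (\<kappa> (Suc n)) (V', \<mu>', c')" "closure V' \<subseteq> V"
        "V' \<subseteq> (\<Union>m\<in>{n..}. W m)"
      by (rule spread_measure_refine[OF f_pos f_mono f_large \<eta> \<kappa>(1) \<kappa>(2) spread_X cover_V])
    then show "\<exists>Y. P (Suc n) Y \<and> R n X Y"
      using V closure_subset[of V'] by (intro exI[of _ "(V', \<mu>', c')"]) (auto simp: P_def R_def X_eq)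
  qed
  then obtain g where g: "\<And>n. P n (g n)" "\<And>n. R n (g n) (g (Suc n))" by blast
  show ?thesis
  proof (rule that[of "\<lambda>n. fst (g n)" "\<lambda>n. fst (snd (g n))" "\<lambda>n. snd (snd (g n))"])
    fix n
    have *: "spread_measure f \<eta> a (\<kappa> n) (g n)" using g(1) by (simp add: P_def)
    obtain V \<mu> c where eq: "g n = (V, \<mu>, c)" by (cases "g n") auto
    have "ennreal (\<kappa> n * f \<rho>) \<le> ennreal (2 * f \<rho>)" if "0 < \<rho>" for \<rho>
      using f_pos[OF that] \<kappa>(3)[of n] by (intro ennreal_leI mult_right_mono) auto
    then show "spread_measure f \<eta> a 2 (fst (g n), fst (snd (g n)), snd (snd (g n)))"
      using * unfolding spread_measure_def eq by (simp, meson order_trans)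
    show "fst (g 0) = U0" using g(1)[of 0] by (simp add: P_def)
    show "closure (fst (g (Suc n))) \<subseteq> fst (g n)" "fst (g (Suc n)) \<subseteq> (\<Union>m\<in>{n..}. W m)"
      using g(2)[of n] by (auto simp: R_def)
  qed
qed

text \<open>The mass distribution principle, without a limit measure. The closures of the supports decrease to
  a compact subset of the limsup set. If every ball of a cover is replaced by the concentric open ball
  whose radius is the old diameter, then by compactness finitely many of these balls cover the support
  of some stage, and the Frostman condition at that stage bounds the cost from below.\<close>
lemma hausdorff_premeasure_limsup_lower_bound:
  fixes U0 :: "'a::euclidean_space set" and W :: "nat \<Rightarrow> 'a set"
  assumes f_pos: "\<And>x. 0 < x \<Longrightarrow> 0 < f x" and f_mono: "\<And>x y. 0 < x \<Longrightarrow> x \<le> y \<Longrightarrow> f x \<le> f y"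
    and f_large: "\<And>C. \<exists>\<rho>0>0. \<forall>\<rho>. 0 < \<rho> \<longrightarrow> \<rho> < \<rho>0 \<longrightarrow> C * \<rho> ^ DIM('a) \<le> f \<rho>"
    and U0: "open U0" "bounded U0" and a: "a < emeasure lborel U0"
    and cover: "\<And>c N. 0 < c \<Longrightarrow> AE x in lborel. x \<in> U0 \<longrightarrow>
      (\<forall>\<delta>>0. \<exists>E y t. gauge_piece f c E y t \<and> (\<exists>n\<ge>N. E \<subseteq> W n) \<and> x \<in> cball y t \<and> t < \<delta>)"
  obtains \<eta> where "0 < \<eta>" "a \<le> 2 * hausdorff_premeasure f \<eta> {x\<in>U0. infinite {n. x \<in> W n}}"
proof -
  let ?d = "DIM('a)"
  let ?T = "{x\<in>U0. infinite {n. x \<in> W n}}"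
  obtain \<eta>0 where \<eta>0: "0 < \<eta>0" "\<And>\<rho>. 0 < \<rho> \<Longrightarrow> \<rho> < \<eta>0 \<Longrightarrow> unit_ball_vol (real ?d) * \<rho> ^ ?d \<le> f \<rho>"
    using f_large[of "unit_ball_vol (real ?d)"] by blast
  define \<eta> where "\<eta> = \<eta>0 / 2"
  have \<eta>: "0 < \<eta>" "\<eta> < \<eta>0" using \<eta>0 by (auto simp: \<eta>_def)
  have em: "emeasure (density lborel (indicator U0)) A = emeasure lborel (A \<inter> U0)" if "A \<in> sets borel" for A
    using that U0(1) by (subst emeasure_density) (auto simp: indicator_inter_arith[symmetric] Int_commute)
  have "spread_measure f \<eta> a 1 (U0, density lborel (indicator U0), 1)"
    unfolding spread_measure_def prod.case
  proof (intro conjI ballI allI impI)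
    fix z and \<rho> :: real assume \<rho>: "0 < \<rho>" "\<rho> \<le> \<eta>"
    have "emeasure (density lborel (indicator U0)) (cball z \<rho>) \<le> emeasure lborel (cball z \<rho>)"
      using U0(1) by (subst em) (auto intro!: emeasure_mono)
    also have "\<dots> \<le> ennreal (1 * f \<rho>)"
      using \<rho> \<eta> \<eta>0(2)[of \<rho>] by (simp add: emeasure_cball ennreal_leI)
    finally show "emeasure (density lborel (indicator U0)) (cball z \<rho>) \<le> ennreal (1 * f \<rho>)" .
  qed (use U0 a in \<open>auto simp: em\<close>)
  note spread0 = this
  obtain U \<mu> c where spread: "\<And>n. spread_measure f \<eta> a 2 (U n, \<mu> n, c n)" and U_0: "U 0 = U0"
    and nest: "\<And>n. closure (U (Suc n)) \<subseteq> U n" and in_W: "\<And>n. U (Suc n) \<subseteq> (\<Union>m\<in>{n..}. W m)"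
  proof (rule nested_spread_measures[OF f_pos f_mono f_large \<eta>(1) spread0 cover])
    fix U \<mu> c
    assume H: "\<And>n. spread_measure f \<eta> a 2 (U n, \<mu> n, c n)" "U 0 = U0"
      "\<And>n. closure (U (Suc n)) \<subseteq> U n" "\<And>n. U (Suc n) \<subseteq> (\<Union>m\<in>{n..}. W m)"
    show thesis by (rule that[of U \<mu> c]) (fact H)+
  qed
  have compact: "compact (closure (U n))" for n
    using spread[of n] by (simp add: spread_measure_def)
  have limit: "(\<Inter>n. closure (U (Suc n))) \<subseteq> ?T"
  proof
    fix x assume "x \<in> (\<Inter>n. closure (U (Suc n)))"
    then have x: "x \<in> U n" for n using nest[of n] by blast
    have "\<exists>m\<ge>n. x \<in> W m" for n using x[of "Suc n"] in_W[of n] by auto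
    then show "x \<in> ?T" using x[of 0] U_0 by (auto simp: infinite_nat_iff_unbounded_le)
  qed
  obtain q where q: "a = ennreal q" "0 \<le> q"
    using a by (cases a) auto
  have "ennreal (q / 2) \<le> hausdorff_premeasure f \<eta> ?T"
    unfolding hausdorff_premeasure_def
  proof (rule Inf_greatest)
    fix s assume "s \<in> {\<Sum>i. ennreal (f (diameter (B i))) |B. (\<forall>i. is_ball (B i) \<and> diameter (B i) \<le> \<eta>) \<and> ?T \<subseteq> (\<Union>i. B i)}"
    then obtain B where s: "s = (\<Sum>i. ennreal (f (diameter (B i))))"
      and B: "\<And>i. is_ball (B i)" "\<And>i. diameter (B i) \<le> \<eta>" "?T \<subseteq> (\<Union>i. B i)" by auto
    have "\<exists>z r. 0 < r \<and> B i \<subseteq> ball z (2 * r) \<and> diameter (B i) = 2 * r" for i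
    proof -
      obtain z r where r: "0 < r" "B i = ball z r \<or> B i = cball z r"
        using B(1)[of i] by (auto simp: is_ball_def)
      have "ball z r \<subseteq> ball z (2 * r)" "cball z r \<subseteq> ball z (2 * r)" using r(1) by auto
      moreover have "diameter (B i) = 2 * r" using r by auto
      ultimately show ?thesis using r by blast
    qed
    then obtain z r where zr: "\<And>i. 0 < r i" "\<And>i. B i \<subseteq> ball (z i) (2 * r i)" "\<And>i. diameter (B i) = 2 * r i"
      by metis
    define G where "G = (\<Union>i. ball (z i) (2 * r i))"
    have "open G" by (auto simp: G_def)
    have T_G: "?T \<subseteq> G" using B(3) zr(2) by (fastforce simp: G_def)
    have "\<exists>n. closure (U (Suc n)) \<subseteq> G"
    proof (rule ccontr)
      assume "\<nexists>n. closure (U (Suc n)) \<subseteq> G"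
      then have ne: "closure (U (Suc n)) - G \<noteq> {}" for n by blast
      have "(\<Inter>n. closure (U (Suc n)) - G) \<noteq> {}"
      proof (rule compact_nest)
        show "compact (closure (U (Suc n)) - G)" for n using compact \<open>open G\<close> by (intro compact_diff)
        show "closure (U (Suc n)) - G \<subseteq> closure (U (Suc m)) - G" if "m \<le> n" for m n
        proof -
          have "closure (U (Suc (Suc k))) \<subseteq> closure (U (Suc k))" for k
            using nest[of "Suc k"] closure_subset by blast
          then have "closure (U (Suc n)) \<subseteq> closure (U (Suc m))"
            using lift_Suc_antimono_le[of "\<lambda>k. closure (U (Suc k))"] that by blast
          then show ?thesis by blast
        qed
      qed (use ne in auto)
      then show False using limit T_G by blast
    qed
    then obtain n where n: "closure (U (Suc n)) \<subseteq> G" ..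
    obtain I where I: "finite I" "closure (U (Suc n)) \<subseteq> (\<Union>i\<in>I. ball (z i) (2 * r i))"
    proof (rule compactE_image[OF compact[of "Suc n"], of UNIV "\<lambda>i. ball (z i) (2 * r i)"])
      show "closure (U (Suc n)) \<subseteq> (\<Union>i. ball (z i) (2 * r i))" using n by (simp add: G_def)
    qed auto
    let ?\<mu> = "\<mu> (Suc n)"
    have sets_\<mu>: "sets ?\<mu> = sets borel"
      and ac: "\<And>A. A \<in> sets borel \<Longrightarrow> emeasure ?\<mu> A \<le> ennreal (c (Suc n)) * emeasure lborel (A \<inter> U (Suc n))"
      and mass: "a < emeasure ?\<mu> UNIV"
      and balls: "\<And>z \<rho>. 0 < \<rho> \<Longrightarrow> \<rho> \<le> \<eta> \<Longrightarrow> emeasure ?\<mu> (cball z \<rho>) \<le> ennreal (2 * f \<rho>)"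
      and "open (U (Suc n))"
      using spread[of "Suc n"] by (auto simp: spread_measure_def)
    have "emeasure ?\<mu> (- U (Suc n)) = 0"
      using ac[of "- U (Suc n)"] \<open>open (U (Suc n))\<close> by simp
    then have "emeasure ?\<mu> UNIV = emeasure ?\<mu> (U (Suc n))"
      using emeasure_Un_null_set[of "U (Suc n)" ?\<mu> "- U (Suc n)"] \<open>open (U (Suc n))\<close> sets_\<mu>
      by (auto simp: null_sets_def)
    also have "\<dots> \<le> emeasure ?\<mu> (\<Union>i\<in>I. cball (z i) (2 * r i))"
    proof (rule emeasure_mono)
      have "(\<Union>i\<in>I. ball (z i) (2 * r i)) \<subseteq> (\<Union>i\<in>I. cball (z i) (2 * r i))"
        by (intro UN_mono ball_subset_cball order_refl)
      then show "U (Suc n) \<subseteq> (\<Union>i\<in>I. cball (z i) (2 * r i))"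
        by (rule order_trans[OF order_trans[OF closure_subset I(2)]])
      show "(\<Union>i\<in>I. cball (z i) (2 * r i)) \<in> sets ?\<mu>"
        using I(1) by (intro sets.finite_UN) (simp_all add: sets_\<mu>)
    qed
    also have "\<dots> \<le> (\<Sum>i\<in>I. emeasure ?\<mu> (cball (z i) (2 * r i)))"
    proof (rule emeasure_subadditive_finite[OF I(1)])
      show "(\<lambda>i. cball (z i) (2 * r i)) ` I \<subseteq> sets ?\<mu>" unfolding sets_\<mu> by auto
    qed
    also have "\<dots> \<le> (\<Sum>i\<in>I. 2 * ennreal (f (diameter (B i))))"
    proof (rule sum_mono)
      fix i assume "i \<in> I"
      have "emeasure ?\<mu> (cball (z i) (2 * r i)) \<le> ennreal (2 * f (2 * r i))"
        using zr(1)[of i] zr(3)[of i] B(2)[of i] by (intro balls) auto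
      then show "emeasure ?\<mu> (cball (z i) (2 * r i)) \<le> 2 * ennreal (f (diameter (B i)))"
        using f_pos[of "2 * r i"] zr(1)[of i] by (simp add: zr(3) ennreal_mult)
    qed
    also have "\<dots> = 2 * (\<Sum>i\<in>I. ennreal (f (diameter (B i))))"
      by (simp add: sum_distrib_left)
    also have "\<dots> \<le> 2 * s"
      unfolding s using I(1) by (intro mult_left_mono sum_le_suminf) auto
    finally have "a \<le> 2 * s" using mass by simp
    then show "ennreal (q / 2) \<le> s"
    proof (cases s)
      case (real x)
      then have "ennreal q \<le> ennreal (2 * x)" using \<open>a \<le> 2 * s\<close> by (simp add: q(1) ennreal_mult)
      then show ?thesis using real q(2) by (simp add: ennreal_le_iff)
    qed simp
  qed
  then have "2 * ennreal (q / 2) \<le> 2 * hausdorff_premeasure f \<eta> ?T"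
    by (rule mult_left_mono) simp
  moreover have "2 * ennreal (q / 2) = a"
  proof -
    have "2 * ennreal (q / 2) = ennreal (2 * (q / 2))"
      using q(2) by (subst ennreal_mult) auto
    then show ?thesis by (simp add: q(1))
  qed
  ultimately have "a \<le> 2 * hausdorff_premeasure f \<eta> ?T" by simp
  with \<eta>(1) show ?thesis by (rule that)
qed

text \<open>The lower bound for \<open>f / M\<close> has the same mass \<open>a\<close> for all \<open>M\<close>, since pieces for \<open>f\<close> with constant
  \<open>c * M\<close> are pieces for \<open>f / M\<close> with constant \<open>c\<close>; only the scale \<open>\<eta>\<close> depends on \<open>M\<close>.\<close>
theorem mass_transference_gauge_pieces:
  fixes U0 :: "'a::euclidean_space set" and W :: "nat \<Rightarrow> 'a set"
  assumes f_pos: "\<And>x. 0 < x \<Longrightarrow> 0 < f x" and f_mono: "\<And>x y. 0 < x \<Longrightarrow> x \<le> y \<Longrightarrow> f x \<le> f y"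
    and f_large: "\<And>C. \<exists>\<rho>0>0. \<forall>\<rho>. 0 < \<rho> \<longrightarrow> \<rho> < \<rho>0 \<longrightarrow> C * \<rho> ^ DIM('a) \<le> f \<rho>"
    and U0: "open U0" "bounded U0" "U0 \<noteq> {}"
    and cover: "\<And>c N. 0 < c \<Longrightarrow> AE x in lborel. x \<in> U0 \<longrightarrow>
      (\<forall>\<delta>>0. \<exists>E y t. gauge_piece f c E y t \<and> (\<exists>n\<ge>N. E \<subseteq> W n) \<and> x \<in> cball y t \<and> t < \<delta>)"
  shows "hausdorff_measure f {x\<in>U0. infinite {n. x \<in> W n}} = \<infinity>"
proof -
  let ?T = "{x\<in>U0. infinite {n. x \<in> W n}}"
  define a where "a = measure lborel U0 / 2"
  have pos: "0 < measure lborel U0" using U0 by (intro open_measure_pos)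
  then have "0 < a" by (simp add: a_def)
  have a: "ennreal a < emeasure lborel U0"
    using pos emeasure_bounded_finite[OF U0(2)]
    by (subst emeasure_eq_ennreal_measure) (auto simp: a_def ennreal_less_iff)
  have "ennreal (M * a) \<le> 2 * hausdorff_measure f ?T" if M: "0 < M" for M
  proof -
    define g where "g x = f x / M" for x
    obtain \<eta> where \<eta>: "0 < \<eta>" "ennreal a \<le> 2 * hausdorff_premeasure g \<eta> ?T"
    proof (rule hausdorff_premeasure_limsup_lower_bound[of g U0 "ennreal a" W])
      show "0 < g x" if "0 < x" for x using f_pos[OF that] M by (simp add: g_def)
      show "g x \<le> g y" if "0 < x" "x \<le> y" for x y
        using f_mono[OF that] M by (simp add: g_def divide_right_mono)
      show "\<exists>\<rho>0>0. \<forall>\<rho>. 0 < \<rho> \<longrightarrow> \<rho> < \<rho>0 \<longrightarrow> C * \<rho> ^ DIM('a) \<le> g \<rho>" for C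
        using f_large[of "C * M"] M by (simp add: g_def field_simps)
      fix c :: real and N :: nat assume c: "0 < c"
      have imp: "gauge_piece f (c * M) E y t \<Longrightarrow> gauge_piece g c E y t" for E :: "'a set" and y t
        using M by (auto simp: gauge_piece_def g_def field_simps)
      show "AE x in lborel. x \<in> U0 \<longrightarrow>
        (\<forall>\<delta>>0. \<exists>E y t. gauge_piece g c E y t \<and> (\<exists>n\<ge>N. E \<subseteq> W n) \<and> x \<in> cball y t \<and> t < \<delta>)"
        using cover[OF mult_pos_pos[OF c M], of N]
      proof (rule eventually_mono)
        fix x
        assume H: "x \<in> U0 \<longrightarrow> (\<forall>\<delta>>0. \<exists>E y t. gauge_piece f (c * M) E y t \<and> (\<exists>n\<ge>N. E \<subseteq> W n) \<and> x \<in> cball y t \<and> t < \<delta>)"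
        show "x \<in> U0 \<longrightarrow> (\<forall>\<delta>>0. \<exists>E y t. gauge_piece g c E y t \<and> (\<exists>n\<ge>N. E \<subseteq> W n) \<and> x \<in> cball y t \<and> t < \<delta>)"
          using H imp by meson
      qed
    qed (use U0 a in auto)
    have "ennreal M * hausdorff_premeasure g \<eta> ?T \<le> hausdorff_premeasure f \<eta> ?T"
      unfolding hausdorff_premeasure_def[of f]
    proof (rule Inf_greatest)
      fix s assume "s \<in> {\<Sum>i. ennreal (f (diameter (B i))) |B. (\<forall>i. is_ball (B i) \<and> diameter (B i) \<le> \<eta>) \<and> ?T \<subseteq> (\<Union>i. B i)}"
      then obtain B where s: "s = (\<Sum>i. ennreal (f (diameter (B i))))"
        and B: "\<And>i. is_ball (B i)" "\<And>i. diameter (B i) \<le> \<eta>" "?T \<subseteq> (\<Union>i. B i)" by auto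
      have "ennreal M * hausdorff_premeasure g \<eta> ?T \<le> ennreal M * (\<Sum>i. ennreal (g (diameter (B i))))"
        by (intro mult_left_mono hausdorff_premeasure_le_cover B) auto
      also have "\<dots> = (\<Sum>i. ennreal M * ennreal (g (diameter (B i))))"
        by (rule ennreal_suminf_cmult[symmetric])
      also have "\<dots> = s"
        unfolding s using M by (intro suminf_cong) (simp add: g_def ennreal_mult'[symmetric])
      finally show "ennreal M * hausdorff_premeasure g \<eta> ?T \<le> s" .
    qed
    also have "\<dots> \<le> hausdorff_measure f ?T" by (rule hausdorff_premeasure_le_measure) (rule \<eta>)
    finally have "2 * (ennreal M * hausdorff_premeasure g \<eta> ?T) \<le> 2 * hausdorff_measure f ?T"
      by (intro mult_left_mono) auto
    moreover have "ennreal (M * a) \<le> 2 * (ennreal M * hausdorff_premeasure g \<eta> ?T)"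
      using mult_left_mono[OF \<eta>(2), of "ennreal M"] M by (simp add: ennreal_mult' mult.left_commute)
    ultimately show ?thesis by (rule order_trans[rotated])
  qed
  note scaled = this
  have "ennreal x \<le> 2 * hausdorff_measure f ?T" for x
  proof (cases "0 < x")
    case True
    then show ?thesis using \<open>0 < a\<close> scaled[of "x / a"] by simp
  next
    case False
    then show ?thesis by (simp add: not_less ennreal_neg)
  qed
  note large = this
  show ?thesis
  proof (rule ccontr)
    assume "hausdorff_measure f ?T \<noteq> \<infinity>"
    then have "2 * hausdorff_measure f ?T \<noteq> top"
      by (simp add: ennreal_mult_eq_top_iff)
    then obtain q where "0 \<le> q" "2 * hausdorff_measure f ?T = ennreal q"
      by (cases "2 * hausdorff_measure f ?T") auto
    then show False using large[of "q + 1"] by simp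
  qed
qed

section \<open>Summable costs\<close>

lemma interval_near_mod_1_cover:
  fixes x r \<rho> :: real
  assumes "0 < r" "0 < \<rho>"
  obtains P :: "real set" where "finite P" "real (card P) \<le> 35 * max 1 (r / \<rho>)"
    "\<And>b. 0 \<le> b \<Longrightarrow> b < 1 \<Longrightarrow> dist_to_int (x - b) \<le> r \<Longrightarrow> \<exists>p\<in>P. \<bar>b - p\<bar> \<le> \<rho>"
proof -
  \<comment> \<open>A grid of step \<open>\<rho>\<close> on the interval of half-length \<open>r\<close> around each integer translate of \<open>x\<close> near the
    unit interval.\<close>
  define M where "M = \<lceil>r / \<rho>\<rceil>"
  define I where "I = {\<lfloor>x\<rfloor> - 2..\<lfloor>x\<rfloor> + 2} \<times> {- M - 1..M + 1}"
  define P where "P = (\<lambda>(k, j). x - of_int k - of_int j * \<rho>) ` I"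
  have "0 \<le> r / \<rho>" using assms by simp
  then have M: "0 \<le> M" unfolding M_def by linarith
  show ?thesis
  proof (rule that[of P])
    show "finite P" by (simp add: P_def I_def)
    have "card P \<le> card I" unfolding P_def by (rule card_image_le) (simp add: I_def)
    also have "card I = 5 * nat (2 * M + 3)" using M by (simp add: I_def card_cartesian_product)
    finally have "real (card P) \<le> real (5 * nat (2 * M + 3))" by (rule of_nat_mono)
    also have "\<dots> = 5 * (2 * of_int M + 3)" using M by simp
    also have "\<dots> \<le> 5 * (2 * (r / \<rho> + 1) + 3)"
    proof -
      have "of_int M \<le> r / \<rho> + 1" unfolding M_def by (rule of_int_ceiling_le_add_one)
      then show ?thesis by simp
    qed
    also have "\<dots> \<le> 35 * max 1 (r / \<rho>)" by (simp add: max_def)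
    finally show "real (card P) \<le> 35 * max 1 (r / \<rho>)" .
  next
    fix b assume b: "0 \<le> b" "b < 1" "dist_to_int (x - b) \<le> r"
    define k where "k = round (x - b)"
    define e where "e = x - b - of_int k"
    define j where "j = \<lfloor>e / \<rho>\<rfloor>"
    have e: "\<bar>e\<bar> \<le> r" using b by (simp add: e_def k_def dist_to_int_def)
    have "of_int k \<le> x - b + 1 / 2" "x - b - 1 / 2 \<le> of_int k"
      using of_int_round_abs_le[of "x - b"] unfolding k_def by linarith+
    then have k: "k \<in> {\<lfloor>x\<rfloor> - 2..\<lfloor>x\<rfloor> + 2}" using b by simp linarith
    have "\<bar>e / \<rho>\<bar> \<le> r / \<rho>" using e assms by (simp add: divide_right_mono)
    moreover have "r / \<rho> \<le> of_int M" by (simp add: M_def)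
    ultimately have "- of_int M \<le> e / \<rho>" "e / \<rho> \<le> of_int M" by linarith+
    then have "j \<in> {- M - 1..M + 1}" unfolding j_def by (simp add: le_floor_iff floor_le_iff)
    with k have "(k, j) \<in> I" by (simp add: I_def)
    then have "x - of_int k - of_int j * \<rho> \<in> P" unfolding P_def by force
    moreover have "\<bar>b - (x - of_int k - of_int j * \<rho>)\<bar> \<le> \<rho>"
    proof -
      have "of_int j \<le> e / \<rho>" "e / \<rho> < of_int j + 1" unfolding j_def by linarith+
      then have "of_int j * \<rho> \<le> e" "e \<le> (of_int j + 1) * \<rho>"
        using assms by (simp_all add: field_simps)
      then show ?thesis by (simp add: e_def algebra_simps abs_le_iff)
    qed
    ultimately show "\<exists>p\<in>P. \<bar>b - p\<bar> \<le> \<rho>" by blast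
  qed
qed

lemma rectangle_near_mod_1_cover:
  fixes y v :: "real ^ 'n"
  assumes v: "\<And>i. 0 < v $ i" and \<rho>: "0 < \<rho>"
  obtains P :: "(real ^ 'n) set" where "finite P"
    "real (card P) \<le> 35 ^ CARD('n) * (\<Prod>i\<in>UNIV. max 1 (v $ i / \<rho>))"
    "{\<beta>\<in>unit_cube. y - \<beta> \<in> near_mod_1 v} \<subseteq> (\<Union>p\<in>P. cball p (real CARD('n) * \<rho>))"
proof -
  have "\<exists>Q. finite Q \<and> real (card Q) \<le> 35 * max 1 (v $ i / \<rho>) \<and>
      (\<forall>b. 0 \<le> b \<longrightarrow> b < 1 \<longrightarrow> dist_to_int (y $ i - b) \<le> v $ i \<longrightarrow> (\<exists>p\<in>Q. \<bar>b - p\<bar> \<le> \<rho>))" for i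
    using interval_near_mod_1_cover[OF v \<rho>, of i "y $ i"] by metis
  then obtain Q where Q: "\<And>i. finite (Q i)" "\<And>i. real (card (Q i)) \<le> 35 * max 1 (v $ i / \<rho>)"
      "\<And>i b. 0 \<le> b \<Longrightarrow> b < 1 \<Longrightarrow> dist_to_int (y $ i - b) \<le> v $ i \<Longrightarrow> \<exists>p\<in>Q i. \<bar>b - p\<bar> \<le> \<rho>"
    by metis
  define P where "P = vec_lambda ` PiE UNIV Q"
  show ?thesis
  proof (rule that[of P])
    show "finite P" using Q(1) by (simp add: P_def finite_PiE)
    have "card P \<le> card (PiE UNIV Q)" unfolding P_def using Q(1) by (intro card_image_le finite_PiE) auto
    also have "\<dots> = (\<Prod>i\<in>UNIV. card (Q i))" by (rule card_PiE) simp
    finally have "real (card P) \<le> (\<Prod>i\<in>UNIV. real (card (Q i)))"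
      by (metis of_nat_mono of_nat_prod)
    also have "\<dots> \<le> (\<Prod>i\<in>UNIV. 35 * max 1 (v $ i / \<rho>))"
      using Q(2) by (intro prod_mono) auto
    also have "\<dots> = 35 ^ CARD('n) * (\<Prod>i\<in>UNIV. max 1 (v $ i / \<rho>))"
      by (simp add: prod.distrib)
    finally show "real (card P) \<le> 35 ^ CARD('n) * (\<Prod>i\<in>UNIV. max 1 (v $ i / \<rho>))" .
    show "{\<beta>\<in>unit_cube. y - \<beta> \<in> near_mod_1 v} \<subseteq> (\<Union>p\<in>P. cball p (real CARD('n) * \<rho>))"
    proof
      fix \<beta> assume "\<beta> \<in> {\<beta>\<in>unit_cube. y - \<beta> \<in> near_mod_1 v}"
      then have "\<exists>p\<in>Q i. \<bar>\<beta> $ i - p\<bar> \<le> \<rho>" for i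
        by (intro Q(3)) (auto simp: unit_cube_def near_mod_1_def)
      then obtain p where p: "\<And>i. p i \<in> Q i" "\<And>i. \<bar>\<beta> $ i - p i\<bar> \<le> \<rho>" by metis
      have "dist (vec_lambda p) \<beta> = norm (\<beta> - vec_lambda p)"
        by (simp add: dist_norm norm_minus_commute)
      also have "\<dots> \<le> (\<Sum>i\<in>UNIV. \<bar>(\<beta> - vec_lambda p) $ i\<bar>)" by (rule norm_le_l1_cart)
      also have "\<dots> \<le> (\<Sum>i\<in>(UNIV :: 'n set). \<rho>)" using p(2) by (intro sum_mono) simp
      finally have "\<beta> \<in> cball (vec_lambda p) (real CARD('n) * \<rho>)" by simp
      moreover have "vec_lambda p \<in> P" using p(1) by (auto simp: P_def)
      ultimately show "\<beta> \<in> (\<Union>p\<in>P. cball p (real CARD('n) * \<rho>))" by blast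
    qed
  qed
qed

context gauge_between_powers
begin

text \<open>Cover by a grid whose step is a half-side that attains the minimum in the content.\<close>
lemma hausdorff_premeasure_rectangle_le:
  fixes y v :: "real ^ 'n"
  assumes v: "\<And>i. 0 < v $ i" "\<And>i. 2 * real CARD('n) * v $ i \<le> \<eta>" and \<eta>: "0 < \<eta>"
  shows "hausdorff_premeasure f \<eta> {\<beta>\<in>unit_cube. y - \<beta> \<in> near_mod_1 v} \<le>
    ennreal (35 ^ CARD('n) * (2 * real CARD('n)) ^ (s + 1) * box_content f v)"
proof -
  let ?d = "real CARD('n)"
  obtain i where i: "box_content f v = box_cost f v (v $ i)" by (rule box_content_attained)
  let ?\<rho> = "v $ i"
  have d: "1 \<le> 2 * ?d" using zero_less_card_finite[where 'a='n] by linarith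
  obtain P :: "(real ^ 'n) set" where P: "finite P"
    "real (card P) \<le> 35 ^ CARD('n) * (\<Prod>i\<in>UNIV. max 1 (v $ i / ?\<rho>))"
    "{\<beta>\<in>unit_cube. y - \<beta> \<in> near_mod_1 v} \<subseteq> (\<Union>p\<in>P. cball p (?d * ?\<rho>))"
    using rectangle_near_mod_1_cover[where y = y and v = v and \<rho> = ?\<rho>, OF v(1) v(1)] by blast
  have "hausdorff_premeasure f \<eta> {\<beta>\<in>unit_cube. y - \<beta> \<in> near_mod_1 v} \<le> hausdorff_premeasure f \<eta> (\<Union>p\<in>P. cball p (?d * ?\<rho>))"
    by (rule hausdorff_premeasure_mono) (rule P)
  also have "\<dots> \<le> (\<integral>\<^sup>+p. hausdorff_premeasure f \<eta> (cball p (?d * ?\<rho>)) \<partial>count_space P)"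
    using P(1) by (intro hausdorff_premeasure_UN_countable[OF dim_fun \<eta>] countable_finite)
  also have "\<dots> \<le> (\<integral>\<^sup>+p. ennreal (f (2 * ?d * ?\<rho>)) \<partial>count_space P)"
  proof (rule nn_integral_mono)
    fix p :: "real ^ 'n"
    have "0 < ?d * ?\<rho>" using v(1)[of i] d by simp
    then have "hausdorff_premeasure f \<eta> (cball p (?d * ?\<rho>)) \<le> ennreal (f (diameter (cball p (?d * ?\<rho>))))"
      using v(2)[of i] by (intro hausdorff_premeasure_ball[OF dim_fun \<eta>] is_ball_cball) auto
    also have "diameter (cball p (?d * ?\<rho>)) = 2 * ?d * ?\<rho>" using \<open>0 < ?d * ?\<rho>\<close> by simp
    finally show "hausdorff_premeasure f \<eta> (cball p (?d * ?\<rho>)) \<le> ennreal (f (2 * ?d * ?\<rho>))" .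
  qed
  also have "\<dots> = ennreal (real (card P) * f (2 * ?d * ?\<rho>))"
    using P(1) by (simp add: nn_integral_count_space_finite ennreal_mult' ennreal_of_nat_eq_real_of_nat mult.commute)
  also have "\<dots> \<le> ennreal ((35 ^ CARD('n) * (\<Prod>i\<in>UNIV. max 1 (v $ i / ?\<rho>))) * ((2 * ?d) ^ (s + 1) * f ?\<rho>))"
    using P(2) f_scale[OF d v(1)[of i]] f_pos[of "2 * ?d * ?\<rho>"] v(1)[of i] d
    by (intro ennreal_leI mult_mono) (auto intro!: mult_nonneg_nonneg prod_nonneg less_imp_le)
  also have "(35 ^ CARD('n) * (\<Prod>i\<in>UNIV. max 1 (v $ i / ?\<rho>))) * ((2 * ?d) ^ (s + 1) * f ?\<rho>) =
    35 ^ CARD('n) * (2 * ?d) ^ (s + 1) * box_content f v"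
    unfolding i box_cost_def by (simp add: mult_ac)
  finally show ?thesis .
qed

lemma hausdorff_measure_limsup_rectangles_eq_0:
  fixes y r :: "nat \<Rightarrow> real ^ 'n"
  assumes r: "\<And>n i. 0 < r n $ i" and lim: "(\<lambda>n. infnorm (r n)) \<longlonglongrightarrow> 0"
    and sum: "summable (\<lambda>n. box_content f (r n))"
  shows "hausdorff_measure f {\<beta>\<in>unit_cube. infinite {n. y n - \<beta> \<in> near_mod_1 (r n)}} = 0"
proof (rule hausdorff_measure_eq_0I)
  let ?T = "{\<beta>\<in>unit_cube. infinite {n. y n - \<beta> \<in> near_mod_1 (r n)}}"
  fix \<eta> e :: real assume \<eta>: "0 < \<eta>" and e: "0 < e"
  define K where "K = 35 ^ CARD('n) * (2 * real CARD('n)) ^ (s + 1)"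
  define g where "g n = K * box_content f (r n)" for n
  have g_nonneg: "0 \<le> g n" for n
    using box_content_pos[of "r n"] r by (simp add: g_def K_def less_imp_le)
  have sum_g: "summable g" unfolding g_def using sum by (rule summable_mult)
  obtain N1 where N1: "\<And>n. n \<ge> N1 \<Longrightarrow> norm (\<Sum>i. g (i + n)) < e"
    using suminf_exist_split[OF e sum_g] by blast
  have d: "0 < 2 * real CARD('n)" by simp
  have "\<forall>\<^sub>F n in sequentially. infnorm (r n) < \<eta> / (2 * real CARD('n))"
    using lim \<eta> d by (intro order_tendstoD(2)[OF lim] divide_pos_pos)
  then obtain N2 where N2: "\<And>n. n \<ge> N2 \<Longrightarrow> infnorm (r n) < \<eta> / (2 * real CARD('n))"
    by (auto simp: eventually_sequentially)
  define N where "N = max N1 N2"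
  have small: "2 * real CARD('n) * r (n + N) $ i \<le> \<eta>" for n i
  proof -
    have le: "N2 \<le> n + N" by (simp add: N_def)
    have "r (n + N) $ i \<le> \<eta> / (2 * real CARD('n))"
      using component_le_infnorm_cart[of "r (n + N)" i] N2[OF le] by linarith
    then show ?thesis using d by (simp add: field_simps)
  qed
  have "?T \<subseteq> (\<Union>n. {\<beta>\<in>unit_cube. y (n + N) - \<beta> \<in> near_mod_1 (r (n + N))})"
  proof
    fix \<beta> assume \<beta>: "\<beta> \<in> ?T"
    then obtain m where "m \<ge> N" "y m - \<beta> \<in> near_mod_1 (r m)"
      by (auto simp: infinite_nat_iff_unbounded_le)
    then show "\<beta> \<in> (\<Union>n. {\<beta>\<in>unit_cube. y (n + N) - \<beta> \<in> near_mod_1 (r (n + N))})"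
      using \<beta> by (intro UN_I[of "m - N"]) auto
  qed
  then have "hausdorff_premeasure f \<eta> ?T \<le> hausdorff_premeasure f \<eta> (\<Union>n. {\<beta>\<in>unit_cube. y (n + N) - \<beta> \<in> near_mod_1 (r (n + N))})"
    by (rule hausdorff_premeasure_mono)
  also have "\<dots> \<le> (\<Sum>n. hausdorff_premeasure f \<eta> {\<beta>\<in>unit_cube. y (n + N) - \<beta> \<in> near_mod_1 (r (n + N))})"
    by (rule hausdorff_premeasure_countable_subadditive)
  also have "\<dots> \<le> (\<Sum>n. ennreal (g (n + N)))"
    unfolding g_def K_def
    by (intro suminf_le hausdorff_premeasure_rectangle_le r small \<eta> summableI)
  also have "\<dots> = ennreal (\<Sum>n. g (n + N))"
    using sum_g g_nonneg by (intro suminf_ennreal2) (auto simp: summable_iff_shift)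
  also have "\<dots> \<le> ennreal e"
    using N1[of N] by (intro ennreal_leI) (auto simp: N_def)
  finally show "hausdorff_premeasure f \<eta> ?T \<le> ennreal e" .
qed

end

section \<open>Enlarging boxes to the critical scale\<close>

lemma continuous_on_Min:
  fixes g :: "'i \<Rightarrow> 'a::topological_space \<Rightarrow> real"
  assumes "finite I" "I \<noteq> {}" "\<And>i. i \<in> I \<Longrightarrow> continuous_on S (g i)"
  shows "continuous_on S (\<lambda>x. Min ((\<lambda>i. g i x) ` I))"
  using assms
proof (induction I rule: finite_ne_induct)
  case (insert i I)
  then have "continuous_on S (\<lambda>x. min (g i x) (Min ((\<lambda>i. g i x) ` I)))"
    by (intro continuous_on_min) auto
  then show ?case using insert by simp
qed simp

context gauge_between_powers
begin

lemma box_content_le_gauge: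
  fixes v :: "real ^ 'n"
  assumes "s < CARD('n)" "\<And>i. 0 < v $ i" "\<And>i. v $ i \<le> \<rho>" "0 < \<rho>"
  shows "box_content f v \<le> f \<rho>"
proof -
  have "box_content f v \<le> box_cost f v \<rho>"
    using assms by (intro box_content_le_box_cost) auto
  also have "\<dots> = f \<rho>"
  proof -
    have "max 1 (v $ j / \<rho>) = 1" for j
      using assms(3)[of j] \<open>0 < \<rho>\<close> by (intro max_absorb1) simp
    then show ?thesis by (simp add: box_cost_def)
  qed
  finally show ?thesis .
qed

text \<open>Intermediate value theorem for the content of the truncated box minus \<open>c * l ^ d\<close>, where \<open>d\<close> is the
  dimension. At the shortest half-side \<open>m\<close> the truncated box is a cube of content \<open>f m \<ge> c * m ^ d\<close>; at
  \<open>l = 1\<close> it is the whole box, of content at most \<open>f \<rho> \<le> c\<close>. The last bound forces \<open>l\<close> to be small when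
  the box is.\<close>
lemma critical_scale:
  fixes v :: "real ^ 'n"
  assumes s: "s < CARD('n)" and v: "\<And>i. 0 < v $ i" "\<And>i. v $ i \<le> \<rho>" and \<rho>: "\<rho> \<le> 1"
    and large: "\<And>x. 0 < x \<Longrightarrow> x \<le> \<rho> \<Longrightarrow> c * x ^ CARD('n) \<le> f x" and small: "f \<rho> \<le> c"
  obtains l where "0 < l" "box_content f (\<chi> i. min (v $ i) l) = c * l ^ CARD('n)" "c * l ^ CARD('n) \<le> f \<rho>"
proof -
  define m where "m = Min (range (($) v))"
  have m_le: "m \<le> v $ i" for i by (simp add: m_def)
  have "m \<in> range (($) v)" unfolding m_def by (intro Min_in) auto
  then have m: "0 < m" "m \<le> \<rho>" using v by auto
  define g where "g l = box_content f (\<chi> i. min (v $ i) l) - c * l ^ CARD('n)" for l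
  have "continuous_on {m..1} (\<lambda>l. box_cost f (\<chi> i. min (v $ i) l) (min (v $ i) l))" for i
  proof -
    have "continuous_on {m..1} (\<lambda>l. f (min (v $ i) l))"
      using m v by (intro continuous_on_compose2[OF f_cont] continuous_intros) auto
    moreover have "continuous_on {m..1} (\<lambda>l. \<Prod>j\<in>UNIV. max 1 (min (v $ j) l / min (v $ i) l))"
      using m v less_imp_neq by (intro continuous_intros) (auto simp: min_def less_imp_neq[symmetric] dest: less_imp_neq)
    ultimately show ?thesis unfolding box_cost_def by (simp add: continuous_on_mult)
  qed
  then have "continuous_on {m..1} (\<lambda>l. box_content f (\<chi> i. min (v $ i) l))"
    unfolding box_content_def by (intro continuous_on_Min) auto
  then have cont: "continuous_on {m..1} g"
    unfolding g_def by (intro continuous_intros)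
  have "(\<chi> i. min (v $ i) m) = (\<chi> i. m)"
    using m_le by (simp add: vec_eq_iff min_absorb2)
  then have "box_content f (\<chi> i. min (v $ i) m) = f m"
    using m by (simp add: box_content_def box_cost_def)
  then have "0 \<le> g m" using large[OF m] by (simp add: g_def)
  moreover have "g 1 \<le> 0"
  proof -
    have "(\<chi> i. min (v $ i) 1) = v" using v(2) \<rho> by (simp add: vec_eq_iff min_def) (meson order_trans)
    then show ?thesis
      using box_content_le_gauge[OF s v] m small by (simp add: g_def)
  qed
  moreover have "m \<le> 1" using m \<rho> by simp
  ultimately obtain l where l: "m \<le> l" "l \<le> 1" "g l = 0"
    using IVT2'[of g 1 0 m] cont by auto
  show ?thesis
  proof (rule that[of l])
    show "0 < l" using l m by simp
    show eq: "box_content f (\<chi> i. min (v $ i) l) = c * l ^ CARD('n)" using l by (simp add: g_def)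
    show "c * l ^ CARD('n) \<le> f \<rho>"
      unfolding eq[symmetric] using v m l by (intro box_content_le_gauge s) (auto simp: min_le_iff_disj)
  qed
qed

text \<open>The enlarged box consists of one cube of volume \<open>l ^ d\<close> for each cell of size \<open>l\<close> of the original box,
  so this is subadditivity of the content at the critical scale.\<close>
lemma box_content_le_enlarged_volume:
  fixes v :: "real ^ 'n"
  assumes s: "s < CARD('n)" and v: "\<And>i. 0 < v $ i" and l: "0 < l"
    and eq: "box_content f (\<chi> i. min (v $ i) l) = c * l ^ CARD('n)"
  shows "box_content f v \<le> c * (\<Prod>i\<in>UNIV. max (v $ i) l)"
proof -
  have "l * max 1 (v $ i / l) = max (v $ i) l" for i
    using l by (simp add: max_def field_simps)
  then have "(\<Prod>i\<in>UNIV. max (v $ i) l) = (\<Prod>i\<in>(UNIV :: 'n set). l * max 1 (v $ i / l))" by simp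
  also have "\<dots> = l ^ CARD('n) * (\<Prod>i\<in>UNIV. max 1 (v $ i / l))" by (simp add: prod.distrib)
  finally show ?thesis
    using box_content_truncate[OF s v l] by (simp add: eq mult.assoc)
qed

end

lemma measure_box_Int_cball_le:
  fixes y m z :: "real ^ 'n"
  assumes m: "\<And>i. 0 < m $ i" and \<rho>: "0 < \<rho>"
  shows "measure lborel (box (y - m) (y + m) \<inter> cball z \<rho>) * (\<Prod>i\<in>UNIV. max 1 (m $ i / \<rho>)) \<le>
    measure lborel (box (y - m) (y + m))"
proof -
  define lo hi :: "real ^ 'n" where "lo = (\<chi> i. max (y $ i - m $ i) (z $ i - \<rho>))"
    and "hi = (\<chi> i. min (y $ i + m $ i) (z $ i + \<rho>))"
  have "\<bar>w $ i - z $ i\<bar> \<le> \<rho>" if "w \<in> cball z \<rho>" for w i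
    using component_le_norm_cart[of "w - z" i] that by (simp add: dist_norm norm_minus_commute)
  then have sub: "box (y - m) (y + m) \<inter> cball z \<rho> \<subseteq> cbox lo hi"
    by (fastforce simp: mem_box_cart lo_def hi_def abs_le_iff algebra_simps dest: less_imp_le)
  have "measure lborel (box (y - m) (y + m) \<inter> cball z \<rho>) \<le> measure lborel (cbox lo hi)"
    using sub emeasure_bounded_finite[of "cbox lo hi"]
    by (intro measure_mono_fmeasurable) (auto simp: fmeasurable_def)
  also have "\<dots> \<le> (\<Prod>i\<in>UNIV. 2 * min (m $ i) \<rho>)"
  proof (cases "cbox lo hi = {}")
    case True
    then show ?thesis using less_imp_le[OF m] \<rho> by (auto intro!: prod_nonneg)
  next
    case False
    then have "lo $ i \<le> hi $ i" for i by (simp add: interval_ne_empty_cart)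
    then have "(\<Prod>i\<in>UNIV. hi $ i - lo $ i) \<le> (\<Prod>i\<in>UNIV. 2 * min (m $ i) \<rho>)"
      by (intro prod_mono) (auto simp: lo_def hi_def min_def max_def)
    then show ?thesis using content_cbox_cart[OF False] by simp
  qed
  finally have "measure lborel (box (y - m) (y + m) \<inter> cball z \<rho>) * (\<Prod>i\<in>UNIV. max 1 (m $ i / \<rho>)) \<le>
      (\<Prod>i\<in>UNIV. 2 * min (m $ i) \<rho>) * (\<Prod>i\<in>UNIV. max 1 (m $ i / \<rho>))"
    by (intro mult_right_mono prod_nonneg) auto
  also have "\<dots> = (\<Prod>i\<in>UNIV. 2 * m $ i)"
  proof -
    have "2 * min (m $ i) \<rho> * max 1 (m $ i / \<rho>) = 2 * m $ i" for i
      using \<rho> by (simp add: min_def max_def field_simps)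
    then show ?thesis by (simp only: prod.distrib[symmetric])
  qed
  also have "\<dots> = measure lborel (box (y - m) (y + m))"
  proof -
    have ne: "cbox (y - m) (y + m) \<noteq> {}"
      using m by (auto simp: interval_ne_empty_cart intro: less_imp_le)
    have "emeasure lborel (box (y - m) (y + m)) = emeasure lborel (cbox (y - m) (y + m))"
      by (simp add: emeasure_lborel_box_eq emeasure_lborel_cbox_eq)
    then have "measure lborel (box (y - m) (y + m)) = measure lborel (cbox (y - m) (y + m))"
      by (simp add: measure_def)
    also have "\<dots> = (\<Prod>i\<in>UNIV. 2 * m $ i)"
      using content_cbox_cart[OF ne] by simp
    finally show ?thesis by simp
  qed
  finally show ?thesis .
qed

lemma gauge_piece_mono:
  assumes "gauge_piece f c' E y t" "c \<le> c'"
  shows "gauge_piece f c E y t"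
proof -
  have "c * measure lborel (cball y t) * measure lborel (E \<inter> cball z \<rho>) \<le>
    c' * measure lborel (cball y t) * measure lborel (E \<inter> cball z \<rho>)" for z \<rho>
    using assms(2) by (intro mult_right_mono) auto
  then show ?thesis
    using assms(1) unfolding gauge_piece_def by (meson order_trans)
qed

context gauge_between_powers
begin

text \<open>A point \<open>\<beta>\<close> of the enlarged box is within \<open>l\<close>, in each coordinate, of the centre of a cell of the
  original box with half-sides \<open>min (v $ i) l\<close>. This cell is a piece in a ball around \<open>\<beta>\<close> of radius
  comparable to \<open>l\<close>: its content \<open>box_content f m\<close> is \<open>c\<close> times the volume of that ball by the choice of
  scale, and the content is at most \<open>box_cost f m \<rho>\<close> for every \<open>\<rho>\<close>.\<close>
lemma gauge_piece_of_enlarged_rectangle: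
  fixes y0 \<beta> v :: "real ^ 'n"
  assumes s: "s < CARD('n)" and v: "\<And>i. 0 < v $ i" and l: "0 < l"
    and near: "y0 - \<beta> \<in> near_mod_1 (\<chi> i. max (v $ i) l)"
    and scale: "box_content f (\<chi> i. min (v $ i) l) =
      c * unit_ball_vol (real CARD('n)) * (2 * real CARD('n)) ^ CARD('n) * l ^ CARD('n)"
  obtains E y where "gauge_piece f c E y (2 * real CARD('n) * l)"
    "E \<subseteq> {\<beta>. y0 - \<beta> \<in> near_mod_1 v}" "\<beta> \<in> cball y (2 * real CARD('n) * l)"
proof -
  let ?d = "real CARD('n)"
  have d: "0 < ?d" by simp
  \<comment> \<open>\<open>X\<close> is the integer translate of \<open>y0\<close> closest to \<open>\<beta>\<close>. The centre \<open>y\<close> of the cell is \<open>X\<close> in the directions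
    where the box is shorter than \<open>l\<close>; in the others it is \<open>\<beta>\<close> itself, moved just enough to keep the cell
    inside the box.\<close>
  define X where "X = (\<chi> i. y0 $ i - of_int (round (y0 $ i - \<beta> $ i)))"
  define y :: "real ^ 'n" where
    "y = (\<chi> i. if v $ i \<le> l then X $ i else max (X $ i - v $ i + l) (min (X $ i + v $ i - l) (\<beta> $ i)))"
  define m where "m = (\<chi> i. min (v $ i) l)"
  have m: "0 < m $ i" "m $ i \<le> l" for i using v l by (auto simp: m_def)
  have X_near: "\<bar>X $ i - \<beta> $ i\<bar> \<le> max (v $ i) l" for i
  proof -
    have "dist_to_int (y0 $ i - \<beta> $ i) \<le> max (v $ i) l" using near by (simp add: near_mod_1_def)
    then show ?thesis by (simp add: X_def dist_to_int_def algebra_simps)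
  qed
  have y_near: "\<bar>\<beta> $ i - y $ i\<bar> \<le> l" and y_X: "\<bar>y $ i - X $ i\<bar> \<le> v $ i - m $ i" for i
  proof -
    have "\<bar>\<beta> $ i - y $ i\<bar> \<le> l \<and> \<bar>y $ i - X $ i\<bar> \<le> v $ i - m $ i"
    proof (cases "v $ i \<le> l")
      case True
      then show ?thesis using X_near[of i] by (simp add: y_def m_def abs_minus_commute)
    next
      case False
      then have "y $ i = max (X $ i - v $ i + l) (min (X $ i + v $ i - l) (\<beta> $ i))" "m $ i = l"
        by (simp_all add: y_def m_def)
      with False X_near[of i] l show ?thesis by linarith
    qed
    then show "\<bar>\<beta> $ i - y $ i\<bar> \<le> l" "\<bar>y $ i - X $ i\<bar> \<le> v $ i - m $ i" by simp_all
  qed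
  have norm_le: "norm w \<le> ?d * b" if "\<And>i. \<bar>w $ i\<bar> \<le> b" for w :: "real ^ 'n" and b
  proof -
    have "norm w \<le> (\<Sum>i\<in>UNIV. \<bar>w $ i\<bar>)" by (rule norm_le_l1_cart)
    also have "\<dots> \<le> (\<Sum>i\<in>(UNIV :: 'n set). b)" using that by (intro sum_mono) simp
    finally show ?thesis by simp
  qed
  define E where "E = box (y - m) (y + m)"
  have E_iff: "w \<in> E \<longleftrightarrow> (\<forall>i. \<bar>w $ i - y $ i\<bar> < m $ i)" for w
    by (auto simp: E_def mem_box_cart abs_less_iff algebra_simps)
  show ?thesis
  proof (rule that[of E y])
    show "\<beta> \<in> cball y (2 * ?d * l)"
    proof -
      have "norm (\<beta> - y) \<le> ?d * l" using y_near by (intro norm_le) simp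
      also have "\<dots> \<le> 2 * ?d * l" using d l by simp
      finally show ?thesis by (simp add: dist_norm norm_minus_commute)
    qed
    show "E \<subseteq> {\<beta>. y0 - \<beta> \<in> near_mod_1 v}"
    proof
      fix w assume w: "w \<in> E"
      have "dist_to_int (y0 $ i - w $ i) \<le> v $ i" for i
      proof -
        have "dist_to_int (y0 $ i - w $ i) \<le> \<bar>y0 $ i - w $ i - of_int (round (y0 $ i - \<beta> $ i))\<bar>"
          unfolding dist_to_int_def by (rule round_diff_minimal)
        also have "\<dots> = \<bar>X $ i - w $ i\<bar>" by (simp add: X_def algebra_simps)
        also have "\<dots> \<le> v $ i" using w[unfolded E_iff, rule_format, of i] y_X[of i] by linarith
        finally show ?thesis .
      qed
      then show "w \<in> {\<beta>. y0 - \<beta> \<in> near_mod_1 v}" by (simp add: near_mod_1_def)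
    qed
    show "gauge_piece f c E y (2 * ?d * l)"
      unfolding gauge_piece_def
    proof (intro conjI allI impI)
      show "open E" unfolding E_def by (rule open_box)
      have "y \<in> E" using m by (simp add: E_iff)
      then show "E \<noteq> {}" by blast
      show "0 < 2 * ?d * l" using d l by simp
      show "E \<subseteq> cball y (2 * ?d * l / 2)"
      proof
        fix w assume w: "w \<in> E"
        have "\<bar>(w - y) $ i\<bar> \<le> l" for i
          using w[unfolded E_iff, rule_format, of i] m(2)[of i] by simp
        then have "norm (w - y) \<le> ?d * l" by (rule norm_le)
        then show "w \<in> cball y (2 * ?d * l / 2)" by (simp add: dist_norm norm_minus_commute)
      qed
      fix z and \<rho> :: real assume \<rho>: "0 < \<rho>"
      have "c * measure lborel (cball y (2 * ?d * l)) = box_content f m"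
        using l unfolding m_def scale by (simp add: measure_lborel_cball power_mult_distrib)
      also have "\<dots> \<le> f \<rho> * (\<Prod>i\<in>UNIV. max 1 (m $ i / \<rho>))"
        using box_content_le_box_cost[OF s m(1) \<rho>] by (simp add: box_cost_def)
      finally have "c * measure lborel (cball y (2 * ?d * l)) * measure lborel (E \<inter> cball z \<rho>) \<le>
          f \<rho> * (\<Prod>i\<in>UNIV. max 1 (m $ i / \<rho>)) * measure lborel (E \<inter> cball z \<rho>)"
        by (intro mult_right_mono) auto
      also have "\<dots> = f \<rho> * (measure lborel (E \<inter> cball z \<rho>) * (\<Prod>i\<in>UNIV. max 1 (m $ i / \<rho>)))"
        by simp
      also have "\<dots> \<le> f \<rho> * measure lborel E"
        unfolding E_def using f_pos[OF \<rho>] by (intro mult_left_mono measure_box_Int_cball_le m \<rho>) auto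
      finally show "c * measure lborel (cball y (2 * ?d * l)) * measure lborel (E \<inter> cball z \<rho>) \<le> f \<rho> * measure lborel E" .
    qed
  qed
qed

end

section \<open>Divergent costs\<close>

context gauge_between_powers
begin

text \<open>For the finitely many indices without a suitable critical scale the radii are left unchanged.\<close>
lemma enlarged_radii:
  fixes r :: "nat \<Rightarrow> real ^ 'n"
  assumes s: "s < CARD('n)" and r: "\<And>n i. 0 < r n $ i \<and> r n $ i < 1 / 2"
    and lim: "(\<lambda>n. infnorm (r n)) \<longlonglongrightarrow> 0"
    and large: "\<And>C. \<exists>\<rho>0>0. \<forall>\<rho>. 0 < \<rho> \<longrightarrow> \<rho> < \<rho>0 \<longrightarrow> C * \<rho> ^ CARD('n) \<le> f \<rho>"
    and div: "\<not> summable (\<lambda>n. box_content f (r n))" and c: "0 < c"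
  obtains u where "\<And>n i. 0 < u n $ i \<and> u n $ i < 1 / 2" "\<not> summable (\<lambda>n. \<Prod>i\<in>UNIV. u n $ i)"
    "\<And>\<delta>. 0 < \<delta> \<Longrightarrow> \<forall>\<^sub>F n in sequentially. \<exists>l>0. l < \<delta> \<and> u n = (\<chi> i. max (r n $ i) l) \<and>
      box_content f (\<chi> i. min (r n $ i) l) = c * l ^ CARD('n)"
proof -
  let ?d = "CARD('n)"
  define \<rho> where "\<rho> n = infnorm (r n)" for n
  have r_le: "r n $ i \<le> \<rho> n" for n i
    using component_le_infnorm_cart[of "r n" i] by (simp add: \<rho>_def)
  have \<rho>_pos: "0 < \<rho> n" for n using r r_le less_le_trans by blast
  have "\<rho> \<longlonglongrightarrow> 0" using lim by (simp add: \<rho>_def[abs_def])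
  then have "filterlim \<rho> (at_right 0) sequentially"
    using \<rho>_pos by (intro tendsto_imp_filterlim_at_right) auto
  then have f\<rho>: "(\<lambda>n. f (\<rho> n)) \<longlonglongrightarrow> 0"
    by (rule filterlim_compose[OF f_tendsto_0])
  have f\<rho>_small: "\<forall>\<^sub>F n in sequentially. f (\<rho> n) < c * \<delta> ^ ?d" if "0 < \<delta>" for \<delta>
    using that c by (intro order_tendstoD(2)[OF f\<rho>]) simp
  have l_less: "l < \<delta>" if "c * l ^ ?d \<le> f (\<rho> n)" "f (\<rho> n) < c * \<delta> ^ ?d" "0 < \<delta>" for l \<delta> n
  proof -
    have "c * l ^ ?d < c * \<delta> ^ ?d" using that(1,2) by (rule le_less_trans)
    then have "l ^ ?d < \<delta> ^ ?d" by (simp only: mult_less_cancel_left_pos[OF c])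
    then show ?thesis by (rule power_less_imp_less_base) (rule less_imp_le[OF that(3)])
  qed
  define Good where "Good n l \<longleftrightarrow> 0 < l \<and> l < 1 / 2 \<and> box_content f (\<chi> i. min (r n $ i) l) = c * l ^ ?d \<and>
    c * l ^ ?d \<le> f (\<rho> n)" for n l
  obtain \<rho>0 where \<rho>0: "0 < \<rho>0" "\<And>x. 0 < x \<Longrightarrow> x < \<rho>0 \<Longrightarrow> c * x ^ ?d \<le> f x"
    using large[of c] by blast
  have "\<forall>\<^sub>F n in sequentially. \<rho> n < min 1 \<rho>0"
    using \<rho>0(1) by (intro order_tendstoD(2)[OF lim[folded \<rho>_def]]) simp
  moreover have "\<forall>\<^sub>F n in sequentially. f (\<rho> n) < c * 1 ^ ?d" by (rule f\<rho>_small) simp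
  moreover have "\<forall>\<^sub>F n in sequentially. f (\<rho> n) < c * (1 / 2) ^ ?d" by (rule f\<rho>_small) simp
  ultimately have ev_Good: "\<forall>\<^sub>F n in sequentially. \<exists>l. Good n l"
  proof eventually_elim
    case (elim n)
    obtain l where "0 < l" "box_content f (\<chi> i. min (r n $ i) l) = c * l ^ ?d" "c * l ^ ?d \<le> f (\<rho> n)"
    proof (rule critical_scale[OF s, of "r n" "\<rho> n" c])
      show "c * x ^ ?d \<le> f x" if "0 < x" "x \<le> \<rho> n" for x
        using that elim by (intro \<rho>0(2)) auto
    qed (use r r_le elim in auto)
    then show ?case
      using l_less[of l n "1 / 2"] elim by (auto simp: Good_def)
  qed
  define l where "l n = (SOME l. Good n l)" for n
  define u where "u n = (if \<exists>l. Good n l then \<chi> i. max (r n $ i) (l n) else r n)" for n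
  have l: "Good n (l n)" if "\<exists>l. Good n l" for n
    unfolding l_def using that by (rule someI_ex)
  show ?thesis
  proof (rule that[of u])
    show "0 < u n $ i \<and> u n $ i < 1 / 2" for n i
    proof (cases "\<exists>l. Good n l")
      case True
      then show ?thesis using l[OF True] r[of n i] by (auto simp: u_def Good_def)
    next
      case False
      then show ?thesis using r[of n i] by (simp add: u_def)
    qed
    show "\<forall>\<^sub>F n in sequentially. \<exists>l>0. l < \<delta> \<and> u n = (\<chi> i. max (r n $ i) l) \<and>
      box_content f (\<chi> i. min (r n $ i) l) = c * l ^ CARD('n)" if "0 < \<delta>" for \<delta>
      using ev_Good f\<rho>_small[OF that]
    proof eventually_elim
      case (elim n)
      then show ?case
        using l[of n] l_less[OF _ _ that, of "l n" n] by (intro exI[of _ "l n"]) (auto simp: Good_def u_def)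
    qed
    show "\<not> summable (\<lambda>n. \<Prod>i\<in>UNIV. u n $ i)"
    proof
      assume *: "summable (\<lambda>n. \<Prod>i\<in>UNIV. u n $ i)"
      have "\<forall>\<^sub>F n in sequentially. norm (box_content f (r n)) \<le> c * (\<Prod>i\<in>UNIV. u n $ i)"
        using ev_Good
      proof eventually_elim
        case (elim n)
        have "box_content f (r n) \<le> c * (\<Prod>i\<in>UNIV. max (r n $ i) (l n))"
          using l[OF elim] r by (intro box_content_le_enlarged_volume[OF s]) (auto simp: Good_def)
        moreover have "0 < box_content f (r n)" using r by (intro box_content_pos) auto
        ultimately show ?case using elim by (simp add: u_def)
      qed
      then have "summable (\<lambda>n. box_content f (r n))"
        by (rule summable_comparison_test_ev) (intro summable_mult *)
      with div show False ..
    qed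
  qed
qed

text \<open>The exceptional null set of \<open>\<alpha>\<close> depends on the radii to which the covering theorem is applied, hence on
  the constant \<open>c\<close> of the pieces. Since a piece for a larger constant is a piece for a smaller one, it is
  enough to use the countably many constants \<open>Suc k\<close>.\<close>
lemma AE_hausdorff_measure_eq_infinity:
  fixes r :: "nat \<Rightarrow> real ^ 'n" and A :: "nat \<Rightarrow> int ^ 'n ^ 'n"
  assumes s: "s < CARD('n)" and r: "\<And>n i. 0 < r n $ i \<and> r n $ i < 1 / 2"
    and lim: "(\<lambda>n. infnorm (r n)) \<longlonglongrightarrow> 0"
    and det: "\<And>m n. m \<noteq> n \<Longrightarrow> det (A m - A n) \<noteq> 0"
    and large: "\<And>C. \<exists>\<rho>0>0. \<forall>\<rho>. 0 < \<rho> \<longrightarrow> \<rho> < \<rho>0 \<longrightarrow> C * \<rho> ^ CARD('n) \<le> f \<rho>"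
    and div: "\<not> summable (\<lambda>n. box_content f (r n))"
  shows "AE \<alpha> in lborel. \<alpha> \<in> unit_cube \<longrightarrow> hausdorff_measure f
    {\<beta>\<in>unit_cube. infinite {n. map_matrix real_of_int (A n) *v \<alpha> - \<beta> \<in> near_mod_1 (r n)}} = \<infinity>"
proof -
  let ?d = "real CARD('n)"
  \<comment> \<open>\<open>\<gamma> * l ^ d\<close> is the volume of a ball of radius \<open>2 * d * l\<close>.\<close>
  define \<gamma> where "\<gamma> = unit_ball_vol ?d * (2 * ?d) ^ CARD('n)"
  have \<gamma>: "0 < \<gamma>" by (simp add: \<gamma>_def)
  define enlarges where "enlarges k u \<longleftrightarrow> (\<forall>n i. 0 < u n $ i \<and> u n $ i < 1 / 2) \<and>
    \<not> summable (\<lambda>n. \<Prod>i\<in>UNIV. u n $ i) \<and>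
    (\<forall>\<delta>>0. \<forall>\<^sub>F n in sequentially. \<exists>l>0. l < \<delta> \<and> u n = (\<chi> i. max (r n $ i) l) \<and>
      box_content f (\<chi> i. min (r n $ i) l) = real (Suc k) * \<gamma> * l ^ CARD('n))"
    for k and u :: "nat \<Rightarrow> real ^ 'n"
  have "\<exists>u. enlarges k u" for k
  proof -
    have "0 < real (Suc k) * \<gamma>" using \<gamma> by simp
    then show ?thesis
    proof (rule enlarged_radii[OF s r lim large div])
      fix u :: "nat \<Rightarrow> real ^ 'n"
      assume "\<And>n i. 0 < u n $ i \<and> u n $ i < 1 / 2" "\<not> summable (\<lambda>n. \<Prod>i\<in>UNIV. u n $ i)"
        "\<And>\<delta>. 0 < \<delta> \<Longrightarrow> \<forall>\<^sub>F n in sequentially. \<exists>l>0. l < \<delta> \<and> u n = (\<chi> i. max (r n $ i) l) \<and>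
          box_content f (\<chi> i. min (r n $ i) l) = real (Suc k) * \<gamma> * l ^ CARD('n)"
      then have "enlarges k u" unfolding enlarges_def by blast
      then show ?thesis by (rule exI[of _ u])
    qed
  qed
  then obtain u where enl: "\<And>k. enlarges k (u k)" by metis
  note u = enl[unfolded enlarges_def, THEN conjunct1, rule_format]
    enl[unfolded enlarges_def, THEN conjunct2, THEN conjunct1]
    enl[unfolded enlarges_def, THEN conjunct2, THEN conjunct2, rule_format]
  have "AE \<alpha> in lborel. \<forall>k. \<alpha> \<in> unit_cube \<longrightarrow> (AE \<beta> in lborel. \<beta> \<in> unit_cube \<longrightarrow>
    infinite {n. map_matrix real_of_int (A n) *v \<alpha> - \<beta> \<in> near_mod_1 (u k n)})"
    unfolding AE_all_countable by (intro allI AE_infinitely_often_near_mod_1 det u)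
  then show ?thesis
  proof eventually_elim
    case (elim \<alpha>)
    show ?case
    proof
      assume \<alpha>: "\<alpha> \<in> unit_cube"
      define y where "y n = map_matrix real_of_int (A n) *v \<alpha>" for n
      define W where "W n = {\<beta>. y n - \<beta> \<in> near_mod_1 (r n)}" for n
      let ?U = "box 0 (1 :: real ^ 'n)"
      have U_sub: "?U \<subseteq> unit_cube"
        by (auto simp: mem_box_cart unit_cube_def less_imp_le)
      have "hausdorff_measure f {x\<in>?U. infinite {n. x \<in> W n}} = \<infinity>"
      proof (rule mass_transference_gauge_pieces[OF f_pos f_mono])
        show "\<exists>\<rho>0>0. \<forall>\<rho>. 0 < \<rho> \<longrightarrow> \<rho> < \<rho>0 \<longrightarrow> C * \<rho> ^ DIM(real ^ 'n) \<le> f \<rho>" for C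
          using large[of C] by simp
        show "open ?U" by (rule open_box)
        show "bounded ?U" by (rule bounded_box)
        have "(\<chi> i. 1 / 2) \<in> ?U" by (simp add: mem_box_cart)
        then show "?U \<noteq> {}" by blast
        fix c :: real and N :: nat assume "0 < c"
        define k where "k = nat \<lceil>c\<rceil>"
        have k: "c \<le> real (Suc k)" unfolding k_def by linarith
        have "AE x in lborel. x \<in> unit_cube \<longrightarrow> infinite {n. y n - x \<in> near_mod_1 (u k n)}"
          using elim \<alpha> by (simp add: y_def)
        then show "AE x in lborel. x \<in> ?U \<longrightarrow>
          (\<forall>\<delta>>0. \<exists>E y t. gauge_piece f c E y t \<and> (\<exists>n\<ge>N. E \<subseteq> W n) \<and> x \<in> cball y t \<and> t < \<delta>)"
        proof eventually_elim
          case (elim x)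
          show ?case
          proof (intro impI allI)
            fix \<delta> :: real assume x: "x \<in> ?U" and \<delta>: "0 < \<delta>"
            have "0 < \<delta> / (2 * ?d)" using \<delta> by simp
            from u(3)[OF this, of k] obtain M where M: "\<And>n. n \<ge> M \<Longrightarrow> \<exists>l>0. l < \<delta> / (2 * ?d) \<and>
                u k n = (\<chi> i. max (r n $ i) l) \<and>
                box_content f (\<chi> i. min (r n $ i) l) = real (Suc k) * \<gamma> * l ^ CARD('n)"
              unfolding eventually_sequentially by blast
            have "infinite {n. y n - x \<in> near_mod_1 (u k n)}" using elim x U_sub by blast
            then obtain n where n: "n \<ge> max M N" "y n - x \<in> near_mod_1 (u k n)"
              unfolding infinite_nat_iff_unbounded_le by blast
            then obtain l where l: "0 < l" "l < \<delta> / (2 * ?d)" "u k n = (\<chi> i. max (r n $ i) l)"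
                "box_content f (\<chi> i. min (r n $ i) l) = real (Suc k) * \<gamma> * l ^ CARD('n)"
              using M[of n] by auto
            obtain E z where E: "gauge_piece f (real (Suc k)) E z (2 * ?d * l)"
                "E \<subseteq> {\<beta>. y n - \<beta> \<in> near_mod_1 (r n)}" "x \<in> cball z (2 * ?d * l)"
            proof (rule gauge_piece_of_enlarged_rectangle[OF s])
              show "0 < r n $ i" for i using r by simp
              show "y n - x \<in> near_mod_1 (\<chi> i. max (r n $ i) l)" using n(2) l(3) by simp
              show "box_content f (\<chi> i. min (r n $ i) l) =
                  real (Suc k) * unit_ball_vol ?d * (2 * ?d) ^ CARD('n) * l ^ CARD('n)"
                using l(4) by (simp add: \<gamma>_def mult.assoc)
            qed (use l in auto)
            have "2 * ?d * l < \<delta>" using l(2) by (simp add: field_simps)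
            then show "\<exists>E y t. gauge_piece f c E y t \<and> (\<exists>n\<ge>N. E \<subseteq> W n) \<and> x \<in> cball y t \<and> t < \<delta>"
              using gauge_piece_mono[OF E(1) k] E(2,3) n(1)
              by (intro exI[of _ E] exI[of _ z] exI[of _ "2 * ?d * l"]) (auto simp: W_def)
          qed
        qed
      qed
      moreover have "hausdorff_measure f {x\<in>?U. infinite {n. x \<in> W n}} \<le>
          hausdorff_measure f {\<beta>\<in>unit_cube. infinite {n. y n - \<beta> \<in> near_mod_1 (r n)}}"
        using U_sub by (intro hausdorff_measure_mono) (auto simp: W_def)
      ultimately show "hausdorff_measure f
          {\<beta>\<in>unit_cube. infinite {n. map_matrix real_of_int (A n) *v \<alpha> - \<beta> \<in> near_mod_1 (r n)}} = \<infinity>"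
        by (simp add: y_def top_unique)
    qed
  qed
qed

text \<open>At the shortest half-side the cost of a box is at most \<open>C\<close> times the product of its half-sides, so
  the volumes of the boxes have divergent sum together with the contents.\<close>
lemma AE_hausdorff_measure_eq_full:
  fixes r :: "nat \<Rightarrow> real ^ 'n" and A :: "nat \<Rightarrow> int ^ 'n ^ 'n"
  assumes r: "\<And>n i. 0 < r n $ i \<and> r n $ i < 1 / 2"
    and det: "\<And>m n. m \<noteq> n \<Longrightarrow> det (A m - A n) \<noteq> 0"
    and bounded: "\<And>x. 0 < x \<Longrightarrow> f x \<le> C * x ^ CARD('n)"
    and div: "\<not> summable (\<lambda>n. box_content f (r n))"
  shows "AE \<alpha> in lborel. \<alpha> \<in> unit_cube \<longrightarrow> hausdorff_measure f
    {\<beta>\<in>unit_cube. infinite {n. map_matrix real_of_int (A n) *v \<alpha> - \<beta> \<in> near_mod_1 (r n)}} =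
    hausdorff_measure f (unit_cube :: (real ^ 'n) set)"
proof -
  have "\<not> summable (\<lambda>n. \<Prod>i\<in>UNIV. r n $ i)"
  proof
    assume *: "summable (\<lambda>n. \<Prod>i\<in>UNIV. r n $ i)"
    have "norm (box_content f (r n)) \<le> C * (\<Prod>i\<in>UNIV. r n $ i)" for n
    proof -
      have "Min (range (($) (r n))) \<in> range (($) (r n))" by (intro Min_in) auto
      then obtain i where "Min (range (($) (r n))) = r n $ i" by (rule imageE)
      then have i: "r n $ i \<le> r n $ j" for j by (metis Min_le finite finite_imageI rangeI)
      have ri: "0 < r n $ i" using r by simp
      have "box_content f (r n) \<le> box_cost f (r n) (r n $ i)" by (rule box_content_le)
      also have "\<dots> = f (r n $ i) * (\<Prod>j\<in>UNIV. r n $ j / r n $ i)"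
        using i ri by (simp add: box_cost_def max_absorb2)
      also have "\<dots> \<le> (C * (r n $ i) ^ CARD('n)) * (\<Prod>j\<in>UNIV. r n $ j / r n $ i)"
        using bounded[OF ri] r by (intro mult_right_mono prod_nonneg) (auto intro!: divide_nonneg_nonneg simp: less_imp_le)
      also have "\<dots> = C * (\<Prod>i\<in>UNIV. r n $ i)"
        using ri by (simp add: prod_dividef)
      finally show ?thesis using box_content_pos[of "r n"] r by simp
    qed
    then have "summable (\<lambda>n. box_content f (r n))"
      by (rule summable_comparison_test'[OF summable_mult[OF *]])
    with div show False ..
  qed
  with det r have "AE \<alpha> in lborel. \<alpha> \<in> unit_cube \<longrightarrow> (AE \<beta> in lborel. \<beta> \<in> unit_cube \<longrightarrow>
      infinite {n. map_matrix real_of_int (A n) *v \<alpha> - \<beta> \<in> near_mod_1 (r n)})"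
    by (rule AE_infinitely_often_near_mod_1)
  then show ?thesis
  proof eventually_elim
    case (elim \<alpha>)
    show ?case
    proof
      assume "\<alpha> \<in> unit_cube"
      let ?C = "unit_cube :: (real ^ 'n) set"
      let ?T = "{\<beta>\<in>?C. infinite {n. map_matrix real_of_int (A n) *v \<alpha> - \<beta> \<in> near_mod_1 (r n)}}"
      have "AE \<beta> in lebesgue. \<beta> \<notin> ?C - ?T"
        using elim \<open>\<alpha> \<in> unit_cube\<close> unfolding AE_completion_iff by (elim impE) (auto elim: eventually_mono)
      moreover have "?C - ?T = {\<beta>\<in>?C. finite {n. map_matrix real_of_int (A n) *v \<alpha> - \<beta> \<in> near_mod_1 (r n)}}"
        by auto
      ultimately have "?C - ?T \<in> null_sets lebesgue"
        by (simp add: completion.AE_iff_null_sets)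
      then have null: "hausdorff_measure f (?C - ?T) = 0"
        using bounded by (intro hausdorff_measure_null_set[OF dim_fun, of C]) auto
      have "hausdorff_measure f ?C \<le> hausdorff_measure f (?T \<union> (?C - ?T))"
        by (rule hausdorff_measure_mono) auto
      also have "\<dots> \<le> hausdorff_measure f ?T + hausdorff_measure f (?C - ?T)"
        by (rule hausdorff_measure_Un[OF dim_fun])
      finally have "hausdorff_measure f ?C \<le> hausdorff_measure f ?T" by (simp add: null)
      moreover have "hausdorff_measure f ?T \<le> hausdorff_measure f ?C"
        by (rule hausdorff_measure_mono) auto
      ultimately show "hausdorff_measure f ?T = hausdorff_measure f ?C" by simp
    qed
  qed
qed

text \<open>As \<open>s < d\<close>, the quotient \<open>f x / x ^ d\<close> is nonincreasing, so it is either bounded or tends to infinity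
  at 0.\<close>
lemma growth_dichotomy:
  assumes s: "s < d"
  obtains C where "\<And>x. 0 < x \<Longrightarrow> f x \<le> C * x ^ d"
  | "\<And>C. \<exists>\<rho>0>0. \<forall>\<rho>. 0 < \<rho> \<longrightarrow> \<rho> < \<rho>0 \<longrightarrow> C * \<rho> ^ d \<le> f \<rho>"
proof (cases "\<exists>C. \<forall>x>0. f x \<le> C * x ^ d")
  case True
  then show ?thesis using that(1) by blast
next
  case False
  have "\<exists>\<rho>0>0. \<forall>\<rho>. 0 < \<rho> \<longrightarrow> \<rho> < \<rho>0 \<longrightarrow> C * \<rho> ^ d \<le> f \<rho>" for C
  proof -
    obtain x where x: "0 < x" "C * x ^ d < f x" using False by (auto simp: not_le)
    have "C * \<rho> ^ d \<le> f \<rho>" if \<rho>: "0 < \<rho>" "\<rho> < x" for \<rho>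
    proof -
      have "C \<le> f x / x ^ d" using x by (simp add: field_simps)
      also have "\<dots> \<le> f \<rho> / \<rho> ^ d" using \<rho> s by (intro quotient_antimono) auto
      finally show ?thesis using \<rho> by (simp add: field_simps)
    qed
    then show ?thesis using x(1) by blast
  qed
  then show ?thesis by (rule that(2))
qed

lemma AE_hausdorff_measure_limsup_rectangles:
  fixes r :: "nat \<Rightarrow> real ^ 'n" and A :: "nat \<Rightarrow> int ^ 'n ^ 'n"
  assumes s: "s < CARD('n)" and r: "\<And>n i. 0 < r n $ i \<and> r n $ i < 1 / 2"
    and lim: "(\<lambda>n. infnorm (r n)) \<longlonglongrightarrow> 0"
    and det: "\<And>m n. m \<noteq> n \<Longrightarrow> det (A m - A n) \<noteq> 0"
  shows "AE \<alpha> in lborel. \<alpha> \<in> unit_cube \<longrightarrow> hausdorff_measure f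
    {\<beta>\<in>unit_cube. infinite {n. map_matrix real_of_int (A n) *v \<alpha> - \<beta> \<in> near_mod_1 (r n)}} =
    (if summable (\<lambda>n. box_content f (r n)) then 0 else hausdorff_measure f (unit_cube :: (real ^ 'n) set))"
proof (cases "summable (\<lambda>n. box_content f (r n))")
  case True
  then show ?thesis
    using hausdorff_measure_limsup_rectangles_eq_0[OF conjunct1[OF r] lim True] by simp
next
  case div: False
  from s show ?thesis
  proof (cases rule: growth_dichotomy)
    case (1 C)
    from r det 1 div have "AE \<alpha> in lborel. \<alpha> \<in> unit_cube \<longrightarrow> hausdorff_measure f
      {\<beta>\<in>unit_cube. infinite {n. map_matrix real_of_int (A n) *v \<alpha> - \<beta> \<in> near_mod_1 (r n)}} =
      hausdorff_measure f (unit_cube :: (real ^ 'n) set)"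
      by (rule AE_hausdorff_measure_eq_full)
    then show ?thesis using div by simp
  next
    case 2
    from s r lim det 2 div have "AE \<alpha> in lborel. \<alpha> \<in> unit_cube \<longrightarrow> hausdorff_measure f
      {\<beta>\<in>unit_cube. infinite {n. map_matrix real_of_int (A n) *v \<alpha> - \<beta> \<in> near_mod_1 (r n)}} = \<infinity>"
      by (rule AE_hausdorff_measure_eq_infinity)
    then show ?thesis
    proof eventually_elim
      case (elim \<alpha>)
      show ?case
      proof
        assume "\<alpha> \<in> unit_cube"
        let ?C = "unit_cube :: (real ^ 'n) set"
        let ?T = "{\<beta>\<in>?C. infinite {n. map_matrix real_of_int (A n) *v \<alpha> - \<beta> \<in> near_mod_1 (r n)}}"
        have T: "hausdorff_measure f ?T = \<infinity>" using elim \<open>\<alpha> \<in> unit_cube\<close> by simp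
        have "hausdorff_measure f ?T \<le> hausdorff_measure f ?C" by (rule hausdorff_measure_mono) auto
        then show "hausdorff_measure f ?T =
            (if summable (\<lambda>n. box_content f (r n)) then 0 else hausdorff_measure f ?C)"
          using T div by (simp add: top_unique)
      qed
    qed
  qed
qed

end

lemma twisted_set_Suc:
  "twisted_set \<alpha> A r = {\<beta>\<in>unit_cube. infinite {n. map_matrix real_of_int (A (Suc n)) *v \<alpha> - \<beta> \<in> near_mod_1 (r (Suc n))}}"
proof -
  have "infinite {n. n \<ge> 1 \<and> P n} \<longleftrightarrow> infinite {n. P (Suc n)}" for P
  proof -
    have "{n. n \<ge> 1 \<and> P n} = Suc ` {n. P (Suc n)}"
      by (auto simp: image_iff) (metis Suc_pred' Suc_le_eq)
    then show ?thesis by (simp add: finite_image_iff)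
  qed
  then show ?thesis
    unfolding twisted_set_eq near_mod_1_def by simp
qed

theorem theorem11:
  fixes r :: "nat \<Rightarrow> real ^ 'n" and A :: "nat \<Rightarrow> int ^ 'n ^ 'n"
    and f :: "real \<Rightarrow> real" and s :: int
  assumes r_range: "\<And>n i. n \<ge> 1 \<Longrightarrow> 0 < r n $ i \<and> r n $ i < 1 / 2"
    and r_tendsto: "(\<lambda>n. infnorm (r n)) \<longlonglongrightarrow> 0"
    and det_nonzero: "\<And>m n. m \<ge> 1 \<Longrightarrow> n \<ge> 1 \<Longrightarrow> m \<noteq> n \<Longrightarrow> det (A m - A n) \<noteq> 0"
    and f_dim: "dimension_function f"
    and s_range: "0 \<le> s" "s \<le> int CARD('n) - 1"
    and f_growth: "preceq_fun (real_of_int s) f" "fun_preceq f (real_of_int (s + 1))"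
  shows "AE \<alpha> \<in> unit_cube in lebesgue.
           hausdorff_measure f (twisted_set \<alpha> A r) =
             (if summable (\<lambda>n. s_coeff r f (Suc n)) then 0
              else hausdorff_measure f (unit_cube :: (real ^ 'n) set))"
proof -
  define s' where "s' = nat s"
  have s': "real_of_int s = real s'" "real_of_int (s + 1) = real (s' + 1)" "s' < CARD('n)"
    using s_range by (auto simp: s'_def)
  interpret gauge_between_powers f s'
    using f_dim f_growth unfolding s' by unfold_locales
  have "s_coeff r f (Suc n) = box_content f (r (Suc n))" for n
    using r_range by (intro s_coeff_eq_box_content) auto
  moreover have "AE \<alpha> in lborel. \<alpha> \<in> unit_cube \<longrightarrow> hausdorff_measure f
    {\<beta>\<in>unit_cube. infinite {n. map_matrix real_of_int (A (Suc n)) *v \<alpha> - \<beta> \<in> near_mod_1 (r (Suc n))}} =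
    (if summable (\<lambda>n. box_content f (r (Suc n))) then 0 else hausdorff_measure f (unit_cube :: (real ^ 'n) set))"
    using r_range det_nonzero LIMSEQ_Suc[OF r_tendsto]
    by (intro AE_hausdorff_measure_limsup_rectangles s') auto
  ultimately show ?thesis
    by (simp add: AE_completion_iff twisted_set_Suc)
qed

end
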